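(* Let $\mathcal{L}$ be a translation-invariant Lévy operator with kernel $\widetilde J$, and let $u$ be the solution of $\partial_tu+\mathcal{L}u=0$, $u(0)=u_0$, with initial data $u_0\in L^2(\mathbb{R}^N)\cap L^p(\mathbb{R}^N)$ for some $p\ge1$. Assume that $\widetilde J(z)\ge\widetilde J_{\log}(z)$ for $|z|<1$. Then $u(t)\in L^2_{2t}(\mathbb{R}^N)\cap L^p_{2t}(\mathbb{R}^N)$ for every $t>0$. If, moreover, $\widetilde J(z)\ge\widetilde J_{\log}(z)$ for all $z\in\mathbb{R}^N$, then $$\|u(t)\|_{L^p_{2t}(\mathbb{R}^N)}\le\|u_0\|_p .$$
   Context: A translation-invariant Lévy operator is $\mathcal{L}f(x)=\mathrm{P.V.}\int_{\mathbb{R}^N}(f(x)-f(y))\widetilde J(x-y)\,dy$ with $\widetilde J\ge0$ measurable, $\widetilde J(-z)=\widetilde J(z)$, $\int\min\{1,|z|^2\}\widetilde J(z)\,dz<\infty$. Its Fourier symbol is $m(\xi)=\int(1-\cos(z\cdot\xi))\widetilde J(z)\,dz$, and the solution with data $u_0$ is $u(t)=\mathcal{H}_t*u_0$, where $\mathcal{H}_t$ is the probability measure with Fourier transform $e^{-tm(\xi)}$ (convention $\widehat f(\xi)=\int f(x)e^{-ix\cdot\xi}dx$). $\widetilde J_{\log}(z)=\frac1{(4\pi)^{N/2}}\int_0^\infty t^{-\frac N2-1}e^{-\frac{|z|^2}{4t}}e^{-t}\,dt$ is the kernel of $\log(I-\Delta)$ (Fourier symbol $\log(1+|\xi|^2)$).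 Bessel potential spaces: for $1\le p<\infty$, $\sigma\ge0$, $L^p_\sigma(\mathbb{R}^N)=\{f\in L^p(\mathbb{R}^N):(I-\Delta)^{\sigma/2}f\in L^p(\mathbb{R}^N)\}$ with norm $\|f\|_{L^p_\sigma}=\|(I-\Delta)^{\sigma/2}f\|_p$, where $(I-\Delta)^{\sigma/2}$ has Fourier symbol $(1+|\xi|^2)^{\sigma/2}$. *)

theory Defs
  imports "HOL-Probability.Probability"
begin

section \<open>Levy kernels, symbols and solutions\<close>

definition levy_kernel :: "('a::euclidean_space \<Rightarrow> real) \<Rightarrow> bool" where
  "levy_kernel J \<longleftrightarrow>
     J \<in> borel_measurable lebesgue \<and>
     (\<forall>z. 0 \<le> J z) \<and>
     (\<forall>z. J (- z) = J z) \<and>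
     integrable lebesgue (\<lambda>z. min 1 ((norm z)\<^sup>2) * J z)"

definition levy_symbol :: "('a::euclidean_space \<Rightarrow> real) \<Rightarrow> 'a \<Rightarrow> real" where
  "levy_symbol J \<xi> = (LINT z|lebesgue. (1 - cos (z \<bullet> \<xi>)) * J z)"

definition fourier_measure :: "'a::euclidean_space measure \<Rightarrow> 'a \<Rightarrow> complex" where
  "fourier_measure \<mu> \<xi> = (LINT x|\<mu>. exp (- (\<i> * of_real (x \<bullet> \<xi>))))"

definition levy_heat_measure ::
    "('a::euclidean_space \<Rightarrow> real) \<Rightarrow> real \<Rightarrow> 'a measure \<Rightarrow> bool" where
  "levy_heat_measure J t \<mu> \<longleftrightarrow>
     prob_space \<mu> \<and> sets \<mu> = sets borel \<and>
     (\<forall>\<xi>. fourier_measure \<mu> \<xi> = of_real (exp (- t * levy_symbol J \<xi>)))"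

definition measure_convolution ::
    "'a::euclidean_space measure \<Rightarrow> ('a \<Rightarrow> complex) \<Rightarrow> 'a \<Rightarrow> complex" where
  "measure_convolution \<mu> f x = (LINT y|\<mu>. f (x - y))"

text \<open>The solution of \<open>\<partial>\<^sub>t u + L u = 0\<close>, \<open>u(0) = u0\<close>, for the operator \<open>L\<close> with
  kernel \<open>J\<close>. A probability measure is determined by its Fourier transform, so
  \<open>\<mu>\<close> is unique; it is the Dirac measure at the origin for \<open>t = 0\<close>.\<close>

definition levy_solution ::
    "('a::euclidean_space \<Rightarrow> real) \<Rightarrow> ('a \<Rightarrow> complex) \<Rightarrow> (real \<Rightarrow> 'a \<Rightarrow> complex) \<Rightarrow> bool" where
  "levy_solution J u0 u \<longleftrightarrow>
     (\<forall>t\<ge>0. \<exists>\<mu>. levy_heat_measure J t \<mu> \<and> u t = measure_convolution \<mu> u0)"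

text \<open>The integral diverges at \<open>z = 0\<close>, where the Bochner integral returns \<open>0\<close>;
  only the values at \<open>z \<noteq> 0\<close> are meaningful.\<close>

definition J_log :: "'a::euclidean_space \<Rightarrow> real" where
  "J_log z = 1 / ((4 * pi) powr (real DIM('a) / 2)) *
     (LBINT t:{0<..}. t powr (- (real DIM('a) / 2) - 1) * exp (- (norm z)\<^sup>2 / (4 * t)) * exp (- t))"

section \<open>Lebesgue spaces\<close>

text \<open>Elements of \<open>L\<^sup>p\<close> are represented by Borel functions; functions that agree almost
  everywhere are not identified.\<close>

definition Lp :: "real \<Rightarrow> ('a::euclidean_space \<Rightarrow> complex) set" where
  "Lp p = {f. f \<in> borel_measurable borel \<and> integrable lborel (\<lambda>x. norm (f x) powr p)}"

definition Lp_norm :: "real \<Rightarrow> ('a::euclidean_space \<Rightarrow> complex) \<Rightarrow> real" where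
  "Lp_norm p f = (LINT x|lborel. norm (f x) powr p) powr (1 / p)"

section \<open>Tempered distributions\<close>

primrec iterated_deriv ::
    "'a::euclidean_space list \<Rightarrow> ('a \<Rightarrow> complex) \<Rightarrow> 'a \<Rightarrow> complex" where
  "iterated_deriv [] f = f"
| "iterated_deriv (b # bs) f = (\<lambda>x. frechet_derivative (iterated_deriv bs f) (at x) b)"

definition schwartz :: "('a::euclidean_space \<Rightarrow> complex) \<Rightarrow> bool" where
  "schwartz \<phi> \<longleftrightarrow>
     (\<forall>bs. set bs \<subseteq> Basis \<longrightarrow>
        (\<forall>x. iterated_deriv bs \<phi> differentiable (at x)) \<and>
        (\<forall>k::nat. bounded (range (\<lambda>x. norm x ^ k *\<^sub>R iterated_deriv bs \<phi> x))))"

definition fourier :: "('a::euclidean_space \<Rightarrow> complex) \<Rightarrow> 'a \<Rightarrow> complex" where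
  "fourier \<phi> \<xi> = (LINT x|lborel. \<phi> x * exp (- (\<i> * of_real (x \<bullet> \<xi>))))"

text \<open>A tempered distribution is given by its values on Schwartz functions.\<close>

definition dist_of :: "('a::euclidean_space \<Rightarrow> complex) \<Rightarrow> ('a \<Rightarrow> complex) \<Rightarrow> complex" where
  "dist_of f \<phi> = (LINT x|lborel. f x * \<phi> x)"

definition dist_fourier ::
    "(('a::euclidean_space \<Rightarrow> complex) \<Rightarrow> complex) \<Rightarrow> ('a \<Rightarrow> complex) \<Rightarrow> complex" where
  "dist_fourier T \<phi> = T (fourier \<phi>)"

definition dist_mult ::
    "('a::euclidean_space \<Rightarrow> complex) \<Rightarrow> (('a \<Rightarrow> complex) \<Rightarrow> complex) \<Rightarrow> ('a \<Rightarrow> complex) \<Rightarrow> complex"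
  where "dist_mult w T \<phi> = T (\<lambda>\<xi>. w \<xi> * \<phi> \<xi>)"

section \<open>Bessel potential spaces\<close>

definition bessel_symbol :: "real \<Rightarrow> 'a::euclidean_space \<Rightarrow> complex" where
  "bessel_symbol \<sigma> \<xi> = of_real ((1 + (norm \<xi>)\<^sup>2) powr (\<sigma> / 2))"

text \<open>\<open>g\<close> represents the tempered distribution \<open>(I - \<Delta>)\<^bsup>\<sigma>/2\<^esup> f\<close>.\<close>

definition is_bessel_derivative ::
    "real \<Rightarrow> ('a::euclidean_space \<Rightarrow> complex) \<Rightarrow> ('a \<Rightarrow> complex) \<Rightarrow> bool" where
  "is_bessel_derivative \<sigma> f g \<longleftrightarrow>
     (\<forall>\<phi>. schwartz \<phi> \<longrightarrow>
        dist_fourier (dist_of g) \<phi> =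
        dist_mult (bessel_symbol \<sigma>) (dist_fourier (dist_of f)) \<phi>)"

definition bessel_space :: "real \<Rightarrow> real \<Rightarrow> ('a::euclidean_space \<Rightarrow> complex) set" where
  "bessel_space p \<sigma> = {f \<in> Lp p. \<exists>g \<in> Lp p. is_bessel_derivative \<sigma> f g}"

text \<open>The choice is unique up to null sets, which the norm does not see.\<close>

definition bessel_derivative ::
    "real \<Rightarrow> real \<Rightarrow> ('a::euclidean_space \<Rightarrow> complex) \<Rightarrow> 'a \<Rightarrow> complex" where
  "bessel_derivative p \<sigma> f = (SOME g. g \<in> Lp p \<and> is_bessel_derivative \<sigma> f g)"

definition bessel_norm :: "real \<Rightarrow> real \<Rightarrow> ('a::euclidean_space \<Rightarrow> complex) \<Rightarrow> real" where
  "bessel_norm p \<sigma> f = Lp_norm p (bessel_derivative p \<sigma> f)"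

end

theory Submission
  imports Defs
begin

text \<open>Write \<open>J = J_log + K - B\<close> with Levy kernels \<open>K, B \<ge> 0\<close>, where \<open>B\<close> is integrable because it
  lives on \<open>|z| \<ge> 1\<close>. Since \<open>J_log\<close> has symbol \<open>ln (1 + |\<xi>|\<^sup>2)\<close>, applying \<open>(I - \<Delta>)\<^sup>t\<close> to the
  solution leaves the Fourier multiplier \<open>exp (- t m\<^sub>K) exp (t m\<^sub>B)\<close>. The first factor is the
  characteristic function of a probability measure, the second one that of a finite signed measure,
  namely a compound Poisson law whose jumps carry the sign \<open>- 1\<close>, times \<open>exp (2 t \<integral>B)\<close>. So
  \<open>(I - \<Delta>)\<^sup>t u(t)\<close> is a weighted average of translates of \<open>u\<^sub>0\<close>, and averaging does not increase
  \<open>L\<^sup>p\<close> norms; when \<open>B = 0\<close> the weight is \<open>1\<close>.\<close>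

section \<open>Gaussian integrals\<close>

text \<open>The multiplier left over by \<open>(I - \<Delta>)\<^sup>t\<close> need not be smooth, so
  its product with a Schwartz function may leave the Schwartz class. The defining identity of the
  Bessel derivative is therefore verified by rewriting both sides as pairings of \<open>u0\<close>
  with Fourier transforms of functions that are merely integrable and square integrable. Here
  \<open>u0\<close> in L^2 is used: the pairings converge absolutely once the Fourier transform is
  known to map such functions into L^2, which is one half of Plancherel's theorem. The signed
  measure is never formed. A probability space carries a random displacement and a bounded weight,
  so Jensen's inequality and translation invariance apply directly, with weight 1 to the solution
  itself and with a signed weight to its derivative. \<open>K\<close> may have infinite mass near 0,
  so its law is built as the law of a random series. The norm in the conclusion is that of an
  arbitrarily chosen derivative, hence uniqueness up to null sets has to be proved as well; it
  follows from injectivity of the Fourier transform on L^1 after damping by a Gaussian.\<close>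

abbreviation echar :: "'a::euclidean_space \<Rightarrow> 'a \<Rightarrow> complex" where
  "echar x \<xi> \<equiv> exp (- (\<i> * complex_of_real (x \<bullet> \<xi>)))"

lemma norm_echar [simp]: "norm (echar x \<xi>) = 1"
  using norm_exp_i_times[of "- (x \<bullet> \<xi>)"] by simp

lemma echar_add: "echar (x + y) \<xi> = echar x \<xi> * echar y \<xi>"
  by (simp add: inner_add_left algebra_simps exp_add[symmetric])

lemma echar_sum: "finite A \<Longrightarrow> echar (\<Sum>i\<in>A. f i) \<xi> = (\<Prod>i\<in>A. echar (f i) \<xi>)"
  by (induction A rule: finite_induct) (simp_all add: echar_add)

lemma Re_echar [simp]: "Re (echar x \<xi>) = cos (x \<bullet> \<xi>)"
  by (simp add: Re_exp)

text \<open>\<open>lborel\<close> is the image of a product of one-dimensional Lebesgue measures, so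
  Fubini splits the integral. Gaussians have this product form, and the decaying weight further down
  is dominated by a function of this form.\<close>

lemma integral_lborel_prod_Basis:
  fixes f :: "'a::euclidean_space \<Rightarrow> real \<Rightarrow> 'b::{real_normed_field, banach, second_countable_topology}"
  assumes "\<And>b. b \<in> Basis \<Longrightarrow> integrable lborel (f b)"
  shows "has_bochner_integral lborel (\<lambda>x::'a. \<Prod>b\<in>Basis. f b (x \<bullet> b))
    (\<Prod>b\<in>Basis. integral\<^sup>L lborel (f b))"
proof -
  interpret product_sigma_finite "\<lambda>_::'a. lborel :: real measure" ..
  have [measurable]: "f b \<in> borel_measurable borel" if "b \<in> Basis" for b
    using assms[OF that] by simp
  have [simp]: "(\<Prod>b\<in>Basis. f b ((\<Sum>c\<in>Basis. \<omega> c *\<^sub>R c) \<bullet> b)) = (\<Prod>b\<in>Basis. f b (\<omega> b))"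
    for \<omega> :: "'a \<Rightarrow> real"
    by (intro prod.cong refl) simp
  have "integrable (Pi\<^sub>M Basis (\<lambda>_. lborel)) (\<lambda>\<omega>. \<Prod>b\<in>Basis. f b (\<omega> b))"
    "(\<integral>\<omega>. (\<Prod>b\<in>Basis. f b (\<omega> b)) \<partial>Pi\<^sub>M Basis (\<lambda>_. lborel)) = (\<Prod>b\<in>Basis. integral\<^sup>L lborel (f b))"
    using assms by (auto intro!: product_integrable_prod product_integral_prod)
  then show ?thesis
    unfolding has_bochner_integral_iff
    by (subst (1 2) lborel_eq, simp add: integrable_distr_eq integral_distr)
qed

lemma gauss_fourier_real:
  fixes c \<xi> :: real
  assumes c: "0 < c"
  shows "has_bochner_integral lborel
    (\<lambda>x. of_real (exp (- c * x\<^sup>2)) * exp (- (\<i> * complex_of_real (x * \<xi>))))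
    (of_real (sqrt (pi / c) * exp (- \<xi>\<^sup>2 / (4 * c))))"
proof -
  interpret real_distribution std_normal_distribution by (rule real_dist_normal_dist)
  \<comment> \<open>Rescaling by \<open>k\<close> turns exp (- x^2 / 2) into exp (- c x^2); the
    frequency \<open>s\<close> absorbs this scale and the minus sign in the Fourier
    convention.\<close>
  define k where "k = sqrt (2 * c)"
  have k: "0 < k" "k\<^sup>2 = 2 * c" using c by (auto simp: k_def)
  define s where "s = - \<xi> / k"
  let ?f = "\<lambda>x. std_normal_density x *\<^sub>R iexp (s * x)"
  have "integrable std_normal_distribution (\<lambda>x. iexp (s * x))"
    by (rule integrable_iexp) simp_all
  moreover have "integral\<^sup>L std_normal_distribution (\<lambda>x. iexp (s * x)) = of_real (exp (- s\<^sup>2 / 2))"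
    using char_std_normal_distribution unfolding char_def by metis
  ultimately have "has_bochner_integral lborel ?f (of_real (exp (- s\<^sup>2 / 2)))"
    by (simp add: has_bochner_integral_iff integrable_density integral_density)
  then have "has_bochner_integral lborel (\<lambda>x. ?f (0 + k * x)) (of_real (exp (- s\<^sup>2 / 2)) /\<^sub>R \<bar>k\<bar>)"
    using k by (subst (asm) lborel_has_bochner_integral_real_affine_iff[of k _ _ 0]) auto
  then have "has_bochner_integral lborel (\<lambda>x. of_real (sqrt (2 * pi)) * ?f (0 + k * x))
    (of_real (sqrt (2 * pi)) * (of_real (exp (- s\<^sup>2 / 2)) /\<^sub>R \<bar>k\<bar>))"
    by (rule has_bochner_integral_mult_right)
  moreover have "of_real (sqrt (2 * pi)) * ?f (0 + k * x) =
    of_real (exp (- c * x\<^sup>2)) * exp (- (\<i> * complex_of_real (x * \<xi>)))" for x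
  proof -
    have "(k * x)\<^sup>2 / 2 = c * x\<^sup>2" by (simp add: power_mult_distrib k)
    moreover have "s * (k * x) = - (x * \<xi>)" using k by (simp add: s_def)
    ultimately show ?thesis
      by (simp add: std_normal_density_def scaleR_conv_of_real)
  qed
  moreover have "of_real (sqrt (2 * pi)) * (of_real (exp (- s\<^sup>2 / 2)) /\<^sub>R \<bar>k\<bar>) =
    (of_real (sqrt (pi / c) * exp (- \<xi>\<^sup>2 / (4 * c))) :: complex)"
  proof -
    have "s\<^sup>2 / 2 = \<xi>\<^sup>2 / (4 * c)" by (simp add: s_def power_divide k)
    moreover have "sqrt (2 * pi) / k = sqrt (pi / c)"
      using c by (simp add: k_def real_sqrt_divide[symmetric])
    ultimately show ?thesis using k
      by (simp add: scaleR_conv_of_real field_simps flip: of_real_mult of_real_inverse)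
  qed
  ultimately show ?thesis by simp
qed

lemma norm_sq_Basis: "(norm (x::'a::euclidean_space))\<^sup>2 = (\<Sum>b\<in>Basis. (x \<bullet> b)\<^sup>2)"
  unfolding power2_norm_eq_inner
  by (subst euclidean_inner) (simp add: power2_eq_square)

lemma gauss_fourier:
  fixes \<xi> :: "'a::euclidean_space"
  assumes c: "0 < c"
  shows "has_bochner_integral lborel (\<lambda>x. of_real (exp (- c * (norm x)\<^sup>2)) * echar x \<xi>)
    (of_real (sqrt (pi / c) ^ DIM('a) * exp (- (norm \<xi>)\<^sup>2 / (4 * c))))"
proof -
  let ?f = "\<lambda>b::'a. \<lambda>x. of_real (exp (- c * x\<^sup>2)) * exp (- (\<i> * complex_of_real (x * (\<xi> \<bullet> b))))"
  have 1: "has_bochner_integral lborel (\<lambda>x::'a. \<Prod>b\<in>Basis. ?f b (x \<bullet> b))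
    (\<Prod>b\<in>Basis. integral\<^sup>L lborel (?f b))"
    by (rule integral_lborel_prod_Basis) (use gauss_fourier_real[OF c] has_bochner_integral_iff in blast)
  have 2: "(\<Prod>b\<in>Basis. ?f b (x \<bullet> b)) = of_real (exp (- c * (norm x)\<^sup>2)) * echar x \<xi>" for x
  proof -
    have a: "x \<bullet> \<xi> = (\<Sum>b\<in>Basis. (x \<bullet> b) * (\<xi> \<bullet> b))" by (rule euclidean_inner)
    show ?thesis
      unfolding a norm_sq_Basis
      by (simp add: prod.distrib exp_sum sum_distrib_left sum_negf[symmetric] of_real_prod del: sum_negf)
  qed
  have 3: "integral\<^sup>L lborel (?f b) = of_real (sqrt (pi / c) * exp (- (\<xi> \<bullet> b)\<^sup>2 / (4 * c)))" for b
    using gauss_fourier_real[OF c] has_bochner_integral_iff by blast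
  have 4: "(\<Prod>b\<in>Basis. integral\<^sup>L lborel (?f b)) =
     of_real (sqrt (pi / c) ^ DIM('a) * exp (- (norm \<xi>)\<^sup>2 / (4 * c)))"
    unfolding 3 norm_sq_Basis
    by (simp add: prod.distrib exp_sum sum_divide_distrib sum_negf[symmetric] of_real_prod del: sum_negf)
  show ?thesis using 1 unfolding 2 4 .
qed

lemma gauss_cos:
  fixes \<xi> :: "'a::euclidean_space"
  assumes c: "0 < c"
  shows "has_bochner_integral lborel (\<lambda>x. exp (- c * (norm x)\<^sup>2) * cos (x \<bullet> \<xi>))
    (sqrt (pi / c) ^ DIM('a) * exp (- (norm \<xi>)\<^sup>2 / (4 * c)))"
  using has_bochner_integral_Re[OF gauss_fourier[OF c, of \<xi>]] by simp

lemma gauss_integral: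
  assumes c: "0 < c"
  shows "has_bochner_integral lborel (\<lambda>x::'a::euclidean_space. exp (- c * (norm x)\<^sup>2))
    (sqrt (pi / c) ^ DIM('a))"
  using gauss_cos[OF c, of 0] by simp

text \<open>Each of the factors 1 + |x|^2 dominates 1 + x_b^2 for one coordinate, so a product of
  integrable functions of one variable is a majorant. This explains the exponent: one factor per
  coordinate.\<close>

lemma integrable_inverse_power_norm:
  "integrable lborel (\<lambda>x::'a::euclidean_space. 1 / (1 + (norm x)\<^sup>2) ^ DIM('a))"
proof -
  have i: "integrable lborel (\<lambda>x::real. 1 / (1 + x\<^sup>2))"
    using integrable_mult_indicator[of UNIV lborel] integrable_inverse_1_plus_square
    by (simp add: set_integrable_def einterval_def inverse_eq_divide)
  have "integrable lborel (\<lambda>x::'a. \<Prod>b\<in>Basis. 1 / (1 + (x \<bullet> b)\<^sup>2))"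
    using integral_lborel_prod_Basis[of "\<lambda>_ x. 1 / (1 + x\<^sup>2)"] i has_bochner_integral_iff by blast
  then show ?thesis
  proof (rule Bochner_Integration.integrable_bound)
    show "AE x::'a in lborel. norm (1 / (1 + (norm x)\<^sup>2) ^ DIM('a)) \<le> norm (\<Prod>b\<in>Basis. 1 / (1 + (x \<bullet> b)\<^sup>2))"
    proof (rule AE_I2)
      fix x :: 'a
      have "(\<Prod>b\<in>(Basis::'a set). 1 / (1 + (norm x)\<^sup>2)) \<le> (\<Prod>b\<in>Basis. 1 / (1 + (x \<bullet> b)\<^sup>2))"
      proof (rule prod_mono, intro conjI)
        fix b :: 'a assume "b \<in> Basis"
        then have "(x \<bullet> b)\<^sup>2 \<le> (norm x)\<^sup>2"
          by (metis Basis_le_norm abs_le_square_iff abs_norm_cancel)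
        then show "1 / (1 + (norm x)\<^sup>2) \<le> 1 / (1 + (x \<bullet> b)\<^sup>2)"
          by (intro divide_left_mono mult_pos_pos) (auto intro: add_pos_nonneg)
      qed simp
      then show "norm (1 / (1 + (norm x)\<^sup>2) ^ DIM('a)) \<le> norm (\<Prod>b\<in>Basis. 1 / (1 + (x \<bullet> b)\<^sup>2))"
        by (simp add: power_one_over prod_nonneg)
    qed
  qed simp
qed

section \<open>The kernel of the logarithmic operator\<close>

lemma nn_integral_exp_neg:
  assumes b: "0 < b"
  shows "(\<integral>\<^sup>+t. ennreal (exp (- b * t)) * indicator {0<..} t \<partial>lborel) = ennreal (1 / b)"
proof -
  have "(\<integral>\<^sup>+t. ennreal (exp (- b * t)) * indicator {0<..} t \<partial>lborel) =
      (\<integral>\<^sup>+t. ennreal (exp (- b * t)) * indicator {0..} t \<partial>lborel)"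
    by (intro nn_integral_cong_AE AE_I[where N="{0}"]) (auto split: split_indicator)
  also have "\<dots> = 0 - (- exp (- b * 0) / b)"
  proof (rule nn_integral_FTC_atLeast)
    show "((\<lambda>t. - exp (- b * t) / b) \<longlongrightarrow> 0) at_top"
      using b by real_asymp
  qed (use b in \<open>auto intro!: derivative_eq_intros\<close>)
  finally show ?thesis by simp
qed

text \<open>A Frullani integral: (1 - exp (- t a)) / t is the integral of exp (- t s) over s in
  [0, a], and after Tonelli the integral in t gives 1 / (1 + s).\<close>

lemma frullani_exp:
  assumes a: "0 \<le> a"
  shows "(\<integral>\<^sup>+t. ennreal (exp (- t) / t * (1 - exp (- t * a))) * indicator {0<..} t \<partial>lborel)
    = ennreal (ln (1 + a))"
proof -
  have 1: "ennreal (exp (- t) / t * (1 - exp (- t * a))) * indicator {0<..} t =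
    (\<integral>\<^sup>+s. ennreal (exp (- (1 + s) * t)) * indicator {0<..} t * indicator {0..a} s \<partial>lborel)" for t
  proof (cases "0 < t")
    case True
    have "(\<integral>\<^sup>+s. ennreal (exp (- (1 + s) * t)) * indicator {0..a} s \<partial>lborel) =
      - exp (- (1 + a) * t) / t - (- exp (- (1 + 0) * t) / t)"
      using True a by (intro nn_integral_FTC_Icc) (auto intro!: derivative_eq_intros simp: field_simps)
    also have "- exp (- (1 + a) * t) / t - (- exp (- (1 + 0) * t) / t) = exp (- t) / t * (1 - exp (- t * a))"
      using True by (simp add: field_simps exp_add[symmetric])
    finally show ?thesis using True by (simp add: mult_ac)
  qed simp
  have "(\<integral>\<^sup>+t. ennreal (exp (- t) / t * (1 - exp (- t * a))) * indicator {0<..} t \<partial>lborel) =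
    (\<integral>\<^sup>+s. (\<integral>\<^sup>+t. ennreal (exp (- (1 + s) * t)) * indicator {0<..} t * indicator {0..a} s \<partial>lborel) \<partial>lborel)"
    unfolding 1 by (rule lborel_pair.Fubini') measurable
  also have "\<dots> = (\<integral>\<^sup>+s. ennreal (1 / (1 + s)) * indicator {0..a} s \<partial>lborel)"
  proof (rule nn_integral_cong)
    fix s :: real
    show "(\<integral>\<^sup>+t. ennreal (exp (- (1 + s) * t)) * indicator {0<..} t * indicator {0..a} s \<partial>lborel) =
      ennreal (1 / (1 + s)) * indicator {0..a} s"
    proof (cases "s \<in> {0..a}")
      case True
      then have "0 < 1 + s" by auto
      from nn_integral_exp_neg[OF this] True show ?thesis by simp
    qed simp
  qed
  also have "\<dots> = ln (1 + a) - ln (1 + 0)"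
    using a by (intro nn_integral_FTC_Icc) (auto intro!: derivative_eq_intros simp: field_simps)
  finally show ?thesis by simp
qed

text \<open>The Gauss kernel with symbol exp (- t |\<xi>|^2). \<open>J_log\<close> is its mixture
  over t with weight exp (- t) / t, the Levy density of the Gamma process, so questions about
  \<open>J_log\<close> reduce to Gaussian integrals.\<close>

definition heat_kernel :: "real \<Rightarrow> 'a::euclidean_space \<Rightarrow> real" where
  "heat_kernel t z = exp (- (1 / (4 * t)) * (norm z)\<^sup>2) / sqrt (4 * pi * t) ^ DIM('a)"

lemma heat_kernel_measurable [measurable]:
  "case_prod heat_kernel \<in> borel_measurable (borel \<Otimes>\<^sub>M (borel :: 'a::euclidean_space measure))"
  unfolding heat_kernel_def[abs_def] by measurable

lemma heat_kernel_nonneg: "0 < t \<Longrightarrow> 0 \<le> heat_kernel t z"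
  by (simp add: heat_kernel_def)

lemma heat_kernel_cos:
  fixes \<xi> :: "'a::euclidean_space"
  assumes t: "0 < t"
  shows "has_bochner_integral lborel (\<lambda>z. heat_kernel t z * cos (z \<bullet> \<xi>)) (exp (- t * (norm \<xi>)\<^sup>2))"
proof -
  have "has_bochner_integral lborel (\<lambda>z. exp (- (1 / (4 * t)) * (norm z)\<^sup>2) * cos (z \<bullet> \<xi>) / sqrt (4 * pi * t) ^ DIM('a))
    (sqrt (pi / (1 / (4 * t))) ^ DIM('a) * exp (- (norm \<xi>)\<^sup>2 / (4 * (1 / (4 * t)))) / sqrt (4 * pi * t) ^ DIM('a))"
    using t by (intro has_bochner_integral_divide gauss_cos) auto
  moreover have "pi / (1 / (4 * t)) = 4 * pi * t" by simp
  ultimately show ?thesis using t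
    by (simp add: heat_kernel_def mult_ac)
qed

lemma heat_kernel_integral:
  assumes t: "0 < t"
  shows "has_bochner_integral lborel (heat_kernel t :: 'a::euclidean_space \<Rightarrow> real) 1"
  using heat_kernel_cos[OF t, of "0::'a"] by simp

lemma nn_integral_heat_kernel_one_minus_cos:
  fixes \<xi> :: "'a::euclidean_space"
  assumes t: "0 < t"
  shows "(\<integral>\<^sup>+z. ennreal (1 - cos (z \<bullet> \<xi>)) * ennreal (heat_kernel t z) \<partial>lborel) =
    ennreal (1 - exp (- t * (norm \<xi>)\<^sup>2))"
proof -
  have h: "has_bochner_integral lborel (\<lambda>z. heat_kernel t z - heat_kernel t z * cos (z \<bullet> \<xi>)) (1 - exp (- t * (norm \<xi>)\<^sup>2))"
    by (intro has_bochner_integral_diff heat_kernel_cos heat_kernel_integral t)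
  have "(\<integral>\<^sup>+z. ennreal (heat_kernel t z - heat_kernel t z * cos (z \<bullet> \<xi>)) \<partial>lborel) = ennreal (1 - exp (- t * (norm \<xi>)\<^sup>2))"
    using h
    by (subst nn_integral_eq_integral)
      (auto simp: has_bochner_integral_iff mult_left_le heat_kernel_nonneg[OF t])
  also have "(\<lambda>z. ennreal (heat_kernel t z - heat_kernel t z * cos (z \<bullet> \<xi>))) =
    (\<lambda>z. ennreal (1 - cos (z \<bullet> \<xi>)) * ennreal (heat_kernel t z))"
    by (rule ext, subst ennreal_mult[symmetric])
      (auto simp: heat_kernel_nonneg[OF t] algebra_simps)
  finally show ?thesis .
qed

text \<open>The weight 1 - exp (- |z|^2) is a computable substitute for min 1 |z|^2. A bound linear
  in t is what cancels the singularity of exp (- t) / t at t = 0.\<close>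

lemma nn_integral_heat_kernel_one_minus_gauss:
  fixes t :: real
  assumes t: "0 < t"
  shows "(\<integral>\<^sup>+z. ennreal (1 - exp (- (norm z)\<^sup>2)) * ennreal (heat_kernel t (z::'a::euclidean_space)) \<partial>lborel)
    \<le> ennreal (2 * DIM('a) * t)"
proof -
  define c where "c = 1 / (4 * t) + 1"
  have c: "0 < c" using t by (simp add: c_def add_pos_pos)
  define I where "I = sqrt (pi / c) ^ DIM('a) / sqrt (4 * pi * t) ^ DIM('a)"
  have "has_bochner_integral lborel (\<lambda>z::'a. exp (- c * (norm z)\<^sup>2) / sqrt (4 * pi * t) ^ DIM('a)) I"
    unfolding I_def by (intro has_bochner_integral_divide gauss_integral c)
  also have "(\<lambda>z::'a. exp (- c * (norm z)\<^sup>2) / sqrt (4 * pi * t) ^ DIM('a)) =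
     (\<lambda>z. heat_kernel t z * exp (- (norm z)\<^sup>2))"
    by (auto simp: heat_kernel_def c_def fun_eq_iff exp_add[symmetric] algebra_simps)
  finally have h: "has_bochner_integral lborel (\<lambda>z::'a. heat_kernel t z - heat_kernel t z * exp (- (norm z)\<^sup>2)) (1 - I)"
    by (intro has_bochner_integral_diff heat_kernel_integral t)
  have "(\<integral>\<^sup>+z. ennreal (heat_kernel t z - heat_kernel t z * exp (- (norm (z::'a))\<^sup>2)) \<partial>lborel) = ennreal (1 - I)"
    using h by (subst nn_integral_eq_integral)
      (auto simp: has_bochner_integral_iff mult_left_le heat_kernel_nonneg[OF t])
  also have "(\<lambda>z. ennreal (heat_kernel t z - heat_kernel t z * exp (- (norm (z::'a))\<^sup>2))) =
    (\<lambda>z. ennreal (1 - exp (- (norm z)\<^sup>2)) * ennreal (heat_kernel t z))"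
    by (rule ext, subst ennreal_mult[symmetric])
      (auto simp: heat_kernel_nonneg[OF t] algebra_simps)
  also have "1 - I \<le> 2 * DIM('a) * t"
  proof -
    have "pi / c / (4 * pi * t) = 1 / (1 + 4 * t)"
    proof -
      have "c * (4 * t) = 1 + 4 * t" using t by (simp add: c_def field_simps)
      moreover have "pi / c / (4 * pi * t) = 1 / (c * (4 * t))" using t by simp
      ultimately show ?thesis by simp
    qed
    then have I: "I = (1 / sqrt (1 + 4 * t)) ^ DIM('a)"
      unfolding I_def power_divide[symmetric] real_sqrt_divide[symmetric] by (simp add: real_sqrt_divide)
    \<comment> \<open>Taking square roots and reciprocals gives (1 + 4 t)^(-1/2) \<ge> exp (- 2 t).
      Raised to the power of the dimension this bounds \<open>I\<close> from below and produces the
      constant 2 * DIM.\<close>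
    have "1 + 4 * t \<le> exp (4 * t)" by (rule exp_ge_add_one_self)
    also have "\<dots> = (exp (2 * t))\<^sup>2" by (simp flip: exp_double)
    finally have "sqrt (1 + 4 * t) \<le> exp (2 * t)" by (rule real_le_lsqrt[rotated]) simp
    then have "1 / exp (2 * t) \<le> 1 / sqrt (1 + 4 * t)"
      using t by (intro divide_left_mono) auto
    then have "(1 / exp (2 * t)) ^ DIM('a) \<le> I"
      unfolding I by (rule power_mono) simp
    also have "(1 / exp (2 * t)) ^ DIM('a) = exp (- (2 * DIM('a) * t))"
      by (simp add: exp_of_nat_mult[symmetric] exp_minus field_simps)
    finally show ?thesis using exp_ge_add_one_self[of "- (2 * DIM('a) * t)"] by linarith
  qed
  finally show ?thesis by (simp add: ennreal_leI)
qed

text \<open>The value \<open>\<infinity>\<close> at the origin makes this version of \<open>J_log\<close> usable with Tonelli.\<close>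

definition J_log_nn :: "'a::euclidean_space \<Rightarrow> ennreal" where
  "J_log_nn z = (\<integral>\<^sup>+t. ennreal (exp (- t) / t) * ennreal (heat_kernel t z) * indicator {0<..} t \<partial>lborel)"

lemma J_log_nn_measurable [measurable]: "J_log_nn \<in> borel_measurable borel"
  unfolding J_log_nn_def[abs_def] by measurable

lemma nn_integral_J_log_nn:
  fixes w :: "'a::euclidean_space \<Rightarrow> ennreal"
  assumes [measurable]: "w \<in> borel_measurable borel"
  shows "(\<integral>\<^sup>+z. w z * J_log_nn z \<partial>lborel) =
    (\<integral>\<^sup>+t. ennreal (exp (- t) / t) * (\<integral>\<^sup>+z. w z * ennreal (heat_kernel t z) \<partial>lborel) * indicator {0<..} t \<partial>lborel)"
proof -
  have "(\<integral>\<^sup>+z. w z * J_log_nn z \<partial>lborel) =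
    (\<integral>\<^sup>+z. (\<integral>\<^sup>+t. w z * (ennreal (exp (- t) / t) * ennreal (heat_kernel t z) * indicator {0<..} t) \<partial>lborel) \<partial>lborel)"
    unfolding J_log_nn_def by (intro nn_integral_cong nn_integral_cmult[symmetric]) measurable
  also have "\<dots> = (\<integral>\<^sup>+t. (\<integral>\<^sup>+z. w z * (ennreal (exp (- t) / t) * ennreal (heat_kernel t z) * indicator {0<..} t) \<partial>lborel) \<partial>lborel)"
    by (rule lborel_pair.Fubini'[symmetric]) measurable
  also have "\<dots> = (\<integral>\<^sup>+t. (\<integral>\<^sup>+z. (ennreal (exp (- t) / t) * indicator {0<..} t) * (w z * ennreal (heat_kernel t z)) \<partial>lborel) \<partial>lborel)"
    by (simp add: mult_ac)
  also have "\<dots> = (\<integral>\<^sup>+t. (ennreal (exp (- t) / t) * indicator {0<..} t) * (\<integral>\<^sup>+z. w z * ennreal (heat_kernel t z) \<partial>lborel) \<partial>lborel)"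
    by (intro nn_integral_cong nn_integral_cmult) measurable
  finally show ?thesis by (simp add: mult_ac)
qed

lemma nn_integral_J_log_nn_one_minus_cos:
  fixes \<xi> :: "'a::euclidean_space"
  shows "(\<integral>\<^sup>+z. ennreal (1 - cos (z \<bullet> \<xi>)) * J_log_nn z \<partial>lborel) = ennreal (ln (1 + (norm \<xi>)\<^sup>2))"
proof -
  have "(\<integral>\<^sup>+z. ennreal (1 - cos (z \<bullet> \<xi>)) * J_log_nn z \<partial>lborel) =
    (\<integral>\<^sup>+t. ennreal (exp (- t) / t * (1 - exp (- t * (norm \<xi>)\<^sup>2))) * indicator {0<..} t \<partial>lborel)"
    by (subst nn_integral_J_log_nn, measurable, intro nn_integral_cong)
      (auto simp: nn_integral_heat_kernel_one_minus_cos ennreal_mult[symmetric] split: split_indicator)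
  then show ?thesis by (simp only: frullani_exp zero_le_power2)
qed

text \<open>The factor t in the heat kernel estimate cancels 1 / t, which leaves a multiple of the
  integral of exp (- t).\<close>

lemma nn_integral_J_log_nn_one_minus_gauss:
  "(\<integral>\<^sup>+z. ennreal (1 - exp (- (norm (z::'a::euclidean_space))\<^sup>2)) * J_log_nn z \<partial>lborel) < \<infinity>"
proof -
  have "(\<integral>\<^sup>+z. ennreal (1 - exp (- (norm (z::'a))\<^sup>2)) * J_log_nn z \<partial>lborel) \<le>
    (\<integral>\<^sup>+t. ennreal (2 * DIM('a)) * (ennreal (exp (- 1 * t)) * indicator {0<..} t) \<partial>lborel)"
  proof (subst nn_integral_J_log_nn, measurable, rule nn_integral_mono)
    fix t :: real
    show "ennreal (exp (- t) / t) * (\<integral>\<^sup>+z. ennreal (1 - exp (- (norm (z::'a))\<^sup>2)) * ennreal (heat_kernel t z) \<partial>lborel) * indicator {0<..} t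
      \<le> ennreal (2 * DIM('a)) * (ennreal (exp (- 1 * t)) * indicator {0<..} t)"
    proof (cases "0 < t")
      case True
      have "ennreal (exp (- t) / t) * (\<integral>\<^sup>+z. ennreal (1 - exp (- (norm (z::'a))\<^sup>2)) * ennreal (heat_kernel t z) \<partial>lborel)
        \<le> ennreal (exp (- t) / t) * ennreal (2 * DIM('a) * t)"
        by (rule mult_left_mono[OF nn_integral_heat_kernel_one_minus_gauss[OF True]]) simp
      also have "\<dots> = ennreal (2 * DIM('a)) * ennreal (exp (- 1 * t))"
        using True by (simp add: ennreal_mult[symmetric] mult_ac)
      finally show ?thesis using True by simp
    qed simp
  qed
  also have "\<dots> = ennreal (2 * DIM('a)) * ennreal (1 / 1)"
    by (subst nn_integral_cmult, measurable) (subst nn_integral_exp_neg, simp_all)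
  also have "\<dots> < \<infinity>" by (simp add: ennreal_mult_less_top)
  finally show ?thesis .
qed

lemma J_log_minus: "J_log (- z) = J_log z"
  by (simp add: J_log_def)

lemma J_log_nonneg: "0 \<le> J_log z"
  unfolding J_log_def set_lebesgue_integral_def
  by (intro mult_nonneg_nonneg Bochner_Integration.integral_nonneg) auto

lemma J_log_eq_integral_heat_kernel:
  "J_log (z::'a::euclidean_space) = (\<integral>t. exp (- t) / t * heat_kernel t z * indicator {0<..} t \<partial>lborel)"
proof -
  have "J_log z = (\<integral>t. 1 / ((4 * pi) powr (real DIM('a) / 2)) *
      (indicator {0<..} t *\<^sub>R (t powr (- (real DIM('a) / 2) - 1) * exp (- (norm z)\<^sup>2 / (4 * t)) * exp (- t))) \<partial>lborel)"
    unfolding J_log_def set_lebesgue_integral_def by simp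
  also have "\<dots> = (\<integral>t. exp (- t) / t * heat_kernel t z * indicator {0<..} t \<partial>lborel)"
  proof (rule Bochner_Integration.integral_cong[OF refl])
    fix t :: real
    show "1 / ((4 * pi) powr (real DIM('a) / 2)) *
      (indicator {0<..} t *\<^sub>R (t powr (- (real DIM('a) / 2) - 1) * exp (- (norm z)\<^sup>2 / (4 * t)) * exp (- t))) =
      exp (- t) / t * heat_kernel t z * indicator {0<..} t"
    proof (cases "0 < t")
      case True
      have "sqrt (4 * pi * t) ^ DIM('a) = (4 * pi * t) powr (real DIM('a) / 2)"
        using True by (simp add: powr_half_sqrt[symmetric] powr_realpow[symmetric] powr_powr)
      also have "\<dots> = (4 * pi) powr (real DIM('a) / 2) * t powr (real DIM('a) / 2)"
        using True by (simp add: powr_mult)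
      finally have s: "sqrt (4 * pi * t) ^ DIM('a) = (4 * pi) powr (real DIM('a) / 2) * t powr (real DIM('a) / 2)" .
      have "t powr (- r - 1) = 1 / (t powr r * t)" for r
        using True by (simp add: powr_diff powr_minus divide_simps)
      then show ?thesis using True unfolding heat_kernel_def s by (simp add: mult_ac)
    qed simp
  qed
  finally show ?thesis .
qed

lemma J_log_measurable [measurable]: "J_log \<in> borel_measurable borel"
  unfolding J_log_eq_integral_heat_kernel[abs_def] by measurable

text \<open>Finiteness almost everywhere comes for free from the finite weighted integral, because
  the weight 1 - exp (- |z|^2) is positive away from 0; where \<open>J_log_nn\<close> is finite the
  Bochner integral agrees with it. At the origin they differ: the former is 0 by default, the latter
  infinite.\<close>

lemma AE_J_log: "AE z::'a::euclidean_space in lborel. ennreal (J_log z) = J_log_nn z"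
proof -
  have "AE z::'a in lborel. ennreal (1 - exp (- (norm z)\<^sup>2)) * J_log_nn z \<noteq> \<infinity>"
    using nn_integral_J_log_nn_one_minus_gauss[where 'a='a]
    by (intro nn_integral_noteq_infinite) (auto simp: less_top)
  moreover have "AE z::'a in lborel. z \<noteq> 0"
    by (rule AE_lborel_singleton)
  ultimately show ?thesis
  proof eventually_elim
    case (elim z)
    then have fin: "J_log_nn z < \<infinity>"
      by (auto simp: ennreal_mult_eq_top_iff less_top)
    let ?f = "\<lambda>t. exp (- t) / t * heat_kernel t z * indicator {0<..} t"
    have e: "ennreal (exp (- t) / t) * ennreal (heat_kernel t z) * indicator {0<..} t = ennreal (?f t)" for t
      by (auto split: split_indicator simp: ennreal_mult[symmetric] heat_kernel_nonneg)
    have nn: "0 \<le> ?f t" for t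
      by (auto split: split_indicator simp: heat_kernel_nonneg)
    have fin': "(\<integral>\<^sup>+t. ennreal (?f t) \<partial>lborel) < \<infinity>" using fin unfolding J_log_nn_def e .
    have "integrable lborel ?f"
      by (rule integrableI_nonneg) (use fin' nn in auto)
    then show ?case
      unfolding J_log_eq_integral_heat_kernel J_log_nn_def e
      by (subst nn_integral_eq_integral) (use nn in auto)
  qed
qed

text \<open>By monotonicity only m = min 1 s in [0, 1] matters, and there exp (- m) \<le> 1 / (1 +
  m) \<le> 1 - m / 2. The estimate carries integrability from the computable weight over to the
  weight in \<open>levy_kernel\<close>.\<close>

lemma min_le_one_minus_exp: "0 \<le> s \<Longrightarrow> min 1 s \<le> 2 * (1 - exp (- s))" for s :: real
proof -
  assume s: "0 \<le> s"
  define m where "m = min 1 s"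
  have m: "0 \<le> m" "m \<le> 1" "m \<le> s" using s by (auto simp: m_def)
  have "1 + m / 2 * 2 \<le> exp m" using exp_ge_add_one_self[of m] by simp
  then have "exp (- m) \<le> 1 / (1 + m)"
    using m by (simp add: exp_minus field_simps)
  also have "\<dots> \<le> 1 - m / 2"
    using m by (simp add: field_simps mult_left_le)
  finally have "m \<le> 2 * (1 - exp (- m))" by simp
  also have "\<dots> \<le> 2 * (1 - exp (- s))" using m by simp
  finally show ?thesis by (simp add: m_def)
qed

lemma levy_kernel_J_log: "levy_kernel (J_log :: 'a::euclidean_space \<Rightarrow> real)"
proof -
  have "integrable lborel (\<lambda>z::'a. min 1 ((norm z)\<^sup>2) * J_log z)"
  proof (rule integrableI_nonneg)
    have "(\<integral>\<^sup>+z. ennreal (min 1 ((norm z)\<^sup>2) * J_log (z::'a)) \<partial>lborel) \<le>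
      (\<integral>\<^sup>+z. 2 * (ennreal (1 - exp (- (norm z)\<^sup>2)) * J_log_nn (z::'a)) \<partial>lborel)"
    proof (rule nn_integral_mono_AE)
      show "AE z::'a in lborel. ennreal (min 1 ((norm z)\<^sup>2) * J_log z) \<le> 2 * (ennreal (1 - exp (- (norm z)\<^sup>2)) * J_log_nn z)"
        using AE_J_log
      proof eventually_elim
        case (elim z)
        have "ennreal (min 1 ((norm z)\<^sup>2) * J_log z) \<le> ennreal (2 * (1 - exp (- (norm z)\<^sup>2)) * J_log z)"
          by (intro ennreal_leI mult_right_mono min_le_one_minus_exp J_log_nonneg) simp
        also have "\<dots> = 2 * (ennreal (1 - exp (- (norm z)\<^sup>2)) * ennreal (J_log z))"
          by (simp add: ennreal_mult ennreal_mult[of 2, simplified, symmetric] J_log_nonneg mult.assoc del: right_diff_distrib_numeral)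
        finally show ?case using elim by simp
      qed
    qed
    also have "\<dots> < \<infinity>"
      using nn_integral_J_log_nn_one_minus_gauss
      by (subst nn_integral_cmult) (auto simp: ennreal_mult_less_top)
    finally show "(\<integral>\<^sup>+z. ennreal (min 1 ((norm z)\<^sup>2) * J_log (z::'a)) \<partial>lborel) < \<infinity>" .
  qed (auto simp: J_log_nonneg)
  then show ?thesis
    unfolding levy_kernel_def
    by (auto simp: J_log_nonneg J_log_minus integrable_completion intro: measurable_completion)
qed

lemma levy_symbol_J_log: "levy_symbol J_log (\<xi>::'a::euclidean_space) = ln (1 + (norm \<xi>)\<^sup>2)"
proof -
  have "levy_symbol J_log \<xi> = (LINT z|lborel. (1 - cos (z \<bullet> \<xi>)) * J_log z)"
    unfolding levy_symbol_def by (rule integral_completion) measurable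
  also have "\<dots> = enn2real (\<integral>\<^sup>+z. ennreal ((1 - cos (z \<bullet> \<xi>)) * J_log z) \<partial>lborel)"
    by (rule integral_eq_nn_integral) (auto simp: J_log_nonneg)
  also have "(\<integral>\<^sup>+z. ennreal ((1 - cos (z \<bullet> \<xi>)) * J_log z) \<partial>lborel) =
    (\<integral>\<^sup>+z. ennreal (1 - cos (z \<bullet> \<xi>)) * J_log_nn z \<partial>lborel)"
    using AE_J_log by (intro nn_integral_cong_AE) (auto simp: ennreal_mult J_log_nonneg)
  finally show ?thesis by (simp add: nn_integral_J_log_nn_one_minus_cos)
qed

section \<open>Existence of infinitely divisible laws\<close>

lemma space_eq_UNIV: "sets M = sets borel \<Longrightarrow> space M = UNIV"
  by (metis sets_eq_imp_space_eq space_borel)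

text \<open>Independence turns the character of a sum into a product. The infinite product space is
  kept so that all partial sums of a random series live on one space; the projection to the first
  \<open>n\<close> coordinates brings back a finite product.\<close>

lemma integral_PiM_prod_echar:
  fixes \<rho> :: "nat \<Rightarrow> 'a::euclidean_space measure"
  assumes \<rho>: "\<And>i. prob_space (\<rho> i)" "\<And>i. sets (\<rho> i) = sets borel"
  shows "(\<integral>\<omega>. echar (\<Sum>i<n. \<omega> i) \<xi> \<partial>PiM UNIV \<rho>) = (\<Prod>i<n. fourier_measure (\<rho> i) \<xi>)"
proof -
  interpret R: prob_space "\<rho> i" for i by (rule \<rho>)
  interpret product_prob_space \<rho> UNIV ..
  have [measurable_cong]: "sets (\<rho> i) = sets borel" for i by (rule \<rho>)
  have "(\<integral>\<omega>. echar (\<Sum>i<n. \<omega> i) \<xi> \<partial>PiM UNIV \<rho>) =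
    (\<integral>\<omega>. (\<Prod>i<n. echar (restrict \<omega> {..<n} i) \<xi>) \<partial>PiM UNIV \<rho>)"
    by (simp add: echar_sum)
  also have "\<dots> = (\<integral>\<omega>. (\<Prod>i<n. echar (\<omega> i) \<xi>) \<partial>distr (PiM UNIV \<rho>) (PiM {..<n} \<rho>) (\<lambda>\<omega>. restrict \<omega> {..<n}))"
    by (subst integral_distr) (auto intro!: measurable_restrict_subset)
  also have "distr (PiM UNIV \<rho>) (PiM {..<n} \<rho>) (\<lambda>\<omega>. restrict \<omega> {..<n}) = PiM {..<n} \<rho>"
    by (rule distr_PiM_restrict_finite) auto
  also have "(\<integral>\<omega>. (\<Prod>i<n. echar (\<omega> i) \<xi>) \<partial>PiM {..<n} \<rho>) = (\<Prod>i<n. \<integral>x. echar x \<xi> \<partial>\<rho> i)"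
  proof (rule product_integral_prod)
    fix i
    show "integrable (\<rho> i) (\<lambda>x. echar x \<xi>)"
      by (rule R.integrable_const_bound[where B=1]) auto
  qed simp
  finally show ?thesis by (simp add: fourier_measure_def)
qed

text \<open>The Poisson generating function, from the exponential series. The closed unit disc is
  the right range, since z will be a number in [-1, 1] times a value of a characteristic
  function.\<close>

lemma integral_poisson_power:
  fixes z :: complex
  assumes r: "0 < r" and z: "norm z \<le> 1"
  shows "(\<integral>n. z ^ n \<partial>measure_pmf (poisson_pmf r)) = exp (of_real r * (z - 1))"
proof -
  have i: "integrable (measure_pmf (poisson_pmf r)) (\<lambda>n. z ^ n)"
    using z by (intro measure_pmf.integrable_const_bound[where B=1] AE_pmfI) (auto simp: norm_power power_le_one)
  then have i': "integrable (count_space UNIV) (\<lambda>n. pmf (poisson_pmf r) n *\<^sub>R z ^ n)"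
    by (simp add: measure_pmf_eq_density integrable_density)
  have "(\<integral>n. z ^ n \<partial>measure_pmf (poisson_pmf r)) = (\<integral>n. pmf (poisson_pmf r) n *\<^sub>R z ^ n \<partial>count_space UNIV)"
    by (simp add: measure_pmf_eq_density integral_density)
  then have "(\<lambda>n. pmf (poisson_pmf r) n *\<^sub>R z ^ n) sums (\<integral>n. z ^ n \<partial>measure_pmf (poisson_pmf r))"
    using sums_integral_count_space_nat[OF i'] by simp
  also have "(\<lambda>n. pmf (poisson_pmf r) n *\<^sub>R z ^ n) = (\<lambda>n. exp (- of_real r) * ((of_real r * z) ^ n /\<^sub>R fact n))"
    using r by (simp add: fun_eq_iff scaleR_conv_of_real power_mult_distrib exp_of_real[symmetric] field_simps)
  finally have "(\<lambda>n. exp (- of_real r) * ((of_real r * z) ^ n /\<^sub>R fact n)) sums (\<integral>n. z ^ n \<partial>measure_pmf (poisson_pmf r))" .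
  moreover have "(\<lambda>n. exp (- of_real r) * ((of_real r * z) ^ n /\<^sub>R fact n)) sums (exp (- of_real r) * exp (of_real r * z))"
    by (intro sums_mult exp_converges)
  ultimately have "(\<integral>n. z ^ n \<partial>measure_pmf (poisson_pmf r)) = exp (- of_real r) * exp (of_real r * z)"
    by (rule sums_unique2)
  then show ?thesis by (simp add: exp_add[symmetric] algebra_simps)
qed

text \<open>The sign \<open>s\<close> serves jumps of negative intensity: for \<open>s = - 1\<close> the right-hand side is,
  up to a constant factor, the exponential of a \<^emph>\<open>negative\<close> finite measure.\<close>

lemma compound_poisson:
  fixes \<nu> :: "'a::euclidean_space measure"
  assumes \<nu>: "finite_measure \<nu>" "sets \<nu> = sets borel"
  obtains M :: "(nat \<times> (nat \<Rightarrow> 'a)) measure" and N :: "nat \<times> (nat \<Rightarrow> 'a) \<Rightarrow> nat"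
    and X :: "nat \<times> (nat \<Rightarrow> 'a) \<Rightarrow> 'a"
  where "prob_space M" "N \<in> measurable M (count_space UNIV)" "X \<in> borel_measurable M"
    "\<And>s \<xi>. \<bar>s\<bar> \<le> 1 \<Longrightarrow> (\<integral>\<omega>. of_real s ^ N \<omega> * echar (X \<omega>) \<xi> \<partial>M) =
      exp (of_real s * (\<integral>z. echar z \<xi> \<partial>\<nu>) - of_real (measure \<nu> UNIV))"
\<comment> \<open>The zero measure cannot be normalised to a jump law; it is represented by no jumps
  at all.\<close>
proof (cases "measure \<nu> UNIV = 0")
  case True
  interpret finite_measure \<nu> by fact
  have "space \<nu> = UNIV" using \<nu>(2) by (rule space_eq_UNIV)
  then have "emeasure \<nu> (space \<nu>) = 0" using True by (simp add: emeasure_eq_measure)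
  then have "null_measure \<nu> = \<nu>"
    by (intro measure_eqI) (auto, metis emeasure_space le_zero_eq)
  then have 0: "(\<integral>z. echar z \<xi> \<partial>\<nu>) = 0" for \<xi>
    by (metis integral_null_measure)
  show thesis
    by (rule that[of "return (count_space UNIV) undefined" "\<lambda>_. 0" "\<lambda>_. 0"])
      (auto simp: 0 True prob_space_return measure_return)
next
  case False
  interpret finite_measure \<nu> by fact
  define r where "r = measure \<nu> UNIV"
  have r: "0 < r" using False by (simp add: r_def zero_less_measure_iff)
  have sp: "space \<nu> = UNIV" using \<nu>(2) by (rule space_eq_UNIV)
  have [measurable_cong]: "sets \<nu> = sets borel" by fact
  define Q where "Q = density \<nu> (\<lambda>_. ennreal (1 / r))"
  have Q: "prob_space Q"
  proof
    have "emeasure Q (space Q) = ennreal (1 / r) * emeasure \<nu> UNIV"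
      using sp by (simp add: Q_def emeasure_density nn_integral_cmult)
    also have "\<dots> = 1"
      using r by (simp add: emeasure_eq_measure r_def[symmetric] ennreal_mult[symmetric])
    finally show "emeasure Q (space Q) = 1" .
  qed
  interpret Q: prob_space Q by (rule Q)
  interpret QQ: product_prob_space "\<lambda>_. Q" "UNIV :: nat set" ..
  have [measurable_cong]: "sets Q = sets borel" by (simp add: Q_def \<nu>)
  have fQ: "fourier_measure Q \<xi> = (\<integral>z. echar z \<xi> \<partial>\<nu>) / of_real r" for \<xi>
    using r by (simp add: fourier_measure_def Q_def integral_density scaleR_conv_of_real)
  have nQ: "norm (fourier_measure Q \<xi>) \<le> 1" for \<xi>
  proof -
    have "norm (fourier_measure Q \<xi>) \<le> (\<integral>z. norm (echar z \<xi>) \<partial>Q)"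
      unfolding fourier_measure_def by (rule integral_norm_bound)
    then show ?thesis using Q.prob_space by simp
  qed
  let ?p = "measure_pmf (poisson_pmf r)"
  \<comment> \<open>A Poisson number of jumps and, independently of it, an infinite sequence of
    jumps with law \<open>Q\<close>; the displacement adds up the first \<open>n\<close> of
    them.\<close>
  define M where "M = ?p \<Otimes>\<^sub>M PiM UNIV (\<lambda>_::nat. Q)"
  interpret pair_prob_space ?p "PiM UNIV (\<lambda>_::nat. Q)" ..
  have M: "prob_space M" unfolding M_def by (rule prob_space_axioms)
  have N: "fst \<in> measurable M (count_space UNIV)" unfolding M_def by measurable
  have sM: "sets M = sets (count_space UNIV \<Otimes>\<^sub>M PiM UNIV (\<lambda>_::nat. Q))"
    unfolding M_def by (intro sets_pair_measure_cong) auto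
  have X: "(\<lambda>(n, \<omega>). \<Sum>i<n. \<omega> i) \<in> borel_measurable M"
    unfolding measurable_cong_sets[OF sM refl]
    by (rule measurable_pair_measure_countable1) auto
  show thesis
  proof (rule that[OF M N X])
    fix s :: real and \<xi> :: 'a
    assume s: "\<bar>s\<bar> \<le> 1"
    let ?f = "\<lambda>n \<omega>. of_real s ^ n * echar (\<Sum>i<n. \<omega> i) \<xi>"
    have m: "(\<lambda>w. of_real s ^ fst w * echar ((\<lambda>(n, \<omega>). \<Sum>i<n. \<omega> i) w) \<xi>) \<in> borel_measurable M"
      using X N by measurable
    have "integrable M (\<lambda>w. of_real s ^ fst w * echar ((\<lambda>(n, \<omega>). \<Sum>i<n. \<omega> i) w) \<xi>)"
      using s m prob_space.finite_measure[OF M]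
      by (intro finite_measure.integrable_const_bound[where B=1]) (auto simp: norm_mult norm_power power_le_one)
    then have i: "integrable (?p \<Otimes>\<^sub>M PiM UNIV (\<lambda>_::nat. Q)) (\<lambda>(n, \<omega>). ?f n \<omega>)"
      by (simp add: M_def case_prod_unfold)
    have "(\<integral>w. of_real s ^ fst w * echar ((\<lambda>(n, \<omega>). \<Sum>i<n. \<omega> i) w) \<xi> \<partial>M) = (\<integral>n. (\<integral>\<omega>. ?f n \<omega> \<partial>PiM UNIV (\<lambda>_::nat. Q)) \<partial>?p)"
      unfolding integral_fst[OF i] by (simp add: M_def case_prod_unfold)
    \<comment> \<open>For a fixed count n, every jump contributes one factor s and one character, so
      the inner integral is an n-th power and the generating function applies.\<close>
    also have "\<dots> = (\<integral>n. (of_real s * fourier_measure Q \<xi>) ^ n \<partial>?p)"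
      using Q by (simp add: integral_PiM_prod_echar Q_def \<nu> power_mult_distrib)
    also have "\<dots> = exp (of_real r * (of_real s * fourier_measure Q \<xi> - 1))"
    proof (rule integral_poisson_power[OF r])
      show "norm (of_real s * fourier_measure Q \<xi>) \<le> 1"
        using mult_mono[OF s nQ[of \<xi>]] by (simp add: norm_mult)
    qed
    also have "\<dots> = exp (of_real s * (\<integral>z. echar z \<xi> \<partial>\<nu>) - of_real (measure \<nu> UNIV))"
      using r by (simp add: fQ r_def[symmetric] algebra_simps)
    finally show "(\<integral>w. of_real s ^ fst w * echar ((\<lambda>(n, \<omega>). \<Sum>i<n. \<omega> i) w) \<xi> \<partial>M) =
      exp (of_real s * (\<integral>z. echar z \<xi> \<partial>\<nu>) - of_real (measure \<nu> UNIV))" .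
  qed
qed

text \<open>Reflection conjugates the character, so the integral equals its own conjugate and only
  the cosine part survives.\<close>

lemma symmetric_measure_integral_echar:
  fixes \<nu> :: "'a::euclidean_space measure"
  assumes "finite_measure \<nu>" and [measurable_cong]: "sets \<nu> = sets borel"
    and sym: "distr \<nu> borel uminus = \<nu>"
  shows "(\<integral>z. echar z \<xi> \<partial>\<nu>) = of_real (\<integral>z. cos (z \<bullet> \<xi>) \<partial>\<nu>)"
proof -
  interpret finite_measure \<nu> by fact
  have i: "integrable \<nu> (\<lambda>z. echar z \<xi>)"
    by (rule integrable_const_bound[where B=1]) auto
  have "(\<integral>z. echar z \<xi> \<partial>\<nu>) = (\<integral>z. echar z \<xi> \<partial>distr \<nu> borel uminus)" by (simp add: sym)
  also have "\<dots> = (\<integral>z. cnj (echar z \<xi>) \<partial>\<nu>)"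
    by (subst integral_distr) (auto simp: exp_cnj)
  also have "\<dots> = cnj (\<integral>z. echar z \<xi> \<partial>\<nu>)"
    by simp
  finally have "Im (\<integral>z. echar z \<xi> \<partial>\<nu>) = 0"
    by (metis Reals_cnj_iff complex_is_Real_iff)
  moreover have "Re (\<integral>z. echar z \<xi> \<partial>\<nu>) = (\<integral>z. cos (z \<bullet> \<xi>) \<partial>\<nu>)"
    using integral_Re[OF i] by simp
  ultimately show ?thesis by (simp add: complex_eq_iff)
qed

lemma infinitely_divisible_finite:
  fixes \<nu> :: "'a::euclidean_space measure"
  assumes \<nu>: "finite_measure \<nu>" "sets \<nu> = sets borel" "distr \<nu> borel uminus = \<nu>"
  obtains \<rho> where "prob_space \<rho>" "sets \<rho> = sets borel"
    "\<And>\<xi>. fourier_measure \<rho> \<xi> = of_real (exp (- (\<integral>z. 1 - cos (z \<bullet> \<xi>) \<partial>\<nu>)))"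
proof -
  interpret finite_measure \<nu> by fact
  have [measurable_cong]: "sets \<nu> = sets borel" by fact
  have sp: "space \<nu> = UNIV" using \<nu>(2) by (rule space_eq_UNIV)
  obtain M :: "(nat \<times> (nat \<Rightarrow> 'a)) measure" and N X
    where M: "prob_space M" "N \<in> measurable M (count_space UNIV)"
    and [measurable]: "X \<in> borel_measurable M"
    and *: "\<And>s \<xi>. \<bar>s\<bar> \<le> 1 \<Longrightarrow> (\<integral>\<omega>. of_real s ^ N \<omega> * echar (X \<omega>) \<xi> \<partial>M) =
      exp (of_real s * (\<integral>z. echar z \<xi> \<partial>\<nu>) - of_real (measure \<nu> UNIV))"
    by (rule compound_poisson[OF \<nu>(1,2)]) blast
  interpret M: prob_space M by fact
  show thesis
  proof (rule that[of "distr M borel X"])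
    fix \<xi> :: 'a
    have "integrable \<nu> (\<lambda>z. cos (z \<bullet> \<xi>))"
      by (rule integrable_const_bound[where B=1]) auto
    then have "(\<integral>z. 1 - cos (z \<bullet> \<xi>) \<partial>\<nu>) = measure \<nu> UNIV - (\<integral>z. cos (z \<bullet> \<xi>) \<partial>\<nu>)"
      using sp by simp
    then show "fourier_measure (distr M borel X) \<xi> = of_real (exp (- (\<integral>z. 1 - cos (z \<bullet> \<xi>) \<partial>\<nu>)))"
      using *[of 1 \<xi>] symmetric_measure_integral_echar[OF \<nu>, of \<xi>]
      by (simp add: fourier_measure_def integral_distr exp_of_real[symmetric])
  qed (auto intro: M.prob_space_distr)
qed

section \<open>Gaussian averages over frequencies and tail bounds\<close>

definition std_gauss :: "'a::euclidean_space measure" where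
  "std_gauss = density lborel (\<lambda>\<xi>. ennreal (exp (- (1 / 2) * (norm \<xi>)\<^sup>2) / sqrt (2 * pi) ^ DIM('a)))"

lemma sets_std_gauss [measurable_cong, simp]: "sets std_gauss = sets borel"
  by (simp add: std_gauss_def)

lemma integral_cos_std_gauss:
  "(\<integral>\<xi>. cos (z \<bullet> \<xi>) \<partial>std_gauss) = exp (- (norm (z::'a::euclidean_space))\<^sup>2 / 2)"
proof -
  have "(\<integral>\<xi>. cos (z \<bullet> \<xi>) \<partial>std_gauss) = (\<integral>\<xi>. (exp (- (1 / 2) * (norm \<xi>)\<^sup>2) * cos (\<xi> \<bullet> z)) / sqrt (2 * pi) ^ DIM('a) \<partial>lborel)"
    unfolding std_gauss_def by (subst integral_density) (auto simp: inner_commute)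
  also have "\<dots> = exp (- (norm z)\<^sup>2 / 2)"
    using gauss_cos[of "1 / 2" z] by (simp add: has_bochner_integral_iff mult.commute)
  finally show ?thesis .
qed

lemma prob_space_std_gauss: "prob_space (std_gauss :: 'a::euclidean_space measure)"
proof
  have "has_bochner_integral lborel (\<lambda>\<xi>::'a. exp (- (1 / 2) * (norm \<xi>)\<^sup>2) / sqrt (2 * pi) ^ DIM('a))
    (sqrt (pi / (1 / 2)) ^ DIM('a) / sqrt (2 * pi) ^ DIM('a))"
    by (intro has_bochner_integral_divide gauss_integral) auto
  then have "(\<integral>\<^sup>+\<xi>. ennreal (exp (- (1 / 2) * (norm (\<xi>::'a))\<^sup>2) / sqrt (2 * pi) ^ DIM('a)) \<partial>lborel) = 1"
    by (subst nn_integral_eq_integral) (auto simp: has_bochner_integral_iff mult.commute)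
  then show "emeasure std_gauss (space std_gauss :: 'a set) = 1"
    by (simp add: std_gauss_def emeasure_density)
qed

text \<open>Averaging over a Gaussian frequency replaces 1 - cos, which oscillates, by 1 - exp (-
  |z|^2 / 2), which increases with |z|. Knowledge of a characteristic exponent thereby becomes
  knowledge of tails.\<close>

lemma std_gauss_average:
  fixes \<nu> :: "'a::euclidean_space measure"
  assumes \<nu>: "finite_measure \<nu>" "sets \<nu> = sets borel"
  shows "integrable std_gauss (\<lambda>\<xi>. \<integral>z. 1 - cos (z \<bullet> \<xi>) \<partial>\<nu>)"
    and "(\<integral>\<xi>. (\<integral>z. 1 - cos (z \<bullet> \<xi>) \<partial>\<nu>) \<partial>std_gauss) = (\<integral>z. 1 - exp (- (norm z)\<^sup>2 / 2) \<partial>\<nu>)"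
proof -
  interpret G: prob_space "std_gauss :: 'a measure" by (rule prob_space_std_gauss)
  interpret finite_measure \<nu> by fact
  interpret pair_sigma_finite \<nu> "std_gauss :: 'a measure" ..
  have [measurable_cong]: "sets \<nu> = sets borel" by fact
  have i: "integrable (\<nu> \<Otimes>\<^sub>M std_gauss) (\<lambda>(z, \<xi>). 1 - cos (z \<bullet> \<xi>))"
  proof (rule finite_measure.integrable_const_bound[where B=2])
    show "finite_measure (\<nu> \<Otimes>\<^sub>M (std_gauss :: 'a measure))"
      by (rule finite_measure_pair_measure) (rule G.finite_measure_axioms, fact)
    show "AE x in \<nu> \<Otimes>\<^sub>M std_gauss. norm (case x of (z, \<xi>) \<Rightarrow> 1 - cos (z \<bullet> \<xi>)) \<le> 2"
      by (intro AE_I2, auto simp: abs_le_iff) (smt (verit) cos_le_one cos_ge_minus_one)+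
  qed measurable
  show "integrable std_gauss (\<lambda>\<xi>. \<integral>z. 1 - cos (z \<bullet> \<xi>) \<partial>\<nu>)"
    using integrable_snd[OF i] .
  have "(\<integral>\<xi>. (\<integral>z. 1 - cos (z \<bullet> \<xi>) \<partial>\<nu>) \<partial>std_gauss) = (\<integral>z. (\<integral>\<xi>. 1 - cos (z \<bullet> \<xi>) \<partial>std_gauss) \<partial>\<nu>)"
    using integral_fst[OF i] integral_snd[OF i] by simp
  also have "\<dots> = (\<integral>z. 1 - exp (- (norm z)\<^sup>2 / 2) \<partial>\<nu>)"
  proof (rule Bochner_Integration.integral_cong[OF refl])
    fix z :: 'a
    have "integrable std_gauss (\<lambda>\<xi>. cos (z \<bullet> \<xi>))"
      by (rule G.integrable_const_bound[where B=1]) auto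
    then show "(\<integral>\<xi>. 1 - cos (z \<bullet> \<xi>) \<partial>std_gauss) = 1 - exp (- (norm z)\<^sup>2 / 2)"
      using G.prob_space by (simp add: integral_cos_std_gauss)
  qed
  finally show "(\<integral>\<xi>. (\<integral>z. 1 - cos (z \<bullet> \<xi>) \<partial>\<nu>) \<partial>std_gauss) = (\<integral>z. 1 - exp (- (norm z)\<^sup>2 / 2) \<partial>\<nu>)" .
qed

text \<open>Markov's inequality for 1 - exp (- |y|^2 / 2), whose mean under \<open>\<rho>\<close> is
  a Gaussian average of 1 - exp (- m) with m the exponent of \<open>\<nu>\<close>. The inequality 1
  - exp (- m) \<le> m makes the bound linear in \<open>\<nu>\<close>, and no total mass of
  \<open>\<nu>\<close> appears in it.\<close>

lemma infinitely_divisible_tail: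
  fixes \<nu> :: "'a::euclidean_space measure"
  assumes \<nu>: "finite_measure \<nu>" "sets \<nu> = sets borel"
    and \<rho>: "prob_space \<rho>" "sets \<rho> = sets borel"
      "\<And>\<xi>. fourier_measure \<rho> \<xi> = of_real (exp (- (\<integral>z. 1 - cos (z \<bullet> \<xi>) \<partial>\<nu>)))"
    and \<delta>: "0 \<le> \<delta>"
  shows "measure \<rho> {y. \<delta> \<le> norm y} * (1 - exp (- \<delta>\<^sup>2 / 2)) \<le> (\<integral>z. 1 - exp (- (norm z)\<^sup>2 / 2) \<partial>\<nu>)"
proof -
  interpret prob_space \<rho> by fact
  have [measurable_cong]: "sets \<rho> = sets borel" by fact
  have sp: "space \<rho> = UNIV" using \<rho>(2) by (rule space_eq_UNIV)
  have "measure \<rho> {y. \<delta> \<le> norm y} * (1 - exp (- \<delta>\<^sup>2 / 2)) =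
      (\<integral>y. indicator {y. \<delta> \<le> norm y} y * (1 - exp (- \<delta>\<^sup>2 / 2)) \<partial>\<rho>)"
    using sp by simp
  also have "\<dots> \<le> (\<integral>y. 1 - exp (- (norm y)\<^sup>2 / 2) \<partial>\<rho>)"
  proof (rule integral_mono)
    show "integrable \<rho> (\<lambda>y. 1 - exp (- (norm y)\<^sup>2 / 2))"
      by (rule integrable_const_bound[where B=1]) auto
    show "integrable \<rho> (\<lambda>y. indicator {y. \<delta> \<le> norm y} y * (1 - exp (- \<delta>\<^sup>2 / 2)))"
      by (rule integrable_const_bound[where B=1]) (auto split: split_indicator)
    fix y :: 'a
    show "indicator {y. \<delta> \<le> norm y} y * (1 - exp (- \<delta>\<^sup>2 / 2)) \<le> 1 - exp (- (norm y)\<^sup>2 / 2)"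
      using \<delta> by (auto split: split_indicator intro: power_mono)
  qed
  also have "\<dots> = (\<integral>\<xi>. (\<integral>y. 1 - cos (y \<bullet> \<xi>) \<partial>\<rho>) \<partial>std_gauss)"
    by (rule std_gauss_average(2)[symmetric]) (rule finite_measure_axioms, fact)
  also have "\<dots> \<le> (\<integral>\<xi>. (\<integral>z. 1 - cos (z \<bullet> \<xi>) \<partial>\<nu>) \<partial>std_gauss)"
  proof (rule integral_mono)
    show "integrable std_gauss (\<lambda>\<xi>. \<integral>y. 1 - cos (y \<bullet> \<xi>) \<partial>\<rho>)"
      by (rule std_gauss_average) (rule finite_measure_axioms, fact)
    show "integrable std_gauss (\<lambda>\<xi>. \<integral>z. 1 - cos (z \<bullet> \<xi>) \<partial>\<nu>)"
      by (rule std_gauss_average) fact+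
    fix \<xi> :: 'a
    have i: "integrable \<rho> (\<lambda>z. echar z \<xi>)"
      by (rule integrable_const_bound[where B=1]) auto
    have "(\<integral>y. cos (y \<bullet> \<xi>) \<partial>\<rho>) = Re (fourier_measure \<rho> \<xi>)"
      unfolding fourier_measure_def using integral_Re[OF i] by simp
    moreover have "integrable \<rho> (\<lambda>y. cos (y \<bullet> \<xi>))"
      using integrable_Re[OF i] by simp
    ultimately have "(\<integral>y. 1 - cos (y \<bullet> \<xi>) \<partial>\<rho>) = 1 - exp (- (\<integral>z. 1 - cos (z \<bullet> \<xi>) \<partial>\<nu>))"
      using prob_space by (simp add: \<rho>(3))
    also have "\<dots> \<le> (\<integral>z. 1 - cos (z \<bullet> \<xi>) \<partial>\<nu>)"
      using exp_ge_add_one_self[of "- (\<integral>z. 1 - cos (z \<bullet> \<xi>) \<partial>\<nu>)"] by simp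
    finally show "(\<integral>y. 1 - cos (y \<bullet> \<xi>) \<partial>\<rho>) \<le> (\<integral>z. 1 - cos (z \<bullet> \<xi>) \<partial>\<nu>)" .
  qed
  also have "\<dots> = (\<integral>z. 1 - exp (- (norm z)\<^sup>2 / 2) \<partial>\<nu>)"
    by (rule std_gauss_average) fact+
  finally show ?thesis .
qed

section \<open>Levy measures of possibly infinite mass\<close>

lemma one_minus_cos_le: "1 - cos (z \<bullet> \<xi>) \<le> (2 + (norm \<xi>)\<^sup>2) * min 1 ((norm z)\<^sup>2)"
  for z \<xi> :: "'a::euclidean_space"
proof (cases "norm z \<le> 1")
  case True
  have "1 - cos (z \<bullet> \<xi>) = 2 * (sin ((z \<bullet> \<xi>) / 2))\<^sup>2"
    using cos_double_sin[of "(z \<bullet> \<xi>) / 2"] by simp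
  also have "\<dots> \<le> 2 * ((z \<bullet> \<xi>) / 2)\<^sup>2"
    using abs_sin_x_le_abs_x[of "(z \<bullet> \<xi>) / 2"] by (simp only: abs_le_square_iff)
  also have "\<dots> \<le> (z \<bullet> \<xi>)\<^sup>2" by (simp add: power2_eq_square)
  also have "\<dots> \<le> (norm z * norm \<xi>)\<^sup>2"
    using Cauchy_Schwarz_ineq2[of z \<xi>] by (metis abs_le_square_iff abs_mult abs_norm_cancel)
  also have "\<dots> \<le> (2 + (norm \<xi>)\<^sup>2) * (norm z)\<^sup>2"
    by (simp add: power_mult_distrib algebra_simps)
  also have "(norm z)\<^sup>2 = min 1 ((norm z)\<^sup>2)"
    using True by (simp add: power_le_one)
  finally show ?thesis .
next
  case False
  then have "min 1 ((norm z)\<^sup>2) = 1" by (simp add: min_def one_le_power)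
  moreover have "1 - cos (z \<bullet> \<xi>) \<le> 2" using cos_ge_minus_one[of "z \<bullet> \<xi>"] by simp
  ultimately show ?thesis by (simp add: add_increasing2)
qed

lemma one_minus_gauss_le: "1 - exp (- (norm z)\<^sup>2 / 2) \<le> min 1 ((norm z)\<^sup>2)"
proof -
  have "1 - exp (- (norm z)\<^sup>2 / 2) \<le> (norm z)\<^sup>2 / 2"
    using exp_ge_add_one_self[of "- (norm z)\<^sup>2 / 2"] by simp
  also have "\<dots> \<le> (norm z)\<^sup>2" by simp
  finally show ?thesis by simp
qed

lemma measurable_disjointed:
  fixes C :: "nat \<Rightarrow> 'a set"
  shows "(\<And>i. C i \<in> sets M) \<Longrightarrow> disjointed C i \<in> sets M"
  by (auto simp: disjointed_def)

text \<open>The radii shrink fast enough for the compound Poisson summand with the jumps in the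
  \<open>(j + 1)\<close>-st ring to exceed \<open>2\<^sup>-\<^sup>j\<close> only with probability \<open>2\<^sup>-\<^sup>j\<close>; the sum of independent
  such variables therefore converges almost surely by Borel--Cantelli.\<close>

lemma infinitely_divisible:
  fixes \<Lambda> :: "'a::euclidean_space measure"
  assumes sets[measurable_cong]: "sets \<Lambda> = sets borel"
    and sym: "distr \<Lambda> borel uminus = \<Lambda>"
    and int: "integrable \<Lambda> (\<lambda>z. min 1 ((norm z)\<^sup>2))"
  obtains \<rho> where "prob_space \<rho>" "sets \<rho> = sets borel"
    "\<And>\<xi>. fourier_measure \<rho> \<xi> = of_real (exp (- (\<integral>z. 1 - cos (z \<bullet> \<xi>) \<partial>\<Lambda>)))"
proof -
  have sp: "space \<Lambda> = UNIV" using sets by (rule space_eq_UNIV)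
  have intc: "integrable \<Lambda> (\<lambda>z. 1 - cos (z \<bullet> \<xi>))" for \<xi>
    by (rule Bochner_Integration.integrable_bound[OF integrable_mult_right[OF int, of "2 + (norm \<xi>)\<^sup>2"]])
      (auto intro!: AE_I2 order_trans[OF one_minus_cos_le])
  let ?g = "\<lambda>z::'a. 1 - exp (- (norm z)\<^sup>2 / 2)"
  have intg: "integrable \<Lambda> ?g"
    by (rule Bochner_Integration.integrable_bound[OF int])
      (auto intro!: AE_I2 simp del: min.bounded_iff, use one_minus_gauss_le in simp)
  \<comment> \<open>\<open>F r\<close> is the right-hand side of the tail bound for jumps of size at
    most \<open>r\<close>. It tends to 0 with \<open>r\<close>, as \<open>?g\<close> is integrable
    and vanishes at 0. The threshold \<open>b j\<close> is (1 / 2)^j times the Markov factor at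
    level (1 / 2)^j.\<close>
  define F where "F r = (\<integral>z. indicator {z. norm z \<le> r} z * ?g z \<partial>\<Lambda>)" for r
  define b :: "nat \<Rightarrow> real" where "b j = (1 / 2) ^ j * (1 - exp (- ((1 / 2) ^ j)\<^sup>2 / 2))" for j
  have b: "0 < b j" for j by (simp add: b_def)
  have F0: "(\<lambda>n. F (1 / real (Suc n))) \<longlonglongrightarrow> (\<integral>z. 0 \<partial>\<Lambda>)"
    unfolding F_def
  proof (rule integral_dominated_convergence[where w = ?g])
    show "AE z in \<Lambda>. (\<lambda>n. indicator {z. norm z \<le> 1 / real (Suc n)} z * ?g z) \<longlonglongrightarrow> 0"
    proof (rule AE_I2)
      fix z :: 'a
      show "(\<lambda>n. indicator {z. norm z \<le> 1 / real (Suc n)} z * ?g z) \<longlonglongrightarrow> 0"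
      proof (cases "z = 0")
        case False
        have "\<forall>\<^sub>F n in sequentially. 1 / real (Suc n) < norm z"
          using LIMSEQ_inverse_real_of_nat False
          by (intro order_tendstoD(2)[of _ 0]) (auto simp: inverse_eq_divide)
        then have "\<forall>\<^sub>F n in sequentially. indicator {z. norm z \<le> 1 / real (Suc n)} z * ?g z = 0"
          by eventually_elim auto
        then show ?thesis by (rule tendsto_eventually)
      qed simp
    qed
  qed (use intg in \<open>auto split: split_indicator\<close>)
  have "\<exists>r>0. r \<le> 1 / real (Suc j) \<and> F r \<le> b j" for j
  proof -
    have "\<forall>\<^sub>F n in sequentially. F (1 / real (Suc n)) < b j"
      using F0 b[of j] by (intro order_tendstoD(2)) auto
    then have "\<forall>\<^sub>F n in sequentially. F (1 / real (Suc n)) < b j \<and> j \<le> n"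
      using eventually_ge_at_top by (rule eventually_conj)
    then obtain n where "F (1 / real (Suc n)) < b j" "j \<le> n"
      by (auto simp: eventually_sequentially)
    then show ?thesis
      by (intro exI[of _ "1 / real (Suc n)"]) (auto intro!: divide_left_mono)
  qed
  then obtain r where r: "\<And>j. 0 < r j" "\<And>j. r j \<le> 1 / real (Suc j)" "\<And>j. F (r j) \<le> b j"
    by metis
  \<comment> \<open>The radii are not known to decrease, so the rings come from
    \<open>disjointed\<close> and not from consecutive balls.\<close>
  define C where "C j = {z::'a. r j < norm z}" for j
  define A where "A = disjointed C"
  have [measurable]: "C j \<in> sets borel" for j by (simp add: C_def)
  have [measurable]: "A j \<in> sets borel" for j
    unfolding A_def by (rule measurable_disjointed) measurable
  \<comment> \<open>The origin stays uncovered, but \<open>?g\<close> and 1 - cos both vanish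
    there.\<close>
  have UA: "(\<Union>j. A j) = - {0}"
  proof -
    have "(\<Union>j. C j) = - {0}"
    proof (intro equalityI subsetI)
      fix z :: 'a assume "z \<in> - {0}"
      then obtain j where "1 / real (Suc j) < norm z"
        using reals_Archimedean[of "norm z"] by (auto simp: inverse_eq_divide)
      then show "z \<in> (\<Union>j. C j)" using r(2)[of j] by (auto simp: C_def intro!: exI[of _ j])
    next
      fix z :: 'a assume "z \<in> (\<Union>j. C j)"
      then show "z \<in> - {0}" using r(1) by (auto simp: C_def, meson order.asym)
    qed
    then show ?thesis by (simp add: A_def UN_disjointed_eq)
  qed
  have disj: "disjoint_family A" unfolding A_def by (rule disjoint_family_disjointed)
  \<comment> \<open>Each ring is symmetric, so every piece of the measure inherits the symmetry that
    keeps its exponent real.\<close>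
  have minusA: "- z \<in> A j \<longleftrightarrow> z \<in> A j" for z j
    by (simp add: A_def disjointed_def C_def)
  have AC: "A j \<subseteq> C j" for j unfolding A_def by (rule disjointed_subset)
  \<comment> \<open>The shift matters: ring j + 1 avoids \<open>C j\<close>, so its jumps have size
    at most \<open>r j\<close>. Ring 0 is not controlled this way, but a single term cannot spoil
    convergence.\<close>
  have Asuc: "A (Suc j) \<subseteq> {z. norm z \<le> r j}" for j
    by (auto simp: A_def disjointed_def C_def)
  define \<nu> where "\<nu> j = density \<Lambda> (\<lambda>z. indicator (A j) z)" for j
  have s\<nu>[measurable_cong]: "sets (\<nu> j) = sets borel" for j by (simp add: \<nu>_def sets)
  have int\<nu>: "(\<integral>z. f z \<partial>\<nu> j) = (\<integral>z. indicator (A j) z * f z \<partial>\<Lambda>)"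
    if [measurable]: "f \<in> borel_measurable borel" for f :: "'a \<Rightarrow> real" and j
  proof -
    have "\<nu> j = density \<Lambda> (\<lambda>z. ennreal (indicator (A j) z))"
      by (simp add: \<nu>_def ennreal_indicator)
    then show ?thesis by (simp add: integral_density)
  qed
  have fin\<nu>: "finite_measure (\<nu> j)" for j
  proof
    have "emeasure (\<nu> j) (space (\<nu> j)) = (\<integral>\<^sup>+z. indicator (A j) z \<partial>\<Lambda>)"
      by (simp add: \<nu>_def emeasure_density sp)
    also have "\<dots> \<le> (\<integral>\<^sup>+z. ennreal (1 / min 1 ((r j)\<^sup>2) * min 1 ((norm z)\<^sup>2)) \<partial>\<Lambda>)"
    proof (rule nn_integral_mono)
      fix z :: 'a
      show "indicator (A j) z \<le> ennreal (1 / min 1 ((r j)\<^sup>2) * min 1 ((norm z)\<^sup>2))"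
      proof (cases "z \<in> A j")
        case True
        then have "(r j)\<^sup>2 \<le> (norm z)\<^sup>2"
          using subsetD[OF AC True] r(1)[of j] by (intro power_mono) (auto simp: C_def)
        then have "min 1 ((r j)\<^sup>2) \<le> min 1 ((norm z)\<^sup>2)" by auto
        moreover have "0 < min 1 ((r j)\<^sup>2)" using r(1)[of j] by simp
        moreover have "1 \<le> 1 / a * b" if "a \<le> b" "0 < a" for a b :: real
          using that by simp
        ultimately have "1 \<le> 1 / min 1 ((r j)\<^sup>2) * min 1 ((norm z)\<^sup>2)"
          by blast
        then show ?thesis using True by (simp flip: ennreal_1)
      qed simp
    qed
    also have "\<dots> < \<infinity>"
      using integrable_mult_right[OF int, of "1 / min 1 ((r j)\<^sup>2)"] r(1)[of j]
      by (subst nn_integral_eq_integral) auto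
    finally show "emeasure (\<nu> j) (space (\<nu> j)) \<noteq> \<infinity>" by simp
  qed
  have sym\<nu>: "distr (\<nu> j) borel uminus = \<nu> j" for j
  proof (rule measure_eqI)
    fix S assume "S \<in> sets (distr (\<nu> j) borel uminus)"
    then have S[measurable]: "S \<in> sets borel" by simp
    have "emeasure (distr (\<nu> j) borel uminus) S = (\<integral>\<^sup>+z. indicator S z \<partial>distr (\<nu> j) borel uminus)"
      by simp
    also have "\<dots> = (\<integral>\<^sup>+z. indicator (A j) z * indicator S (- z) \<partial>\<Lambda>)"
      by (subst nn_integral_distr) (auto simp: \<nu>_def nn_integral_density)
    also have "\<dots> = (\<integral>\<^sup>+z. indicator (A j) z * indicator S (- z) \<partial>distr \<Lambda> borel uminus)"
      by (simp add: sym)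
    also have "\<dots> = (\<integral>\<^sup>+z. indicator (A j) z * indicator S z \<partial>\<Lambda>)"
      by (subst nn_integral_distr) (auto simp: indicator_def minusA)
    also have "\<dots> = emeasure (\<nu> j) S"
      by (simp add: \<nu>_def emeasure_density)
    finally show "emeasure (distr (\<nu> j) borel uminus) S = emeasure (\<nu> j) S" .
  qed (simp add: s\<nu>)
  have "\<exists>\<rho>. prob_space \<rho> \<and> sets \<rho> = sets borel \<and>
    (\<forall>\<xi>. fourier_measure \<rho> \<xi> = of_real (exp (- (\<integral>z. 1 - cos (z \<bullet> \<xi>) \<partial>\<nu> j))))" for j
    by (rule infinitely_divisible_finite[OF fin\<nu> s\<nu> sym\<nu>, of j]) blast
  then obtain \<rho> where \<rho>: "\<And>j. prob_space (\<rho> j)" "\<And>j. sets (\<rho> j) = sets borel"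
    "\<And>j \<xi>. fourier_measure (\<rho> j) \<xi> = of_real (exp (- (\<integral>z. 1 - cos (z \<bullet> \<xi>) \<partial>\<nu> j)))"
    by metis
  have [measurable_cong]: "sets (\<rho> i) = sets borel" for i by (rule \<rho>)
  have tail: "measure (\<rho> (Suc j)) {y. (1 / 2) ^ j \<le> norm y} \<le> (1 / 2) ^ j" for j
  proof -
    let ?e = "1 - exp (- ((1 / 2) ^ j)\<^sup>2 / 2) :: real"
    have "measure (\<rho> (Suc j)) {y. (1 / 2) ^ j \<le> norm y} * ?e \<le> (\<integral>z. ?g z \<partial>\<nu> (Suc j))"
      by (rule infinitely_divisible_tail[OF fin\<nu> s\<nu> \<rho>]) simp
    also have "\<dots> = (\<integral>z. indicator (A (Suc j)) z * ?g z \<partial>\<Lambda>)" by (rule int\<nu>) measurable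
    also have "\<dots> \<le> F (r j)" unfolding F_def
      using Asuc by (intro integral_mono Bochner_Integration.integrable_bound[OF intg])
        (auto intro!: AE_I2 split: split_indicator)
    also have "\<dots> \<le> (1 / 2) ^ j * ?e" using r(3) by (simp add: b_def)
    finally show ?thesis by simp
  qed
  interpret R: prob_space "\<rho> i" for i by (rule \<rho>)
  interpret P: product_prob_space \<rho> UNIV ..
  let ?P = "PiM UNIV \<rho>"
  \<comment> \<open>\<open>lim\<close> is an unspecified value where the series diverges; by
    \<open>conv\<close> below this happens only on a null set.\<close>
  define X where "X \<omega> = lim (\<lambda>n. \<Sum>i<n. \<omega> i)" for \<omega> :: "nat \<Rightarrow> 'a"
  have [measurable]: "X \<in> borel_measurable ?P"
    unfolding X_def[abs_def] by measurable
  have "AE \<omega> in ?P. eventually (\<lambda>j. \<omega> \<in> space ?P - {\<omega> \<in> space ?P. (1 / 2) ^ j \<le> norm (\<omega> (Suc j))}) sequentially"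
  proof (rule borel_cantelli_AE1)
    show "summable (\<lambda>j. measure ?P {\<omega> \<in> space ?P. (1 / 2) ^ j \<le> norm (\<omega> (Suc j))})"
    proof (rule summable_comparison_test')
      show "summable (\<lambda>j. (1 / 2) ^ j :: real)" by simp
      fix j :: nat
      have "measure (\<rho> (Suc j)) {y. (1 / 2) ^ j \<le> norm y} =
        measure (distr ?P (\<rho> (Suc j)) (\<lambda>\<omega>. \<omega> (Suc j))) {y. (1 / 2) ^ j \<le> norm y}"
        by (simp add: P.PiM_component)
      also have "\<dots> = measure ?P {\<omega> \<in> space ?P. (1 / 2) ^ j \<le> norm (\<omega> (Suc j))}"
        by (subst measure_distr) (auto intro!: arg_cong2[where f=measure])
      finally show "norm (measure ?P {\<omega> \<in> space ?P. (1 / 2) ^ j \<le> norm (\<omega> (Suc j))}) \<le> (1 / 2) ^ j"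
        using tail[of j] by simp
    qed
  qed (auto simp: P.emeasure_eq_measure)
  then have conv: "AE \<omega> in ?P. (\<lambda>n. \<Sum>i<n. \<omega> i) \<longlonglongrightarrow> X \<omega>"
  proof eventually_elim
    case (elim \<omega>)
    then have "eventually (\<lambda>j. norm (\<omega> (Suc j)) \<le> (1 / 2) ^ j) sequentially"
      by eventually_elim auto
    then have "summable (\<lambda>j. \<omega> (Suc j))"
      by (rule summable_comparison_test_ev) simp
    then have "summable \<omega>" by (simp add: summable_Suc_iff)
    then have "convergent (\<lambda>n. \<Sum>i<n. \<omega> i)" by (simp add: summable_iff_convergent)
    then show ?case unfolding X_def by (simp add: convergent_LIMSEQ_iff)
  qed
  show thesis
  proof (rule that[of "distr ?P borel X"])
    show "prob_space (distr ?P borel X)" by (rule P.prob_space_distr) measurable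
    show "sets (distr ?P borel X) = sets borel" by simp
    fix \<xi> :: 'a
    have 1: "(\<lambda>n. \<integral>\<omega>. echar (\<Sum>i<n. \<omega> i) \<xi> \<partial>?P) \<longlonglongrightarrow> (\<integral>\<omega>. echar (X \<omega>) \<xi> \<partial>?P)"
    proof (rule integral_dominated_convergence[where w = "\<lambda>_. 1"])
      show "AE \<omega> in ?P. (\<lambda>n. echar (\<Sum>i<n. \<omega> i) \<xi>) \<longlonglongrightarrow> echar (X \<omega>) \<xi>"
        using conv by eventually_elim (intro tendsto_intros)
    qed auto
    \<comment> \<open>The exponents of the independent summands add up, and disjointness merges the
      rings into one indicator.\<close>
    have 2: "(\<integral>\<omega>. echar (\<Sum>i<n. \<omega> i) \<xi> \<partial>?P) =
      of_real (exp (- (\<integral>z. indicator (\<Union>i<n. A i) z * (1 - cos (z \<bullet> \<xi>)) \<partial>\<Lambda>)))" for n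
    proof -
      have "(\<Sum>i<n. \<integral>z. 1 - cos (z \<bullet> \<xi>) \<partial>\<nu> i) = (\<Sum>i<n. \<integral>z. indicator (A i) z * (1 - cos (z \<bullet> \<xi>)) \<partial>\<Lambda>)"
        by (intro sum.cong refl int\<nu>) measurable
      also have "\<dots> = (\<integral>z. (\<Sum>i<n. indicator (A i) z * (1 - cos (z \<bullet> \<xi>))) \<partial>\<Lambda>)"
        by (intro Bochner_Integration.integral_sum[symmetric] Bochner_Integration.integrable_bound[OF intc])
          (auto intro!: AE_I2 split: split_indicator)
      also have "\<dots> = (\<integral>z. indicator (\<Union>i<n. A i) z * (1 - cos (z \<bullet> \<xi>)) \<partial>\<Lambda>)"
        using disj by (intro Bochner_Integration.integral_cong refl)
          (simp add: sum_distrib_right[symmetric] indicator_UN_disjoint disjoint_family_on_mono[OF _ disj])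
      finally have "(\<Prod>i<n. exp (- (\<integral>z. 1 - cos (z \<bullet> \<xi>) \<partial>\<nu> i))) =
          exp (- (\<integral>z. indicator (\<Union>i<n. A i) z * (1 - cos (z \<bullet> \<xi>)) \<partial>\<Lambda>))"
        using exp_sum[of "{..<n}" "\<lambda>i. - (\<integral>z. 1 - cos (z \<bullet> \<xi>) \<partial>\<nu> i)"]
        by (simp only: sum_negf finite_lessThan)
      then show ?thesis
        unfolding integral_PiM_prod_echar[OF \<rho>(1,2)] \<rho>(3) of_real_prod[symmetric] by simp
    qed
    have 3: "(\<lambda>n. \<integral>z. indicator (\<Union>i<n. A i) z * (1 - cos (z \<bullet> \<xi>)) \<partial>\<Lambda>) \<longlonglongrightarrow> (\<integral>z. 1 - cos (z \<bullet> \<xi>) \<partial>\<Lambda>)"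
    proof (rule integral_dominated_convergence[where w = "\<lambda>z. 1 - cos (z \<bullet> \<xi>)"])
      show "AE z in \<Lambda>. (\<lambda>n. indicator (\<Union>i<n. A i) z * (1 - cos (z \<bullet> \<xi>))) \<longlonglongrightarrow> 1 - cos (z \<bullet> \<xi>)"
      proof (rule AE_I2)
        fix z :: 'a
        show "(\<lambda>n. indicator (\<Union>i<n. A i) z * (1 - cos (z \<bullet> \<xi>))) \<longlonglongrightarrow> 1 - cos (z \<bullet> \<xi>)"
        proof (cases "z = 0")
          case False
          then obtain j where "z \<in> A j" using UA by blast
          then have "\<forall>\<^sub>F n in sequentially. indicator (\<Union>i<n. A i) z * (1 - cos (z \<bullet> \<xi>)) = 1 - cos (z \<bullet> \<xi>)"
            by (intro eventually_sequentiallyI[of "Suc j"]) (auto simp: indicator_def Suc_le_eq)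
          then show ?thesis by (rule tendsto_eventually)
        qed simp
      qed
    qed (auto simp: intc split: split_indicator)
    have "(\<lambda>n. \<integral>\<omega>. echar (\<Sum>i<n. \<omega> i) \<xi> \<partial>?P) \<longlonglongrightarrow> of_real (exp (- (\<integral>z. 1 - cos (z \<bullet> \<xi>) \<partial>\<Lambda>)))"
      unfolding 2 by (intro tendsto_intros 3)
    with 1 have "(\<integral>\<omega>. echar (X \<omega>) \<xi> \<partial>?P) = of_real (exp (- (\<integral>z. 1 - cos (z \<bullet> \<xi>) \<partial>\<Lambda>)))"
      by (rule LIMSEQ_unique)
    then show "fourier_measure (distr ?P borel X) \<xi> = of_real (exp (- (\<integral>z. 1 - cos (z \<bullet> \<xi>) \<partial>\<Lambda>)))"
      by (simp add: fourier_measure_def integral_distr)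
  qed
qed

section \<open>The Fourier transform on integrable functions\<close>

lemma nn_integral_lborel_translate:
  fixes f :: "'a::euclidean_space \<Rightarrow> ennreal"
  assumes [measurable]: "f \<in> borel_measurable borel"
  shows "(\<integral>\<^sup>+x. f (x - a) \<partial>lborel) = (\<integral>\<^sup>+x. f x \<partial>lborel)"
  by (subst (2) lborel_distr_plus[symmetric, of "- a"], subst nn_integral_distr) (auto simp: add.commute)

lemma integral_lborel_translate:
  fixes f :: "'a::euclidean_space \<Rightarrow> 'b::{banach, second_countable_topology}"
  assumes [measurable]: "f \<in> borel_measurable borel"
  shows "(\<integral>x. f (x + a) \<partial>lborel) = (\<integral>x. f x \<partial>lborel)"
  by (subst (2) lborel_distr_plus[symmetric, of a], subst integral_distr) (auto simp: add.commute)

lemma echar_minus: "echar x (- \<xi>) = cnj (echar x \<xi>)"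
  by (simp add: exp_cnj)

lemma echar_add_right: "echar x (\<xi> + \<eta>) = echar x \<xi> * echar x \<eta>"
  by (simp add: inner_add_right algebra_simps exp_add[symmetric])

lemma fourier_measurable [measurable]:
  assumes [measurable]: "\<psi> \<in> borel_measurable borel"
  shows "fourier \<psi> \<in> borel_measurable borel"
  unfolding fourier_def[abs_def] by measurable

lemma integrable_mult_echar:
  assumes "integrable lborel \<psi>"
  shows "integrable lborel (\<lambda>x. \<psi> x * echar x \<xi>)" "integrable lborel (\<lambda>x. \<psi> x * echar \<xi> x)"
  using assms by (auto intro!: Bochner_Integration.integrable_bound[OF assms] AE_I2 simp: norm_mult)

lemma norm_fourier_le:
  assumes "integrable lborel \<psi>"
  shows "norm (fourier \<psi> \<xi>) \<le> (\<integral>x. norm (\<psi> x) \<partial>lborel)"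
  using integral_norm_bound[of lborel "\<lambda>x. \<psi> x * echar x \<xi>"]
  unfolding fourier_def norm_mult norm_echar by simp

lemma (in pair_sigma_finite) integrable_mult_pair:
  fixes f :: "'a \<Rightarrow> 'c::{real_normed_field, banach, second_countable_topology}"
  assumes f: "integrable M1 f" and g: "integrable M2 g"
  shows "integrable (M1 \<Otimes>\<^sub>M M2) (\<lambda>(x, y). f x * g y)"
proof (rule Fubini_integrable)
  show "(\<lambda>(x, y). f x * g y) \<in> borel_measurable (M1 \<Otimes>\<^sub>M M2)"
    using f g by measurable
  show "integrable M1 (\<lambda>x. \<integral>y. norm (case (x, y) of (x, y) \<Rightarrow> f x * g y) \<partial>M2)"
    using f by (simp add: norm_mult)
  show "AE x in M1. integrable M2 (\<lambda>y. case (x, y) of (x, y) \<Rightarrow> f x * g y)"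
    using g by simp
qed

text \<open>The multiplication formula: Fubini for a kernel that is symmetric in its two
  variables.\<close>

lemma integral_mult_fourier:
  fixes f g :: "'a::euclidean_space \<Rightarrow> complex"
  assumes f: "integrable lborel f" and g: "integrable lborel g"
  shows "(\<integral>x. f x * fourier g x \<partial>lborel) = (\<integral>\<xi>. fourier f \<xi> * g \<xi> \<partial>lborel)"
proof -
  have [measurable]: "f \<in> borel_measurable borel" "g \<in> borel_measurable borel"
    using f g by auto
  have "integrable (lborel \<Otimes>\<^sub>M lborel) (\<lambda>(x, \<xi>). f x * g \<xi> * echar x \<xi>)"
    by (rule Bochner_Integration.integrable_bound[OF lborel_pair.integrable_mult_pair[OF f g]])
      (auto simp: norm_mult)
  from lborel_pair.Fubini_integral[OF this]
  have "(\<integral>\<xi>. (\<integral>x. f x * g \<xi> * echar x \<xi> \<partial>lborel) \<partial>lborel) = (\<integral>x. (\<integral>\<xi>. f x * g \<xi> * echar x \<xi> \<partial>lborel) \<partial>lborel)"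
    by simp
  moreover have "(\<integral>x. f x * g \<xi> * echar x \<xi> \<partial>lborel) = fourier f \<xi> * g \<xi>" for \<xi>
    unfolding fourier_def by (subst integral_mult_left_zero[symmetric]) (simp add: mult_ac)
  moreover have "(\<integral>\<xi>. f x * g \<xi> * echar x \<xi> \<partial>lborel) = f x * fourier g x" for x
    unfolding fourier_def by (subst integral_mult_right_zero[symmetric]) (simp add: mult_ac inner_commute)
  ultimately show ?thesis by simp
qed

lemma fourier_gauss_modulated:
  fixes \<xi> :: "'a::euclidean_space"
  assumes c: "0 < c"
  shows "fourier (\<lambda>x. of_real (exp (- c * (norm x)\<^sup>2)) * echar x (- \<eta>)) \<xi> =
    of_real (sqrt (pi / c) ^ DIM('a) * exp (- (1 / (4 * c)) * (norm (\<xi> - \<eta>))\<^sup>2))"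
proof -
  have "fourier (\<lambda>x. of_real (exp (- c * (norm x)\<^sup>2)) * echar x (- \<eta>)) \<xi> =
      (\<integral>x. of_real (exp (- c * (norm x)\<^sup>2)) * echar x (\<xi> + - \<eta>) \<partial>lborel)"
    unfolding fourier_def echar_add_right by (simp add: mult_ac)
  also have "\<dots> = of_real (sqrt (pi / c) ^ DIM('a) * exp (- (1 / (4 * c)) * (norm (\<xi> - \<eta>))\<^sup>2))"
    using gauss_fourier[OF c, of "\<xi> + - \<eta>"] by (simp add: has_bochner_integral_iff)
  finally show ?thesis .
qed

lemma integrable_gauss_modulated:
  fixes \<eta> :: "'a::euclidean_space"
  assumes c: "0 < c"
  shows "integrable lborel (\<lambda>x. of_real (exp (- c * (norm x)\<^sup>2)) * echar x \<eta>)"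
  using gauss_fourier[OF c, of \<eta>] by (simp only: has_bochner_integral_iff)

text \<open>Half of Plancherel with a Gaussian regulariser. Expanding the square and integrating in
  the frequency first turns the left-hand side into a quadratic form in \<open>\<psi>\<close> with
  the convolution kernel \<open>G\<close>, the transform of the Gaussian. The mass of
  \<open>G\<close>, and so the bound, does not depend on \<open>c\<close>.\<close>

lemma gauss_fourier_L2_le:
  fixes \<psi> :: "'a::euclidean_space \<Rightarrow> complex"
  assumes \<psi>1: "integrable lborel \<psi>" and \<psi>2: "integrable lborel (\<lambda>x. (norm (\<psi> x))\<^sup>2)" and c: "0 < c"
  shows "(\<integral>\<^sup>+x. ennreal (exp (- c * (norm x)\<^sup>2) * (norm (fourier \<psi> x))\<^sup>2) \<partial>lborel)
    \<le> ennreal ((2 * pi) ^ DIM('a) * (\<integral>x. (norm (\<psi> x))\<^sup>2 \<partial>lborel))"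
proof -
  have [measurable]: "\<psi> \<in> borel_measurable borel" using \<psi>1 by auto
  have [measurable]: "cnj \<in> borel_measurable borel"
    by (intro borel_measurable_continuous_onI continuous_intros)
  define E where "E x = complex_of_real (exp (- c * (norm x)\<^sup>2))" for x :: 'a
  define G where "G \<zeta> = sqrt (pi / c) ^ DIM('a) * exp (- (1 / (4 * c)) * (norm \<zeta>)\<^sup>2)" for \<zeta> :: 'a
  have [measurable]: "E \<in> borel_measurable borel" unfolding E_def[abs_def] by measurable
  have [measurable]: "G \<in> borel_measurable borel" unfolding G_def[abs_def] by measurable
  have G0: "0 \<le> G \<zeta>" for \<zeta> using c by (simp add: G_def)
  have Gle: "G \<zeta> \<le> sqrt (pi / c) ^ DIM('a)" for \<zeta> using c by (simp add: G_def mult_left_le)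
  \<comment> \<open>The two Gaussian constants multiply to (pi / c) * (4 pi c) = (2 pi)^2 per
    coordinate under the square root, so \<open>c\<close> cancels.\<close>
  have Gint: "has_bochner_integral lborel G ((2 * pi) ^ DIM('a))"
  proof -
    have "has_bochner_integral lborel G (sqrt (pi / c) ^ DIM('a) * sqrt (pi / (1 / (4 * c))) ^ DIM('a))"
      unfolding G_def[abs_def] using c by (intro has_bochner_integral_mult_right gauss_integral) auto
    also have "sqrt (pi / c) ^ DIM('a) * sqrt (pi / (1 / (4 * c))) ^ DIM('a) = sqrt ((2 * pi)\<^sup>2) ^ DIM('a)"
      using c unfolding power_mult_distrib[symmetric] real_sqrt_mult[symmetric]
      by (simp add: power2_eq_square mult_ac)
    finally show ?thesis by (simp only: real_sqrt_abs abs_of_nonneg pi_ge_zero mult_nonneg_nonneg zero_le_numeral)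
  qed
  have Eint: "integrable lborel E"
    using integrable_gauss_modulated[OF c, of 0] by (simp add: E_def[abs_def])
  have E\<psi>: "integrable lborel (\<lambda>x. E x * fourier \<psi> x)"
    by (rule Bochner_Integration.integrable_bound[OF integrable_mult_left[OF Eint, of "of_real (\<integral>x. norm (\<psi> x) \<partial>lborel)"]])
      (auto intro!: mult_left_mono AE_I2 norm_fourier_le[OF \<psi>1] simp: norm_mult)
  have i: "integrable (lborel \<Otimes>\<^sub>M lborel) (\<lambda>(x, \<eta>). E x * fourier \<psi> x * cnj (\<psi> \<eta>) * echar x (- \<eta>))"
    by (rule Bochner_Integration.integrable_bound[OF lborel_pair.integrable_mult_pair[OF E\<psi> integrable_cnj[OF \<psi>1]]])
      (auto simp: norm_mult simp del: inner_minus_right)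
  define H where "H \<eta> = (\<integral>x. E x * fourier \<psi> x * cnj (\<psi> \<eta>) * echar x (- \<eta>) \<partial>lborel)" for \<eta>
  have Hint: "integrable lborel H"
    unfolding H_def[abs_def] by (rule lborel_pair.integrable_snd[OF i])
  have H: "H \<eta> = cnj (\<psi> \<eta>) * (\<integral>\<xi>. of_real (G (\<xi> - \<eta>)) * \<psi> \<xi> \<partial>lborel)" for \<eta>
  proof -
    have "H \<eta> = cnj (\<psi> \<eta>) * (\<integral>x. (E x * echar x (- \<eta>)) * fourier \<psi> x \<partial>lborel)"
      unfolding H_def by (subst integral_mult_right_zero[symmetric]) (simp add: mult_ac)
    also have "(\<integral>x. (E x * echar x (- \<eta>)) * fourier \<psi> x \<partial>lborel) =
        (\<integral>\<xi>. fourier (\<lambda>x. E x * echar x (- \<eta>)) \<xi> * \<psi> \<xi> \<partial>lborel)"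
      unfolding E_def by (intro integral_mult_fourier integrable_gauss_modulated c \<psi>1)
    also have "\<dots> = (\<integral>\<xi>. of_real (G (\<xi> - \<eta>)) * \<psi> \<xi> \<partial>lborel)"
      unfolding E_def fourier_gauss_modulated[OF c] G_def ..
    finally show ?thesis .
  qed
  have e: "complex_of_real (exp (- c * (norm x)\<^sup>2) * (norm (fourier \<psi> x))\<^sup>2) =
    (\<integral>\<eta>. E x * fourier \<psi> x * cnj (\<psi> \<eta>) * echar x (- \<eta>) \<partial>lborel)" for x
  proof -
    have "(\<integral>\<eta>. E x * fourier \<psi> x * cnj (\<psi> \<eta>) * echar x (- \<eta>) \<partial>lborel) =
      E x * fourier \<psi> x * (\<integral>\<eta>. cnj (\<psi> \<eta> * echar \<eta> x) \<partial>lborel)"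
      by (subst integral_mult_right_zero[symmetric]) (simp only: echar_minus complex_cnj_mult mult_ac inner_commute)
    also have "\<dots> = E x * (fourier \<psi> x * cnj (fourier \<psi> x))"
      by (simp only: fourier_def mult.assoc Bochner_Integration.integral_cnj)
    also have "\<dots> = complex_of_real (exp (- c * (norm x)\<^sup>2) * (norm (fourier \<psi> x))\<^sup>2)"
      unfolding complex_norm_square[symmetric] by (simp add: E_def)
    finally show ?thesis ..
  qed
  have int1: "integrable lborel (\<lambda>x. complex_of_real (exp (- c * (norm x)\<^sup>2) * (norm (fourier \<psi> x))\<^sup>2))"
    unfolding e by (rule lborel_pair.integrable_fst[OF i])
  have int2: "integrable lborel (\<lambda>x. exp (- c * (norm x)\<^sup>2) * (norm (fourier \<psi> x))\<^sup>2)"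
    using int1 by (simp only: complex_of_real_integrable_eq)
  have "complex_of_real (\<integral>x. exp (- c * (norm x)\<^sup>2) * (norm (fourier \<psi> x))\<^sup>2 \<partial>lborel) = (\<integral>\<eta>. H \<eta> \<partial>lborel)"
    unfolding integral_complex_of_real[symmetric] e H_def by (rule lborel_pair.Fubini_integral[OF i, symmetric])
  from arg_cong[where f=norm, OF this, unfolded norm_of_real]
  have "(\<integral>x. exp (- c * (norm x)\<^sup>2) * (norm (fourier \<psi> x))\<^sup>2 \<partial>lborel) \<le> norm (\<integral>\<eta>. H \<eta> \<partial>lborel)"
    by (rule ord_le_eq_trans[OF abs_ge_self])
  then have "(\<integral>\<^sup>+x. ennreal (exp (- c * (norm x)\<^sup>2) * (norm (fourier \<psi> x))\<^sup>2) \<partial>lborel) \<le> ennreal (norm (\<integral>\<eta>. H \<eta> \<partial>lborel))"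
    using int2 by (subst nn_integral_eq_integral) (auto intro: ennreal_leI)
  also have "\<dots> \<le> (\<integral>\<^sup>+\<eta>. ennreal (norm (H \<eta>)) \<partial>lborel)"
    by (rule integral_norm_bound_ennreal[OF Hint])
  \<comment> \<open>The Schur test: the product of two values of \<open>\<psi>\<close> is split by
    the arithmetic-geometric mean inequality, and each half sees only the mass of
    \<open>G\<close>.\<close>
  also have "\<dots> \<le> (\<integral>\<^sup>+\<eta>. (\<integral>\<^sup>+\<xi>. ennreal (G (\<xi> - \<eta>)) * ennreal ((norm (\<psi> \<eta>))\<^sup>2 / 2)
      + ennreal (G (\<xi> - \<eta>)) * ennreal ((norm (\<psi> \<xi>))\<^sup>2 / 2) \<partial>lborel) \<partial>lborel)"
  proof (rule nn_integral_mono)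
    fix \<eta> :: 'a
    have "integrable lborel (\<lambda>\<xi>. of_real (G (\<xi> - \<eta>)) * \<psi> \<xi>)"
      by (rule Bochner_Integration.integrable_bound[OF integrable_mult_right[OF \<psi>1, of "of_real (sqrt (pi / c) ^ DIM('a))"]])
        (use G0 Gle c in \<open>auto intro!: AE_I2 mult_right_mono simp: norm_mult norm_power\<close>)
    then have i: "integrable lborel (\<lambda>\<xi>. cnj (\<psi> \<eta>) * (of_real (G (\<xi> - \<eta>)) * \<psi> \<xi>))"
      by (rule integrable_mult_right)
    have "ennreal (norm (H \<eta>)) = ennreal (norm (\<integral>\<xi>. cnj (\<psi> \<eta>) * (of_real (G (\<xi> - \<eta>)) * \<psi> \<xi>) \<partial>lborel))"
      by (simp add: H)
    also have "\<dots> \<le> (\<integral>\<^sup>+\<xi>. ennreal (norm (cnj (\<psi> \<eta>) * (of_real (G (\<xi> - \<eta>)) * \<psi> \<xi>))) \<partial>lborel)"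
      by (rule integral_norm_bound_ennreal[OF i])
    also have "\<dots> \<le> (\<integral>\<^sup>+\<xi>. ennreal (G (\<xi> - \<eta>)) * ennreal ((norm (\<psi> \<eta>))\<^sup>2 / 2)
      + ennreal (G (\<xi> - \<eta>)) * ennreal ((norm (\<psi> \<xi>))\<^sup>2 / 2) \<partial>lborel)"
    proof (rule nn_integral_mono)
      fix \<xi> :: 'a
      have "norm (\<psi> \<eta>) * norm (\<psi> \<xi>) \<le> (norm (\<psi> \<eta>))\<^sup>2 / 2 + (norm (\<psi> \<xi>))\<^sup>2 / 2"
        using sum_squares_bound[of "norm (\<psi> \<eta>)" "norm (\<psi> \<xi>)"] by (simp add: field_simps)
      then have "G (\<xi> - \<eta>) * (norm (\<psi> \<eta>) * norm (\<psi> \<xi>)) \<le> G (\<xi> - \<eta>) * ((norm (\<psi> \<eta>))\<^sup>2 / 2 + (norm (\<psi> \<xi>))\<^sup>2 / 2)"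
        by (rule mult_left_mono) (rule G0)
      then have "norm (cnj (\<psi> \<eta>) * (of_real (G (\<xi> - \<eta>)) * \<psi> \<xi>)) \<le>
          G (\<xi> - \<eta>) * ((norm (\<psi> \<eta>))\<^sup>2 / 2) + G (\<xi> - \<eta>) * ((norm (\<psi> \<xi>))\<^sup>2 / 2)"
        using G0[of "\<xi> - \<eta>"] by (simp add: norm_mult distrib_left mult_ac)
      then show "ennreal (norm (cnj (\<psi> \<eta>) * (of_real (G (\<xi> - \<eta>)) * \<psi> \<xi>))) \<le>
          ennreal (G (\<xi> - \<eta>)) * ennreal ((norm (\<psi> \<eta>))\<^sup>2 / 2)
        + ennreal (G (\<xi> - \<eta>)) * ennreal ((norm (\<psi> \<xi>))\<^sup>2 / 2)"
        using G0[of "\<xi> - \<eta>"] by (simp only: ennreal_mult[symmetric] ennreal_plus[symmetric] divide_nonneg_nonneg zero_le_power2 mult_nonneg_nonneg zero_le_numeral ennreal_leI)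
    qed
    finally show "ennreal (norm (H \<eta>)) \<le> (\<integral>\<^sup>+\<xi>. ennreal (G (\<xi> - \<eta>)) * ennreal ((norm (\<psi> \<eta>))\<^sup>2 / 2)
      + ennreal (G (\<xi> - \<eta>)) * ennreal ((norm (\<psi> \<xi>))\<^sup>2 / 2) \<partial>lborel)" .
  qed
  also have "\<dots> = (\<integral>\<^sup>+\<eta>. (\<integral>\<^sup>+\<xi>. ennreal (G (\<xi> - \<eta>)) * ennreal ((norm (\<psi> \<eta>))\<^sup>2 / 2) \<partial>lborel) \<partial>lborel)
      + (\<integral>\<^sup>+\<eta>. (\<integral>\<^sup>+\<xi>. ennreal (G (\<xi> - \<eta>)) * ennreal ((norm (\<psi> \<xi>))\<^sup>2 / 2) \<partial>lborel) \<partial>lborel)"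
    by (subst nn_integral_add, measurable)+
  also have "(\<integral>\<^sup>+\<eta>. (\<integral>\<^sup>+\<xi>. ennreal (G (\<xi> - \<eta>)) * ennreal ((norm (\<psi> \<xi>))\<^sup>2 / 2) \<partial>lborel) \<partial>lborel) =
      (\<integral>\<^sup>+\<xi>. (\<integral>\<^sup>+\<eta>. ennreal (G (\<xi> - \<eta>)) * ennreal ((norm (\<psi> \<xi>))\<^sup>2 / 2) \<partial>lborel) \<partial>lborel)"
    by (rule lborel_pair.Fubini') measurable
  also have "(\<lambda>\<xi> \<eta>. ennreal (G (\<xi> - \<eta>)) * ennreal ((norm (\<psi> \<xi>))\<^sup>2 / 2)) =
      (\<lambda>\<xi> \<eta>. ennreal (G (\<eta> - \<xi>)) * ennreal ((norm (\<psi> \<xi>))\<^sup>2 / 2))"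
    by (simp add: G_def norm_minus_commute)
  also have "(\<integral>\<^sup>+\<eta>. (\<integral>\<^sup>+\<xi>. ennreal (G (\<xi> - \<eta>)) * ennreal ((norm (\<psi> \<eta>))\<^sup>2 / 2) \<partial>lborel) \<partial>lborel) =
      ennreal ((2 * pi) ^ DIM('a)) * ennreal ((\<integral>x. (norm (\<psi> x))\<^sup>2 \<partial>lborel) / 2)"
  proof -
    have "(\<integral>\<^sup>+\<xi>. ennreal (G (\<xi> - \<eta>)) \<partial>lborel) = ennreal ((2 * pi) ^ DIM('a))" for \<eta>
      using Gint G0 by (subst nn_integral_lborel_translate) (auto simp: nn_integral_eq_integral has_bochner_integral_iff)
    moreover have "(\<integral>\<^sup>+x. ennreal ((norm (\<psi> x))\<^sup>2 / 2) \<partial>lborel) = ennreal ((\<integral>x. (norm (\<psi> x))\<^sup>2 \<partial>lborel) / 2)"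
      using \<psi>2 by (subst nn_integral_eq_integral) auto
    ultimately show ?thesis
      by (simp add: nn_integral_multc nn_integral_cmult)
  qed
  also have "ennreal ((2 * pi) ^ DIM('a)) * ennreal ((\<integral>x. (norm (\<psi> x))\<^sup>2 \<partial>lborel) / 2) +
      ennreal ((2 * pi) ^ DIM('a)) * ennreal ((\<integral>x. (norm (\<psi> x))\<^sup>2 \<partial>lborel) / 2) =
      ennreal ((2 * pi) ^ DIM('a) * (\<integral>x. (norm (\<psi> x))\<^sup>2 \<partial>lborel))"
    by (subst distrib_left[symmetric], subst ennreal_plus[symmetric]) (simp_all add: ennreal_mult)
  finally show ?thesis .
qed

text \<open>The regulariser is removed by Fatou's lemma along c = 1 / (n + 1), as the bound is
  uniform in \<open>c\<close>.\<close>

lemma fourier_L2: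
  fixes \<psi> :: "'a::euclidean_space \<Rightarrow> complex"
  assumes \<psi>1: "integrable lborel \<psi>" and \<psi>2: "integrable lborel (\<lambda>x. (norm (\<psi> x))\<^sup>2)"
  shows "integrable lborel (\<lambda>x. (norm (fourier \<psi> x))\<^sup>2)"
proof (rule integrableI_nonneg)
  have [measurable]: "\<psi> \<in> borel_measurable borel" using \<psi>1 by auto
  show "(\<lambda>x. (norm (fourier \<psi> x))\<^sup>2) \<in> borel_measurable lborel" by measurable
  let ?K = "ennreal ((2 * pi) ^ DIM('a) * (\<integral>x. (norm (\<psi> x))\<^sup>2 \<partial>lborel))"
  let ?f = "\<lambda>n x. ennreal (exp (- (1 / real (Suc n)) * (norm x)\<^sup>2) * (norm (fourier \<psi> x))\<^sup>2)"
  have "(\<integral>\<^sup>+x. ennreal ((norm (fourier \<psi> x))\<^sup>2) \<partial>lborel) = (\<integral>\<^sup>+x. liminf (\<lambda>n. ?f n x) \<partial>lborel)"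
  proof (rule nn_integral_cong)
    fix x :: 'a
    have "(\<lambda>n. exp (- (1 / real (Suc n)) * (norm x)\<^sup>2) * (norm (fourier \<psi> x))\<^sup>2) \<longlonglongrightarrow>
        exp (- 0 * (norm x)\<^sup>2) * (norm (fourier \<psi> x))\<^sup>2"
      using LIMSEQ_inverse_real_of_nat by (intro tendsto_intros) (simp add: inverse_eq_divide)
    then have "(\<lambda>n. ?f n x) \<longlonglongrightarrow> ennreal ((norm (fourier \<psi> x))\<^sup>2)"
      by (intro tendsto_ennrealI) simp
    then show "ennreal ((norm (fourier \<psi> x))\<^sup>2) = liminf (\<lambda>n. ?f n x)"
      by (intro lim_imp_Liminf[symmetric]) auto
  qed
  also have "\<dots> \<le> liminf (\<lambda>n. \<integral>\<^sup>+x. ?f n x \<partial>lborel)"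
    by (rule nn_integral_liminf) measurable
  also have "\<dots> \<le> liminf (\<lambda>n. ?K)"
    by (intro Liminf_mono always_eventually allI gauss_fourier_L2_le assms) simp
  also have "\<dots> < \<infinity>" by (simp add: Liminf_const)
  finally show "(\<integral>\<^sup>+x. ennreal ((norm (fourier \<psi> x))\<^sup>2) \<partial>lborel) < \<infinity>" .
qed simp

section \<open>Weighted averages of translates\<close>

lemma powr_tangent_le:
  fixes p a x :: real
  assumes p: "1 \<le> p" and a: "0 < a" and x: "0 \<le> x"
  shows "a powr p + p * a powr (p - 1) * (x - a) \<le> x powr p"
\<comment> \<open>The tangent argument is applied on the open half-line; the endpoint is computed
  directly.\<close>
proof (cases "x = 0")
  case True
  have "a powr (p - 1) * a = a powr p" using a by (simp add: powr_diff)
  then have "a powr p + p * a powr (p - 1) * (x - a) = (1 - p) * a powr p"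
    using True by (simp add: algebra_simps)
  then show ?thesis using True p by (simp add: mult_nonpos_nonneg)
next
  case False
  have "p * a powr (p - 1) * (x - a) \<le> x powr p - a powr p"
    by (rule convex_on_imp_above_tangent[OF powr_convex[OF p]])
      (use a x False in \<open>auto intro!: derivative_eq_intros simp: interior_open\<close>)
  then show ?thesis by simp
qed

lemma le_one_add_powr:
  fixes p y :: real
  assumes "0 \<le> y" "1 \<le> p"
  shows "y \<le> 1 + y powr p"
proof (cases "1 \<le> y")
  case True
  then have "y powr 1 \<le> y powr p" using assms by (intro powr_mono) auto
  then show ?thesis using True by simp
next
  case False
  then show ?thesis using powr_ge_zero[of y p] by linarith
qed

text \<open>Jensen's inequality, by integrating the tangent of r^p at the mean \<open>a\<close>. If
  the right-hand side is infinite there is nothing to show; if it is finite, y \<le> 1 + y^p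
  supplies the integrability of \<open>h\<close>.\<close>

lemma (in prob_space) norm_integral_powr_le:
  fixes h :: "'a \<Rightarrow> 'b::{banach, second_countable_topology}"
  assumes p: "1 \<le> p" and [measurable]: "h \<in> borel_measurable M"
  shows "ennreal (norm (\<integral>x. h x \<partial>M) powr p) \<le> (\<integral>\<^sup>+x. ennreal (norm (h x) powr p) \<partial>M)"
proof (cases "(\<integral>\<^sup>+x. ennreal (norm (h x) powr p) \<partial>M) < \<infinity>")
  case True
  have ip: "integrable M (\<lambda>x. norm (h x) powr p)"
    by (rule integrableI_nonneg) (use True in auto)
  have i: "integrable M (\<lambda>x. norm (h x))"
    by (rule Bochner_Integration.integrable_bound[of _ "\<lambda>x. 1 + norm (h x) powr p"])
      (use ip le_one_add_powr[OF _ p] in auto)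
  define a where "a = (\<integral>x. norm (h x) \<partial>M)"
  have a: "0 \<le> a" unfolding a_def by simp
  have "norm (\<integral>x. h x \<partial>M) powr p \<le> a powr p"
    unfolding a_def using p by (intro powr_mono2 integral_norm_bound) auto
  also have "\<dots> \<le> (\<integral>x. norm (h x) powr p \<partial>M)"
  proof (cases "a = 0")
    case False
    have "a powr p = (\<integral>x. a powr p + p * a powr (p - 1) * (norm (h x) - a) \<partial>M)"
      using i by (simp add: prob_space a_def)
    also have "\<dots> \<le> (\<integral>x. norm (h x) powr p \<partial>M)"
      using i ip a False p by (intro integral_mono powr_tangent_le) auto
    finally show ?thesis .
  qed simp
  finally show ?thesis
    using ip by (subst nn_integral_eq_integral) (auto intro: ennreal_leI)
qed (simp add: not_less top_unique)

text \<open>Convolution with the signed measure obtained by pushing the density \<open>w\<close> on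
  \<open>M\<close> forward along \<open>X\<close>; \<open>weighted_char\<close> is the Fourier
  transform of that measure. Keeping sign and displacement on one probability space avoids signed
  measures.\<close>

definition weighted_translate ::
    "'b measure \<Rightarrow> ('b \<Rightarrow> real) \<Rightarrow> ('b \<Rightarrow> 'a::euclidean_space) \<Rightarrow> ('a \<Rightarrow> complex) \<Rightarrow> 'a \<Rightarrow> complex" where
  "weighted_translate M w X f x = (\<integral>\<omega>. of_real (w \<omega>) * f (x - X \<omega>) \<partial>M)"

definition weighted_char ::
    "'b measure \<Rightarrow> ('b \<Rightarrow> real) \<Rightarrow> ('b \<Rightarrow> 'a::euclidean_space) \<Rightarrow> 'a \<Rightarrow> complex" where
  "weighted_char M w X \<xi> = (\<integral>\<omega>. of_real (w \<omega>) * echar (X \<omega>) \<xi> \<partial>M)"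

text \<open>\<open>C\<close> bounds the weight and thus the total variation of the represented
  signed measure. It becomes the operator bound on every L^p.\<close>

locale weighted_translation = prob_space M
  for M :: "'b measure" and w :: "'b \<Rightarrow> real" and X :: "'b \<Rightarrow> 'a::euclidean_space" and C :: real +
  assumes w_measurable [measurable]: "w \<in> borel_measurable M"
    and X_measurable [measurable]: "X \<in> borel_measurable M"
    and w_le: "\<And>\<omega>. \<bar>w \<omega>\<bar> \<le> C"
begin

lemma C_nonneg: "0 \<le> C"
  using w_le order_trans[OF abs_ge_zero] by blast

lemma weighted_translate_measurable:
  assumes [measurable]: "f \<in> borel_measurable borel"
  shows "weighted_translate M w X f \<in> borel_measurable borel"
  unfolding weighted_translate_def by measurable

text \<open>Jensen in \<omega>, then Tonelli, then translation invariance of Lebesgue measure for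
  each fixed \<omega>.\<close>

lemma nn_integral_weighted_translate:
  assumes p: "1 \<le> p" and [measurable]: "f \<in> borel_measurable borel"
  shows "(\<integral>\<^sup>+x. ennreal (norm (weighted_translate M w X f x) powr p) \<partial>lborel)
    \<le> ennreal (C powr p) * (\<integral>\<^sup>+x. ennreal (norm (f x) powr p) \<partial>lborel)"
proof -
  interpret pair_sigma_finite "lborel :: 'a measure" M ..
  have "(\<integral>\<^sup>+x. ennreal (norm (weighted_translate M w X f x) powr p) \<partial>lborel) \<le>
    (\<integral>\<^sup>+x. (\<integral>\<^sup>+\<omega>. ennreal (norm (of_real (w \<omega>) * f (x - X \<omega>)) powr p) \<partial>M) \<partial>lborel)"
    unfolding weighted_translate_def using p by (intro nn_integral_mono norm_integral_powr_le) measurable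
  also have "\<dots> \<le> (\<integral>\<^sup>+x. (\<integral>\<^sup>+\<omega>. ennreal (C powr p) * ennreal (norm (f (x - X \<omega>)) powr p) \<partial>M) \<partial>lborel)"
  proof (intro nn_integral_mono)
    fix x \<omega>
    have "norm (of_real (w \<omega>) * f (x - X \<omega>)) powr p \<le> (C * norm (f (x - X \<omega>))) powr p"
      using w_le[of \<omega>] p by (intro powr_mono2) (auto simp: norm_mult mult_right_mono)
    also have "\<dots> = C powr p * norm (f (x - X \<omega>)) powr p"
      using C_nonneg by (simp add: powr_mult)
    finally show "ennreal (norm (of_real (w \<omega>) * f (x - X \<omega>)) powr p) \<le>
      ennreal (C powr p) * ennreal (norm (f (x - X \<omega>)) powr p)"
      by (simp add: ennreal_mult[symmetric] ennreal_leI)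
  qed
  also have "\<dots> = (\<integral>\<^sup>+\<omega>. (\<integral>\<^sup>+x. ennreal (C powr p) * ennreal (norm (f (x - X \<omega>)) powr p) \<partial>lborel) \<partial>M)"
    by (rule Fubini'[symmetric]) measurable
  also have "\<dots> = (\<integral>\<^sup>+\<omega>. ennreal (C powr p) * (\<integral>\<^sup>+x. ennreal (norm (f x) powr p) \<partial>lborel) \<partial>M)"
    by (subst nn_integral_cmult, measurable)
      (subst nn_integral_lborel_translate[of "\<lambda>x. ennreal (norm (f x) powr p)"], measurable)
  also have "\<dots> = ennreal (C powr p) * (\<integral>\<^sup>+x. ennreal (norm (f x) powr p) \<partial>lborel)"
    by (simp add: emeasure_space_1)
  finally show ?thesis .
qed

lemma weighted_translate_Lp:
  assumes p: "1 \<le> p" and f: "f \<in> Lp p"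
  shows "weighted_translate M w X f \<in> Lp p"
    and "Lp_norm p (weighted_translate M w X f) \<le> C * Lp_norm p f"
proof -
  have [measurable]: "f \<in> borel_measurable borel" and fi: "integrable lborel (\<lambda>x. norm (f x) powr p)"
    using f by (auto simp: Lp_def)
  note [measurable] = weighted_translate_measurable
  let ?T = "weighted_translate M w X f"
  have e: "(\<integral>\<^sup>+x. ennreal (norm (f x) powr p) \<partial>lborel) = ennreal (\<integral>x. norm (f x) powr p \<partial>lborel)"
    using fi by (intro nn_integral_eq_integral) auto
  have le: "(\<integral>\<^sup>+x. ennreal (norm (?T x) powr p) \<partial>lborel) \<le> ennreal (C powr p * (\<integral>x. norm (f x) powr p \<partial>lborel))"
    using nn_integral_weighted_translate[OF p, of f] by (simp add: e ennreal_mult)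
  have i: "integrable lborel (\<lambda>x. norm (?T x) powr p)"
    by (rule integrableI_nonneg) (use order.strict_trans1[OF le ennreal_less_top] in auto)
  then show "?T \<in> Lp p" by (simp add: Lp_def weighted_translate_measurable)
  have "(\<integral>x. norm (?T x) powr p \<partial>lborel) \<le> C powr p * (\<integral>x. norm (f x) powr p \<partial>lborel)"
    using le i by (subst (asm) nn_integral_eq_integral) auto
  then have "Lp_norm p ?T \<le> (C powr p * (\<integral>x. norm (f x) powr p \<partial>lborel)) powr (1 / p)"
    unfolding Lp_norm_def using p by (intro powr_mono2) auto
  also have "\<dots> = C * Lp_norm p f"
    using p C_nonneg by (simp add: powr_mult powr_powr Lp_norm_def)
  finally show "Lp_norm p ?T \<le> C * Lp_norm p f" .
qed

end

context weighted_translation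
begin

text \<open>Justifies Fubini for pairings with random translates: translation does not change the
  L^2 norm, so \<open>K\<close> and \<open>L\<close> are independent of \<omega>, and |a b| \<le>
  |a|^2 + |b|^2.\<close>

lemma integrable_weighted_product:
  fixes a b :: "'a \<Rightarrow> 'b \<Rightarrow> complex"
  assumes [measurable]: "case_prod a \<in> borel_measurable (borel \<Otimes>\<^sub>M M)" "case_prod b \<in> borel_measurable (borel \<Otimes>\<^sub>M M)"
    and a: "\<And>\<omega>. (\<integral>\<^sup>+x. ennreal ((norm (a x \<omega>))\<^sup>2) \<partial>lborel) = ennreal K"
    and b: "\<And>\<omega>. (\<integral>\<^sup>+x. ennreal ((norm (b x \<omega>))\<^sup>2) \<partial>lborel) = ennreal L"
  shows "integrable (lborel \<Otimes>\<^sub>M M) (\<lambda>(x, \<omega>). of_real (w \<omega>) * (a x \<omega> * b x \<omega>))"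
proof (rule integrableI_bounded)
  interpret pair_sigma_finite "lborel :: 'a measure" M ..
  have "(\<integral>\<^sup>+z. ennreal (norm (case z of (x, \<omega>) \<Rightarrow> of_real (w \<omega>) * (a x \<omega> * b x \<omega>))) \<partial>(lborel \<Otimes>\<^sub>M M)) =
    (\<integral>\<^sup>+\<omega>. (\<integral>\<^sup>+x. ennreal (norm (of_real (w \<omega>) * (a x \<omega> * b x \<omega>))) \<partial>lborel) \<partial>M)"
    by (subst nn_integral_snd[symmetric]) (auto simp: case_prod_unfold)
  also have "\<dots> \<le> (\<integral>\<^sup>+\<omega>. ennreal C * (ennreal K + ennreal L) \<partial>M)"
  proof (rule nn_integral_mono)
    fix \<omega> assume [measurable]: "\<omega> \<in> space M"
    have [measurable]: "(\<lambda>x. a x \<omega>) \<in> borel_measurable borel" "(\<lambda>x. b x \<omega>) \<in> borel_measurable borel"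
      by measurable
    have "(\<integral>\<^sup>+x. ennreal (norm (of_real (w \<omega>) * (a x \<omega> * b x \<omega>))) \<partial>lborel) \<le>
      (\<integral>\<^sup>+x. ennreal C * (ennreal ((norm (a x \<omega>))\<^sup>2) + ennreal ((norm (b x \<omega>))\<^sup>2)) \<partial>lborel)"
    proof (rule nn_integral_mono)
      fix x
      have "2 * (norm (a x \<omega>) * norm (b x \<omega>)) \<le> (norm (a x \<omega>))\<^sup>2 + (norm (b x \<omega>))\<^sup>2"
        using sum_squares_bound[of "norm (a x \<omega>)" "norm (b x \<omega>)"] by simp
      then have "norm (a x \<omega>) * norm (b x \<omega>) \<le> (norm (a x \<omega>))\<^sup>2 + (norm (b x \<omega>))\<^sup>2"
        using mult_nonneg_nonneg[OF norm_ge_zero[of "a x \<omega>"] norm_ge_zero[of "b x \<omega>"]] by linarith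
      then have "norm (of_real (w \<omega>) * (a x \<omega> * b x \<omega>)) \<le> C * ((norm (a x \<omega>))\<^sup>2 + (norm (b x \<omega>))\<^sup>2)"
        using w_le[of \<omega>] C_nonneg unfolding norm_mult norm_of_real by (intro mult_mono) auto
      then have "ennreal (norm (of_real (w \<omega>) * (a x \<omega> * b x \<omega>))) \<le> ennreal (C * ((norm (a x \<omega>))\<^sup>2 + (norm (b x \<omega>))\<^sup>2))"
        by (rule ennreal_leI)
      then show "ennreal (norm (of_real (w \<omega>) * (a x \<omega> * b x \<omega>))) \<le>
          ennreal C * (ennreal ((norm (a x \<omega>))\<^sup>2) + ennreal ((norm (b x \<omega>))\<^sup>2))"
        using C_nonneg by (simp add: ennreal_mult)
    qed
    also have "\<dots> = ennreal C * (ennreal K + ennreal L)"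
      by (simp add: nn_integral_cmult nn_integral_add a b)
    finally show "(\<integral>\<^sup>+x. ennreal (norm (of_real (w \<omega>) * (a x \<omega> * b x \<omega>))) \<partial>lborel) \<le> ennreal C * (ennreal K + ennreal L)" .
  qed
  also have "\<dots> < \<infinity>" by (simp add: emeasure_space_1 ennreal_mult_less_top)
  finally show "(\<integral>\<^sup>+z. ennreal (norm (case z of (x, \<omega>) \<Rightarrow> of_real (w \<omega>) * (a x \<omega> * b x \<omega>))) \<partial>(lborel \<Otimes>\<^sub>M M)) < \<infinity>" .
qed measurable

text \<open>Translating a Fourier transform by \<open>X \<omega>\<close> multiplies
  \<open>\<psi>\<close> by a character; averaging the characters with weight \<open>w\<close>
  produces \<open>weighted_char\<close>.\<close>

lemma weighted_average_fourier:
  assumes \<psi>: "integrable lborel \<psi>"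
  shows "(\<integral>\<omega>. of_real (w \<omega>) * fourier \<psi> (x + X \<omega>) \<partial>M) = fourier (\<lambda>\<xi>. weighted_char M w X \<xi> * \<psi> \<xi>) x"
proof -
  interpret pair_sigma_finite "lborel :: 'a measure" M ..
  have [measurable]: "\<psi> \<in> borel_measurable borel" using \<psi> by auto
  let ?F = "\<lambda>\<xi> \<omega>. \<psi> \<xi> * echar x \<xi> * (of_real (w \<omega>) * echar (X \<omega>) \<xi>)"
  have "integrable M (\<lambda>_. complex_of_real C)" by simp
  note i0 = integrable_mult_pair[OF \<psi> this]
  have i: "integrable (lborel \<Otimes>\<^sub>M M) (\<lambda>(\<xi>, \<omega>). ?F \<xi> \<omega>)"
    by (rule Bochner_Integration.integrable_bound[OF i0])
      (use w_le C_nonneg in \<open>auto intro!: AE_I2 mult_left_mono simp: norm_mult\<close>)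
  have "(\<integral>\<omega>. of_real (w \<omega>) * fourier \<psi> (x + X \<omega>) \<partial>M) = (\<integral>\<omega>. (\<integral>\<xi>. ?F \<xi> \<omega> \<partial>lborel) \<partial>M)"
  proof (rule Bochner_Integration.integral_cong[OF refl])
    fix \<omega>
    show "of_real (w \<omega>) * fourier \<psi> (x + X \<omega>) = (\<integral>\<xi>. ?F \<xi> \<omega> \<partial>lborel)"
      unfolding fourier_def by (subst integral_mult_right_zero[symmetric])
        (simp only: inner_commute[of "x + X \<omega>"] inner_commute[of x] inner_commute[of "X \<omega>"] inner_add_right
          mult_ac exp_add[symmetric] of_real_add distrib_left minus_add_distrib inner_commute)
  qed
  also have "\<dots> = (\<integral>\<xi>. (\<integral>\<omega>. ?F \<xi> \<omega> \<partial>M) \<partial>lborel)"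
    by (rule Fubini_integral[OF i])
  also have "\<dots> = fourier (\<lambda>\<xi>. weighted_char M w X \<xi> * \<psi> \<xi>) x"
    unfolding fourier_def weighted_char_def
    by (intro Bochner_Integration.integral_cong refl, subst integral_mult_right_zero) (simp only: mult_ac inner_commute)
  finally show ?thesis .
qed

text \<open>The adjoint of averaging translates of \<open>f\<close> is averaging opposite translates
  of the transform of \<open>\<psi>\<close>, that is, multiplication of \<open>\<psi>\<close> by
  \<open>weighted_char\<close>. Asking only for L^1 and L^2 allows \<open>\<psi>\<close> to be a
  Schwartz function times the Bessel symbol.\<close>

lemma integral_weighted_translate_mult_fourier:
  assumes f: "f \<in> Lp 2"
    and \<psi>1: "integrable lborel \<psi>" and \<psi>2: "integrable lborel (\<lambda>x. (norm (\<psi> x))\<^sup>2)"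
  shows "(\<integral>x. weighted_translate M w X f x * fourier \<psi> x \<partial>lborel) =
    (\<integral>x. f x * fourier (\<lambda>\<xi>. weighted_char M w X \<xi> * \<psi> \<xi>) x \<partial>lborel)"
proof -
  interpret pair_sigma_finite "lborel :: 'a measure" M ..
  have [measurable]: "\<psi> \<in> borel_measurable borel" using \<psi>1 by auto
  have [measurable]: "f \<in> borel_measurable borel" and f2: "integrable lborel (\<lambda>x. (norm (f x))\<^sup>2)"
    using f by (auto simp: Lp_def)
  define \<Psi> where "\<Psi> = fourier \<psi>"
  have [measurable]: "\<Psi> \<in> borel_measurable borel" unfolding \<Psi>_def by measurable
  have \<Psi>2: "integrable lborel (\<lambda>x. (norm (\<Psi> x))\<^sup>2)"
    unfolding \<Psi>_def by (rule fourier_L2[OF \<psi>1 \<psi>2])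
  define K where "K = (\<integral>x. (norm (f x))\<^sup>2 \<partial>lborel)"
  define L where "L = (\<integral>x. (norm (\<Psi> x))\<^sup>2 \<partial>lborel)"
  have nf: "(\<integral>\<^sup>+x. ennreal ((norm (f x))\<^sup>2) \<partial>lborel) = ennreal K"
    using f2 by (simp add: K_def nn_integral_eq_integral)
  have n\<Psi>: "(\<integral>\<^sup>+x. ennreal ((norm (\<Psi> x))\<^sup>2) \<partial>lborel) = ennreal L"
    using \<Psi>2 by (simp add: L_def nn_integral_eq_integral)
  have i1: "integrable (lborel \<Otimes>\<^sub>M M) (\<lambda>(x, \<omega>). of_real (w \<omega>) * (f (x - X \<omega>) * \<Psi> x))"
    by (rule integrable_weighted_product[where K=K and L=L])
      (use nn_integral_lborel_translate[of "\<lambda>x. ennreal ((norm (f x))\<^sup>2)"] nf n\<Psi> in auto)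
  have i2: "integrable (lborel \<Otimes>\<^sub>M M) (\<lambda>(x, \<omega>). of_real (w \<omega>) * (f x * \<Psi> (x + X \<omega>)))"
    by (rule integrable_weighted_product[where K=K and L=L])
      (use nn_integral_lborel_translate[of "\<lambda>x. ennreal ((norm (\<Psi> x))\<^sup>2)" "- X \<omega>" for \<omega>] nf n\<Psi> in auto)
  have "(\<integral>x. weighted_translate M w X f x * \<Psi> x \<partial>lborel) =
      (\<integral>x. (\<integral>\<omega>. of_real (w \<omega>) * (f (x - X \<omega>) * \<Psi> x) \<partial>M) \<partial>lborel)"
    unfolding weighted_translate_def
    by (simp only: integral_mult_left_zero[symmetric] mult.assoc)
  also have "\<dots> = (\<integral>\<omega>. (\<integral>x. of_real (w \<omega>) * (f (x - X \<omega>) * \<Psi> x) \<partial>lborel) \<partial>M)"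
    by (rule Fubini_integral[OF i1, symmetric])
  also have "\<dots> = (\<integral>\<omega>. (\<integral>x. of_real (w \<omega>) * (f x * \<Psi> (x + X \<omega>)) \<partial>lborel) \<partial>M)"
  proof (rule Bochner_Integration.integral_cong[OF refl])
    fix \<omega>
    show "(\<integral>x. of_real (w \<omega>) * (f (x - X \<omega>) * \<Psi> x) \<partial>lborel) = (\<integral>x. of_real (w \<omega>) * (f x * \<Psi> (x + X \<omega>)) \<partial>lborel)"
      using integral_lborel_translate[of "\<lambda>x. of_real (w \<omega>) * (f (x - X \<omega>) * \<Psi> x)" "X \<omega>"] by auto
  qed
  also have "\<dots> = (\<integral>x. (\<integral>\<omega>. of_real (w \<omega>) * (f x * \<Psi> (x + X \<omega>)) \<partial>M) \<partial>lborel)"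
    by (rule Fubini_integral[OF i2])
  also have "\<dots> = (\<integral>x. f x * (\<integral>\<omega>. of_real (w \<omega>) * \<Psi> (x + X \<omega>) \<partial>M) \<partial>lborel)"
    by (simp only: integral_mult_right_zero[symmetric] mult.left_commute)
  finally show ?thesis unfolding \<Psi>_def weighted_average_fourier[OF \<psi>1] .
qed

end

section \<open>Uniqueness of Bessel derivatives\<close>

lemma integral_lborel_affine:
  fixes f :: "'a::euclidean_space \<Rightarrow> real"
  assumes [measurable]: "f \<in> borel_measurable borel" and s: "0 < s"
  shows "(\<integral>a. f a \<partial>lborel) = s ^ DIM('a) * (\<integral>z. f (x + s *\<^sub>R z) \<partial>lborel)"
  by (subst lborel_affine[of s x]) (use s in \<open>simp_all add: integral_density integral_distr\<close>)

lemma std_gauss_integral: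
  fixes f :: "'a::euclidean_space \<Rightarrow> real"
  assumes [measurable]: "f \<in> borel_measurable borel"
  shows "(\<integral>z. f z \<partial>std_gauss) = (\<integral>z. exp (- (1 / 2) * (norm z)\<^sup>2) * f z \<partial>lborel) / sqrt (2 * pi) ^ DIM('a)"
  unfolding std_gauss_def by (subst integral_density) auto

text \<open>A translated Gaussian is itself the transform of an integrable function, so by the
  multiplication formula \<open>k\<close> annihilates it, and hence also box indicators smoothed by
  a Gaussian of width \<open>s\<close>. As \<open>s\<close> tends to 0 the smoothed indicators
  converge off the frontier of the box.\<close>

lemma integral_box_eq_0_if_fourier_eq_0:
  fixes k :: "'a::euclidean_space \<Rightarrow> complex"
  assumes k: "integrable lborel k" and k0: "\<And>\<eta>. fourier k \<eta> = 0"
  shows "(\<integral>x. indicator (box l u) x *\<^sub>R k x \<partial>lborel) = 0"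
proof -
  have [measurable]: "k \<in> borel_measurable borel" using k by auto
  interpret G: prob_space "std_gauss :: 'a measure" by (rule prob_space_std_gauss)
  let ?I = "indicator (box l u) :: 'a \<Rightarrow> real"
  define h where "h s x = (\<integral>z. ?I (x + s *\<^sub>R z) \<partial>std_gauss)" for s x
  have [measurable]: "h s \<in> borel_measurable borel" for s
    unfolding h_def[abs_def] by measurable
  have zero: "(\<integral>x. k x * of_real (h s x) \<partial>lborel) = 0" if s: "0 < s" for s
  proof -
    \<comment> \<open>With this \<open>c\<close> the kernel \<open>e\<close> becomes exp (- |x -
      a|^2 / (2 s^2)), the Gaussian of width \<open>s\<close>.\<close>
    define c where "c = s\<^sup>2 / 2"
    have c: "0 < c" using s by (simp add: c_def)
    define e where "e x a = exp (- (1 / (4 * c)) * (norm (x - a))\<^sup>2)" for x a :: 'a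
    have [measurable]: "case_prod e \<in> borel_measurable (borel \<Otimes>\<^sub>M borel)"
      unfolding e_def[abs_def] by measurable
    have e0: "(\<integral>x. k x * of_real (e x a) \<partial>lborel) = 0" for a
    proof -
      have "(\<integral>x. k x * fourier (\<lambda>\<xi>. of_real (exp (- c * (norm \<xi>)\<^sup>2)) * echar \<xi> (- a)) x \<partial>lborel) = 0"
        unfolding integral_mult_fourier[OF k integrable_gauss_modulated[OF c]] k0 by simp
      then have "(\<integral>x. of_real (sqrt (pi / c) ^ DIM('a)) * (k x * of_real (e x a)) \<partial>lborel) = 0"
        unfolding fourier_gauss_modulated[OF c] by (simp add: e_def mult_ac)
      then show ?thesis using c by simp
    qed
    have h: "h s x = (\<integral>a. ?I a * e x a \<partial>lborel) / (s ^ DIM('a) * sqrt (2 * pi) ^ DIM('a))" for x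
    proof -
      have "(\<integral>a. ?I a * e x a \<partial>lborel) = s ^ DIM('a) * (\<integral>z. ?I (x + s *\<^sub>R z) * e x (x + s *\<^sub>R z) \<partial>lborel)"
        by (rule integral_lborel_affine) (use s in auto)
      also have "(\<lambda>z. ?I (x + s *\<^sub>R z) * e x (x + s *\<^sub>R z)) = (\<lambda>z. exp (- (1 / 2) * (norm z)\<^sup>2) * ?I (x + s *\<^sub>R z))"
        using s by (simp add: e_def c_def fun_eq_iff power_mult_distrib)
      finally show ?thesis
        unfolding h_def using s by (subst std_gauss_integral) auto
    qed
    have I: "integrable lborel (\<lambda>a. complex_of_real (?I a))"
      using integrable_real_indicator[of "box l u" lborel] emeasure_bounded_finite[OF bounded_box[of l u]] by simp
    have i: "integrable (lborel \<Otimes>\<^sub>M lborel) (\<lambda>(x, a). k x * of_real (?I a) * of_real (e x a))"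
      by (rule Bochner_Integration.integrable_bound[OF lborel_pair.integrable_mult_pair[OF k I]])
        (use c in \<open>auto intro!: AE_I2 mult_left_le simp: norm_mult e_def\<close>)
    have "(\<integral>x. (\<integral>a. k x * of_real (?I a) * of_real (e x a) \<partial>lborel) \<partial>lborel) =
      (\<integral>a. (\<integral>x. k x * of_real (?I a) * of_real (e x a) \<partial>lborel) \<partial>lborel)"
      by (rule lborel_pair.Fubini_integral[OF i, symmetric])
    also have "\<dots> = 0"
    proof -
      have "(\<integral>x. k x * of_real (?I a) * of_real (e x a) \<partial>lborel) = of_real (?I a) * (\<integral>x. k x * of_real (e x a) \<partial>lborel)" for a
        by (subst integral_mult_right_zero[symmetric]) (simp only: mult_ac)
      then show ?thesis by (simp add: e0)
    qed
    finally have "(\<integral>x. k x * of_real (\<integral>a. ?I a * e x a \<partial>lborel) \<partial>lborel) = 0"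
      by (simp only: mult.assoc integral_mult_right_zero of_real_mult[symmetric] integral_complex_of_real)
    then show ?thesis
      unfolding h by (simp only: of_real_divide times_divide_eq_right integral_divide_zero div_0)
  qed
  have hle: "\<bar>h s x\<bar> \<le> 1" for s x
  proof -
    have "\<bar>h s x\<bar> \<le> (\<integral>z. \<bar>?I (x + s *\<^sub>R z)\<bar> \<partial>std_gauss)" unfolding h_def by (rule integral_abs_bound)
    also have "\<dots> \<le> (\<integral>z. 1 \<partial>(std_gauss :: 'a measure))"
      by (intro integral_mono G.integrable_const_bound[where B=1]) (auto split: split_indicator)
    finally show ?thesis using G.prob_space by simp
  qed
  have conv: "(\<lambda>n. h (1 / real (Suc n)) x) \<longlonglongrightarrow> ?I x" if x: "x \<notin> frontier (box l u)" for x
  proof -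
    have "(\<lambda>n. h (1 / real (Suc n)) x) \<longlonglongrightarrow> (\<integral>z. ?I x \<partial>(std_gauss :: 'a measure))"
      unfolding h_def
    proof (rule integral_dominated_convergence[where w = "\<lambda>_. 1"])
      have "(\<lambda>n. ?I (x + (1 / real (Suc n)) *\<^sub>R z)) \<longlonglongrightarrow> ?I x" for z
      proof -
        have "(\<lambda>n. x + (1 / real (Suc n)) *\<^sub>R z) \<longlonglongrightarrow> x + 0 *\<^sub>R z"
          using LIMSEQ_inverse_real_of_nat by (intro tendsto_intros) (simp add: inverse_eq_divide)
        then have lim: "(\<lambda>n. x + (1 / real (Suc n)) *\<^sub>R z) \<longlonglongrightarrow> x" by simp
        show ?thesis
        proof (cases "x \<in> box l u")
          case True
          then have "\<forall>\<^sub>F n in sequentially. x + (1 / real (Suc n)) *\<^sub>R z \<in> box l u"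
            using topological_tendstoD[OF lim open_box] by blast
          then have "\<forall>\<^sub>F n in sequentially. ?I (x + (1 / real (Suc n)) *\<^sub>R z) = ?I x"
            by eventually_elim (use True in simp)
          then show ?thesis by (rule tendsto_eventually)
        next
          case False
          then have "x \<in> - closure (box l u)"
            using x interior_subset[of "box l u"] by (auto simp: frontier_def)
          then have "\<forall>\<^sub>F n in sequentially. x + (1 / real (Suc n)) *\<^sub>R z \<in> - closure (box l u)"
            by (rule topological_tendstoD[OF lim, rotated]) (rule open_Compl, rule closed_closure)
          then have "\<forall>\<^sub>F n in sequentially. ?I (x + (1 / real (Suc n)) *\<^sub>R z) = ?I x"
            by eventually_elim (use False closure_subset[of "box l u"] in \<open>auto simp: indicator_def\<close>)
          then show ?thesis by (rule tendsto_eventually)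
        qed
      qed
      then show "AE z in std_gauss. (\<lambda>n. ?I (x + (1 / real (Suc n)) *\<^sub>R z)) \<longlonglongrightarrow> ?I x" by simp
    qed (auto split: split_indicator)
    then show ?thesis using G.prob_space by simp
  qed
  \<comment> \<open>The exceptional points of the convergence form the frontier of a convex set,
    which is negligible.\<close>
  have "AE x in lborel. x \<notin> frontier (box l u)"
  proof -
    have "frontier (box l u) \<in> null_sets lborel"
      using negligible_convex_frontier[OF convex_box(2)[of l u]]
      by (simp add: negligible_iff_null_sets null_sets_completion_iff)
    then show ?thesis by (rule AE_not_in)
  qed
  then have "AE x in lborel. (\<lambda>n. k x * of_real (h (1 / real (Suc n)) x)) \<longlonglongrightarrow> k x * of_real (?I x)"
    by eventually_elim (intro tendsto_intros conv)
  then have "(\<lambda>n. \<integral>x. k x * of_real (h (1 / real (Suc n)) x) \<partial>lborel) \<longlonglongrightarrow> (\<integral>x. k x * of_real (?I x) \<partial>lborel)"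
    by (intro integral_dominated_convergence[where w = "\<lambda>x. norm (k x)"])
      (use k hle in \<open>auto intro!: AE_I2 mult_left_le simp: norm_mult\<close>)
  then have "(\<integral>x. k x * of_real (?I x) \<partial>lborel) = 0"
    by (simp add: zero LIMSEQ_const_iff)
  then show ?thesis by (simp add: scaleR_conv_of_real mult.commute)
qed

text \<open>Boxes are stable under intersection and generate the Borel sets, so the sets over which
  \<open>k\<close> integrates to 0 are all Borel sets.\<close>

lemma fourier_eq_0_imp_AE_eq_0:
  fixes k :: "'a::euclidean_space \<Rightarrow> complex"
  assumes k: "integrable lborel k" and k0: "\<And>\<eta>. fourier k \<eta> = 0"
  shows "AE x in lborel. k x = 0"
proof (rule sigma_finite_measure.density_zero[OF lborel.sigma_finite_measure_axioms k])
  fix A :: "'a set" assume "A \<in> sets lborel"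
  then have A: "A \<in> sigma_sets UNIV (range (\<lambda>(a, b). box a b))"
    by (simp add: borel_eq_box)
  have b: "B \<in> sets borel" if "B \<in> sigma_sets UNIV (range (\<lambda>(a, b). box a b :: 'a set))" for B
    using that by (simp add: borel_eq_box)
  have "set_integrable lborel B k" if "B \<in> sets borel" for B
    unfolding set_integrable_def using that k by (intro integrable_mult_indicator) auto
  note int = this
  \<comment> \<open>Frequency 0 gives the integral over the whole space, which the complement step
    needs.\<close>
  have all: "(\<integral>x. k x \<partial>lborel) = 0" using k0[of 0] by (simp add: fourier_def)
  show "set_lebesgue_integral lborel A k = 0"
  proof (rule sigma_sets_induct_disjoint[OF _ _ A])
    show "Int_stable (range (\<lambda>(a, b). box a b :: 'a set))"
      by (auto simp: Int_stable_def box_Int_box)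
    show "set_lebesgue_integral lborel B k = 0" if "B \<in> range (\<lambda>(a, b). box a b)" for B
      using that integral_box_eq_0_if_fourier_eq_0[OF k k0] by (auto simp: set_lebesgue_integral_def)
    show "set_lebesgue_integral lborel (UNIV - B) k = 0"
      if "B \<in> sigma_sets UNIV (range (\<lambda>(a, b). box a b))" "set_lebesgue_integral lborel B k = 0" for B
    proof -
      have "set_lebesgue_integral lborel (B \<union> (UNIV - B)) k =
          set_lebesgue_integral lborel B k + set_lebesgue_integral lborel (UNIV - B) k"
        using b[OF that(1)] by (intro set_integral_Un int) auto
      then show ?thesis using that(2) all by (simp add: set_lebesgue_integral_def)
    qed
    show "set_lebesgue_integral lborel (\<Union>i. B i) k = 0"
      if "disjoint_family B" "range B \<subseteq> sigma_sets UNIV (range (\<lambda>(a, b). box a b))"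
        "\<And>i. set_lebesgue_integral lborel (B i) k = 0" for B :: "nat \<Rightarrow> 'a set"
    proof (subst lebesgue_integral_countable_add)
      have B: "B i \<in> sets borel" for i using that(2) b by blast
      then show "B i \<in> sets lborel" for i by simp
      show "B i \<inter> B j = {}" if "i \<noteq> j" for i j
        using \<open>disjoint_family B\<close> that by (auto simp: disjoint_family_on_def)
      show "set_integrable lborel (\<Union>i. B i) k" using B by (intro int) auto
    qed (simp add: that(3))
  qed (auto simp: set_lebesgue_integral_def)
qed

section \<open>Gaussians are Schwartz functions\<close>

lemma real_polynomial_function_has_derivative:
  fixes P :: "'a::real_normed_vector \<Rightarrow> real"
  assumes "real_polynomial_function P"
  shows "\<exists>P'. (\<forall>x. (P has_derivative P' x) (at x)) \<and> (\<forall>b. real_polynomial_function (\<lambda>x. P' x b))"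
  using assms
proof induction
  case (linear f)
  then show ?case
    by (intro exI[of _ "\<lambda>_. f"]) (auto intro: bounded_linear_imp_has_derivative)
next
  case (const c)
  then show ?case by (intro exI[of _ "\<lambda>_ _. 0"]) auto
next
  case (add f g)
  then obtain f' g' where "\<forall>x. (f has_derivative f' x) (at x)" "\<forall>b. real_polynomial_function (\<lambda>x. f' x b)"
    "\<forall>x. (g has_derivative g' x) (at x)" "\<forall>b. real_polynomial_function (\<lambda>x. g' x b)"
    by blast
  then show ?case
    by (intro exI[of _ "\<lambda>x b. f' x b + g' x b"]) (auto intro: has_derivative_add)
next
  case (mult f g)
  then obtain f' g' where "\<forall>x. (f has_derivative f' x) (at x)" "\<forall>b. real_polynomial_function (\<lambda>x. f' x b)"
    "\<forall>x. (g has_derivative g' x) (at x)" "\<forall>b. real_polynomial_function (\<lambda>x. g' x b)"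
    by blast
  with mult.hyps show ?case
    by (intro exI[of _ "\<lambda>x b. f x * g' x b + f' x b * g x"] conjI allI
        has_derivative_mult real_polynomial_function.intros(3,4)) auto
qed

lemma real_polynomial_function_bound:
  fixes P :: "'a::real_normed_vector \<Rightarrow> real"
  assumes "real_polynomial_function P"
  shows "\<exists>C n. \<forall>x. \<bar>P x\<bar> \<le> C * (1 + norm x) ^ n"
  using assms
proof induction
  case (linear f)
  have "\<bar>f x\<bar> \<le> onorm f * (1 + norm x) ^ 1" for x
    using onorm[OF linear, of x] onorm_pos_le[OF linear] by (simp add: distrib_left)
  then show ?case by blast
next
  case (const c)
  have "\<forall>x::'a. \<bar>c\<bar> \<le> \<bar>c\<bar> * (1 + norm x) ^ 0" by simp
  then show ?case by blast
next
  case (add f g)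
  then obtain C n D m where f: "\<And>x. \<bar>f x\<bar> \<le> C * (1 + norm x) ^ n" and g: "\<And>x. \<bar>g x\<bar> \<le> D * (1 + norm x) ^ m"
    by blast
  have "\<bar>f x + g x\<bar> \<le> (\<bar>C\<bar> + \<bar>D\<bar>) * (1 + norm x) ^ (n + m)" for x
  proof -
    have "\<bar>f x\<bar> \<le> \<bar>C\<bar> * (1 + norm x) ^ (n + m)"
      by (rule order_trans[OF f mult_mono]) (auto intro: power_increasing)
    moreover have "\<bar>g x\<bar> \<le> \<bar>D\<bar> * (1 + norm x) ^ (n + m)"
      by (rule order_trans[OF g mult_mono]) (auto intro: power_increasing)
    ultimately show ?thesis by (simp add: distrib_right)
  qed
  then show ?case by blast
next
  case (mult f g)
  then obtain C n D m where f: "\<And>x. \<bar>f x\<bar> \<le> C * (1 + norm x) ^ n" and g: "\<And>x. \<bar>g x\<bar> \<le> D * (1 + norm x) ^ m"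
    by blast
  have "\<bar>f x * g x\<bar> \<le> (C * D) * (1 + norm x) ^ (n + m)" for x
    using mult_mono[OF f g order_trans[OF abs_ge_zero f] abs_ge_zero, of x x]
    by (simp add: abs_mult power_add mult_ac)
  then show ?case by blast
qed

text \<open>One term of the exponential series bounds (1 + r)^m by m! exp (1 + r), and (r - 1)^2
  \<ge> 0 gives 1 + r - r^2 / 2 \<le> 3 / 2.\<close>

lemma polynomial_mult_exp_bounded:
  fixes r :: real
  assumes "0 \<le> r"
  shows "(1 + r) ^ m * exp (- (1 / 2) * r\<^sup>2) \<le> fact m * exp (3 / 2)"
proof -
  have "(1 + r) ^ m / fact m \<le> exp (1 + r)"
  proof -
    have "(1 + r) ^ m /\<^sub>R fact m \<le> (\<Sum>n. (1 + r) ^ n /\<^sub>R fact n)"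
      using sum_le_suminf[OF summable_exp_generic[of "1 + r"], of "{m}"] assms by simp
    then show ?thesis by (simp add: exp_def divide_inverse mult.commute)
  qed
  then have "(1 + r) ^ m \<le> fact m * exp (1 + r)" by (simp add: field_simps)
  then have "(1 + r) ^ m * exp (- (1 / 2) * r\<^sup>2) \<le> fact m * exp (1 + r) * exp (- (1 / 2) * r\<^sup>2)"
    by (rule mult_right_mono) simp
  also have "\<dots> = fact m * exp (1 + r - r\<^sup>2 / 2)"
    by (simp add: exp_add[symmetric] mult.assoc)
  also have "\<dots> \<le> fact m * exp (3 / 2)"
  proof -
    have "0 \<le> (r - 1)\<^sup>2" by simp
    then have "1 + r - r\<^sup>2 / 2 \<le> 3 / 2" by (simp add: power2_eq_square algebra_simps)
    then show ?thesis by simp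
  qed
  finally show ?thesis .
qed

text \<open>Polynomial multiples of a Gaussian centred at \<open>\<eta>\<close>: a class that
  contains the Gaussian and is closed under differentiation, so that induction over the list of
  derivatives goes through.\<close>

definition poly_gauss :: "'a::euclidean_space \<Rightarrow> ('a \<Rightarrow> real) \<Rightarrow> 'a \<Rightarrow> complex" where
  "poly_gauss \<eta> P x = of_real (P x * exp (- (1 / 2) * (norm (x - \<eta>))\<^sup>2))"

lemma poly_gauss_has_derivative:
  fixes P :: "'a::euclidean_space \<Rightarrow> real"
  assumes P: "real_polynomial_function P"
  obtains Q where "\<And>b. real_polynomial_function (Q b)"
    "\<And>x. (poly_gauss \<eta> P has_derivative (\<lambda>b. poly_gauss \<eta> (Q b) x)) (at x)"
proof -
  obtain P' where P': "\<And>x. (P has_derivative P' x) (at x)" "\<And>b. real_polynomial_function (\<lambda>x. P' x b)"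
    using real_polynomial_function_has_derivative[OF P] by blast
  \<comment> \<open>The product rule: the derivative of \<open>P\<close> in direction
    \<open>b\<close> minus \<open>P\<close> times (x - \<eta>) \<bullet> b. It is spelled with sums
    and constant factors to match the introduction rules for polynomial functions.\<close>
  define Q where "Q b x = P' x b + P x * (- 1 * (x \<bullet> b + - (\<eta> \<bullet> b)))" for b x
  have "real_polynomial_function (Q b)" for b
    unfolding Q_def[abs_def]
    by (intro real_polynomial_function.intros P' P bounded_linear_inner_left)
  moreover have "(poly_gauss \<eta> P has_derivative (\<lambda>b. poly_gauss \<eta> (Q b) x)) (at x)" for x
  proof -
    have "((\<lambda>x. P x * exp (- (1 / 2) * ((x - \<eta>) \<bullet> (x - \<eta>)))) has_derivative
      (\<lambda>b. P x * (exp (- (1 / 2) * ((x - \<eta>) \<bullet> (x - \<eta>))) * (- (1 / 2) * ((x - \<eta>) \<bullet> b + b \<bullet> (x - \<eta>))))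
        + P' x b * exp (- (1 / 2) * ((x - \<eta>) \<bullet> (x - \<eta>))))) (at x)"
      by (auto intro!: derivative_eq_intros P'(1) simp: mult_ac)
    also have "(\<lambda>b. P x * (exp (- (1 / 2) * ((x - \<eta>) \<bullet> (x - \<eta>))) * (- (1 / 2) * ((x - \<eta>) \<bullet> b + b \<bullet> (x - \<eta>))))
        + P' x b * exp (- (1 / 2) * ((x - \<eta>) \<bullet> (x - \<eta>)))) =
        (\<lambda>b. Q b x * exp (- (1 / 2) * ((x - \<eta>) \<bullet> (x - \<eta>))))"
      by (simp add: Q_def fun_eq_iff inner_commute inner_diff_left algebra_simps)
    finally show ?thesis
      unfolding poly_gauss_def[abs_def] power2_norm_eq_inner by (rule has_derivative_of_real)
  qed
  ultimately show thesis by (rule that)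
qed

lemma iterated_deriv_poly_gauss:
  fixes P :: "'a::euclidean_space \<Rightarrow> real"
  assumes P: "real_polynomial_function P"
  shows "\<exists>Q. real_polynomial_function Q \<and> iterated_deriv bs (poly_gauss \<eta> P) = poly_gauss \<eta> Q"
proof (induction bs)
  case Nil
  then show ?case using P by auto
next
  case (Cons b bs)
  then obtain Q where Q: "real_polynomial_function Q" "iterated_deriv bs (poly_gauss \<eta> P) = poly_gauss \<eta> Q"
    by blast
  obtain R where R: "\<And>b. real_polynomial_function (R b)"
    "\<And>x. (poly_gauss \<eta> Q has_derivative (\<lambda>b. poly_gauss \<eta> (R b) x)) (at x)"
    by (rule poly_gauss_has_derivative[OF Q(1)]) blast
  have "iterated_deriv (b # bs) (poly_gauss \<eta> P) = poly_gauss \<eta> (R b)"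
    by (simp add: Q(2) fun_eq_iff frechet_derivative_at[OF R(2), symmetric])
  then show ?case using R(1) by blast
qed

lemma poly_gauss_bounded:
  fixes P :: "'a::euclidean_space \<Rightarrow> real"
  assumes P: "real_polynomial_function P"
  shows "bounded (range (\<lambda>x. norm x ^ k *\<^sub>R poly_gauss \<eta> P x))"
proof -
  obtain C n where C: "\<And>x. \<bar>P x\<bar> \<le> C * (1 + norm x) ^ n"
    using real_polynomial_function_bound[OF P] by blast
  have C0: "0 \<le> C" using order_trans[OF abs_ge_zero C[of 0]] by simp
  let ?m = "k + n"
  let ?K = "C * (1 + norm \<eta>) ^ ?m * (fact ?m * exp (3 / 2))"
  have "norm (norm x ^ k *\<^sub>R poly_gauss \<eta> P x) \<le> ?K" for x
  proof -
    let ?r = "norm (x - \<eta>)"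
    \<comment> \<open>Recentring at \<open>\<eta>\<close>: powers of 1 + |x| are traded for powers
      of 1 + |x - \<eta>|, which the Gaussian absorbs.\<close>
    have "1 + norm x \<le> (1 + norm \<eta>) * (1 + ?r)"
      using norm_triangle_sub[of x \<eta>] mult_nonneg_nonneg[OF norm_ge_zero[of \<eta>] norm_ge_zero[of "x - \<eta>"]]
      unfolding distrib_left distrib_right by linarith
    then have le: "(1 + norm x) ^ ?m \<le> (1 + norm \<eta>) ^ ?m * (1 + ?r) ^ ?m"
      unfolding power_mult_distrib[symmetric] by (rule power_mono) simp
    have "norm (norm x ^ k *\<^sub>R poly_gauss \<eta> P x) = norm x ^ k * \<bar>P x\<bar> * exp (- (1 / 2) * ?r\<^sup>2)"
      by (simp add: poly_gauss_def norm_mult abs_mult norm_power del: of_real_mult of_real_exp)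
    also have "\<dots> \<le> (1 + norm x) ^ k * (C * (1 + norm x) ^ n) * exp (- (1 / 2) * ?r\<^sup>2)"
      by (intro mult_right_mono mult_mono C power_mono) auto
    also have "\<dots> = C * (1 + norm x) ^ ?m * exp (- (1 / 2) * ?r\<^sup>2)"
      by (simp add: power_add)
    also have "\<dots> \<le> C * ((1 + norm \<eta>) ^ ?m * (1 + ?r) ^ ?m) * exp (- (1 / 2) * ?r\<^sup>2)"
      by (intro mult_right_mono mult_left_mono le C0) simp
    also have "\<dots> = C * (1 + norm \<eta>) ^ ?m * ((1 + ?r) ^ ?m * exp (- (1 / 2) * ?r\<^sup>2))"
      by (simp only: mult_ac)
    also have "\<dots> \<le> ?K"
      using C0 by (intro mult_left_mono polynomial_mult_exp_bounded) auto
    finally show ?thesis .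
  qed
  then show ?thesis by (intro boundedI[of _ ?K]) auto
qed

lemma schwartz_gauss: "schwartz (poly_gauss \<eta> (\<lambda>_. 1))"
  unfolding schwartz_def
proof (intro allI impI conjI)
  fix bs :: "'a list" and x :: 'a and k :: nat
  obtain Q where Q: "real_polynomial_function Q" "iterated_deriv bs (poly_gauss \<eta> (\<lambda>_. 1)) = poly_gauss \<eta> Q"
    using iterated_deriv_poly_gauss[OF real_polynomial_function.intros(2)] by blast
  show "iterated_deriv bs (poly_gauss \<eta> (\<lambda>_. 1)) differentiable at x"
    unfolding Q(2) by (rule poly_gauss_has_derivative[OF Q(1)]) (blast intro: differentiableI)
  show "bounded (range (\<lambda>x. norm x ^ k *\<^sub>R iterated_deriv bs (poly_gauss \<eta> (\<lambda>_. 1)) x))"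
    unfolding Q(2) by (rule poly_gauss_bounded[OF Q(1)])
qed

lemma fourier_gauss_translate:
  fixes \<eta> :: "'a::euclidean_space"
  shows "fourier (poly_gauss \<eta> (\<lambda>_. 1)) x =
    echar x \<eta> * of_real (sqrt (2 * pi) ^ DIM('a) * exp (- (1 / 2) * (norm x)\<^sup>2))"
proof -
  have "fourier (poly_gauss \<eta> (\<lambda>_. 1)) x = (\<integral>\<xi>. poly_gauss \<eta> (\<lambda>_. 1) (\<xi> + \<eta>) * echar (\<xi> + \<eta>) x \<partial>lborel)"
    unfolding fourier_def by (rule integral_lborel_translate[symmetric]) (unfold poly_gauss_def[abs_def], measurable)
  also have "\<dots> = (\<integral>\<xi>. echar \<eta> x * (of_real (exp (- (1 / 2) * (norm \<xi>)\<^sup>2)) * echar \<xi> x) \<partial>lborel)"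
    unfolding echar_add by (simp add: poly_gauss_def mult_ac)
  also have "\<dots> = echar \<eta> x * of_real (sqrt (pi / (1 / 2)) ^ DIM('a) * exp (- (norm x)\<^sup>2 / (4 * (1 / 2))))"
    using gauss_fourier[of "1 / 2" x] by (simp only: integral_mult_right_zero has_bochner_integral_iff)
  finally show ?thesis by (simp add: inner_commute mult.commute)
qed

text \<open>From |f| \<le> 1 + |f|^p and the bound 1 for the Gaussian, one majorant serves every p
  \<ge> 1.\<close>

lemma integrable_Lp_mult_gauss:
  fixes f :: "'a::euclidean_space \<Rightarrow> complex"
  assumes f: "f \<in> Lp p" and p: "1 \<le> p"
  shows "integrable lborel (\<lambda>x. f x * of_real (exp (- (1 / 2) * (norm x)\<^sup>2)))"
proof -
  have [measurable]: "f \<in> borel_measurable borel" and i: "integrable lborel (\<lambda>x. norm (f x) powr p)"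
    using f by (auto simp: Lp_def)
  have "integrable lborel (\<lambda>x::'a. exp (- (1 / 2) * (norm x)\<^sup>2) + norm (f x) powr p)"
    using gauss_integral[of "1 / 2", where 'a='a] i by (auto simp: has_bochner_integral_iff)
  then show ?thesis
  proof (rule Bochner_Integration.integrable_bound)
    show "AE x in lborel. norm (f x * of_real (exp (- (1 / 2) * (norm x)\<^sup>2))) \<le>
      norm (exp (- (1 / 2) * (norm x)\<^sup>2) + norm (f x) powr p)"
    proof (rule AE_I2)
      fix x :: 'a
      let ?e = "exp (- (1 / 2) * (norm x)\<^sup>2)"
      have "norm (f x) * ?e \<le> (1 + norm (f x) powr p) * ?e"
        by (intro mult_right_mono le_one_add_powr p) auto
      also have "\<dots> \<le> ?e + norm (f x) powr p"
        by (simp add: distrib_right mult_left_le)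
      finally show "norm (f x * of_real ?e) \<le> norm (?e + norm (f x) powr p)"
        by (simp add: norm_mult)
    qed
  qed simp
qed

text \<open>The transform of a Gaussian centred at \<eta> is a character in \<eta> times a fixed
  Gaussian. Testing with all of these reads off the Fourier transform of \<open>g1\<close> and of
  \<open>g2\<close> after damping, and the damped functions are integrable although
  \<open>g1\<close> and \<open>g2\<close> lie only in L^p.\<close>

lemma is_bessel_derivative_unique:
  fixes f g1 g2 :: "'a::euclidean_space \<Rightarrow> complex"
  assumes p: "1 \<le> p" and g: "g1 \<in> Lp p" "g2 \<in> Lp p"
    and b: "is_bessel_derivative \<sigma> f g1" "is_bessel_derivative \<sigma> f g2"
  shows "AE x in lborel. g1 x = g2 x"
proof -
  let ?e = "\<lambda>x::'a. complex_of_real (exp (- (1 / 2) * (norm x)\<^sup>2))"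
  let ?c = "complex_of_real (sqrt (2 * pi) ^ DIM('a))"
  have i: "integrable lborel (\<lambda>x. g1 x * ?e x)" "integrable lborel (\<lambda>x. g2 x * ?e x)"
    by (rule integrable_Lp_mult_gauss[OF _ p], fact)+
  have *: "(\<integral>x. h x * fourier (poly_gauss \<eta> (\<lambda>_. 1)) x \<partial>lborel) = ?c * fourier (\<lambda>x. h x * ?e x) \<eta>" for h \<eta>
    unfolding fourier_gauss_translate unfolding fourier_def
    by (subst integral_mult_right_zero[symmetric]) (simp only: of_real_mult mult_ac)
  have "AE x in lborel. g1 x * ?e x - g2 x * ?e x = 0"
  proof (rule fourier_eq_0_imp_AE_eq_0)
    show "integrable lborel (\<lambda>x. g1 x * ?e x - g2 x * ?e x)"
      by (intro Bochner_Integration.integrable_diff i)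
    fix \<eta> :: 'a
    have "?c * fourier (\<lambda>x. g1 x * ?e x) \<eta> = ?c * fourier (\<lambda>x. g2 x * ?e x) \<eta>"
      using b schwartz_gauss[of \<eta>] unfolding is_bessel_derivative_def dist_fourier_def dist_of_def *[symmetric]
      by simp
    then have "fourier (\<lambda>x. g1 x * ?e x) \<eta> = fourier (\<lambda>x. g2 x * ?e x) \<eta>" by simp
    then show "fourier (\<lambda>x. g1 x * ?e x - g2 x * ?e x) \<eta> = 0"
      using integrable_mult_echar(1)[OF i(1)] integrable_mult_echar(1)[OF i(2)]
      unfolding fourier_def by (simp only: left_diff_distrib Bochner_Integration.integral_diff diff_self)
  qed
  then show ?thesis by eventually_elim simp
qed

lemma schwartz_bessel_bound:
  fixes \<phi> :: "'a::euclidean_space \<Rightarrow> complex"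
  assumes \<phi>: "schwartz \<phi>"
  obtains D where "\<And>\<xi>. norm (bessel_symbol \<sigma> \<xi> * \<phi> \<xi>) \<le> D * (1 / (1 + (norm \<xi>)\<^sup>2) ^ DIM('a))"
proof -
  have bd: "bounded (range (\<lambda>x. norm x ^ k *\<^sub>R \<phi> x))" for k :: nat
    using \<phi>[unfolded schwartz_def, rule_format, of "[]"] by simp
  obtain m0 :: nat where m0: "\<sigma> / 2 \<le> real m0" using real_arch_simple by blast
  \<comment> \<open>The first summand absorbs the growth of the Bessel symbol, the second leaves a
    power of 1 + |\<xi>|^2 that is integrable.\<close>
  define m where "m = m0 + DIM('a)"
  obtain A where A: "\<And>x. norm (norm x ^ 0 *\<^sub>R \<phi> x) \<le> A"
    using bd[of 0] unfolding bounded_iff by blast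
  obtain B where B: "\<And>x. norm (norm x ^ (2 * m) *\<^sub>R \<phi> x) \<le> B"
    using bd[of "2 * m"] unfolding bounded_iff by blast
  have "norm (bessel_symbol \<sigma> \<xi> * \<phi> \<xi>) \<le> 2 ^ m * (A + B) * (1 / (1 + (norm \<xi>)\<^sup>2) ^ DIM('a))" for \<xi>
  proof -
    let ?q = "1 + (norm \<xi>)\<^sup>2"
    have q: "1 \<le> ?q" by simp
    have "?q powr (\<sigma> / 2) \<le> ?q powr (real m0)" using m0 q by (intro powr_mono) auto
    also have "\<dots> = ?q ^ m0" by (rule powr_realpow[OF less_le_trans[OF zero_less_one q]])
    also have "\<dots> = ?q ^ m * (1 / ?q ^ DIM('a))"
      using less_le_trans[OF zero_less_one q] by (simp add: m_def power_add)
    finally have 1: "?q powr (\<sigma> / 2) \<le> ?q ^ m * (1 / ?q ^ DIM('a))" .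
    have "?q ^ m \<le> (2 * max 1 ((norm \<xi>)\<^sup>2)) ^ m"
      by (rule power_mono) auto
    also have "\<dots> \<le> 2 ^ m * (1 + norm \<xi> ^ (2 * m))"
      by (auto simp: power_mult_distrib power_mult max_def)
    finally have 2: "?q ^ m \<le> 2 ^ m * (1 + norm \<xi> ^ (2 * m))" .
    have "?q ^ m * norm (\<phi> \<xi>) \<le> 2 ^ m * (1 + norm \<xi> ^ (2 * m)) * norm (\<phi> \<xi>)"
      by (rule mult_right_mono[OF 2]) simp
    also have "\<dots> = 2 ^ m * (norm (norm \<xi> ^ 0 *\<^sub>R \<phi> \<xi>) + norm (norm \<xi> ^ (2 * m) *\<^sub>R \<phi> \<xi>))"
      by (simp add: algebra_simps norm_power)
    also have "\<dots> \<le> 2 ^ m * (A + B)"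
      by (intro mult_left_mono add_mono A B) simp
    finally have 3: "?q ^ m * norm (\<phi> \<xi>) \<le> 2 ^ m * (A + B)" .
    have "norm (bessel_symbol \<sigma> \<xi> * \<phi> \<xi>) = ?q powr (\<sigma> / 2) * norm (\<phi> \<xi>)"
      by (simp add: bessel_symbol_def norm_mult)
    also have "\<dots> \<le> ?q ^ m * (1 / ?q ^ DIM('a)) * norm (\<phi> \<xi>)"
      by (rule mult_right_mono[OF 1]) simp
    also have "\<dots> = ?q ^ m * norm (\<phi> \<xi>) * (1 / ?q ^ DIM('a))" by (simp only: mult_ac)
    also have "\<dots> \<le> 2 ^ m * (A + B) * (1 / ?q ^ DIM('a))"
      by (rule mult_right_mono[OF 3]) simp
    finally show ?thesis .
  qed
  then show thesis by (rule that)
qed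

text \<open>Supplies the L^1 and L^2 conditions for both sides of the derivative identity; \<sigma>
  = 0 covers the Schwartz function itself.\<close>

lemma schwartz_bessel_integrable:
  fixes \<phi> :: "'a::euclidean_space \<Rightarrow> complex"
  assumes \<phi>: "schwartz \<phi>"
  shows "integrable lborel (\<lambda>\<xi>. bessel_symbol \<sigma> \<xi> * \<phi> \<xi>)"
    and "integrable lborel (\<lambda>\<xi>. (norm (bessel_symbol \<sigma> \<xi> * \<phi> \<xi>))\<^sup>2)"
proof -
  have "continuous_on UNIV \<phi>"
    using \<phi>[unfolded schwartz_def, rule_format, of "[]"]
    by (auto intro!: continuous_at_imp_continuous_on differentiable_imp_continuous_within)
  then have [measurable]: "\<phi> \<in> borel_measurable borel" by (rule borel_measurable_continuous_onI)
  have [measurable]: "bessel_symbol \<sigma> \<in> borel_measurable (borel :: 'a measure)"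
    unfolding bessel_symbol_def[abs_def] by measurable
  obtain D where D: "\<And>\<xi>. norm (bessel_symbol \<sigma> \<xi> * \<phi> \<xi>) \<le> D * (1 / (1 + (norm \<xi>)\<^sup>2) ^ DIM('a))"
    by (rule schwartz_bessel_bound[OF \<phi>, of \<sigma>]) blast
  have D0: "0 \<le> D" using order_trans[OF norm_ge_zero D[of 0]] by simp
  have i: "integrable lborel (\<lambda>\<xi>::'a. D * (1 / (1 + (norm \<xi>)\<^sup>2) ^ DIM('a)))"
    by (intro integrable_mult_right integrable_inverse_power_norm)
  show 1: "integrable lborel (\<lambda>\<xi>. bessel_symbol \<sigma> \<xi> * \<phi> \<xi>)"
    by (rule Bochner_Integration.integrable_bound[OF i])
      (use D0 in \<open>auto intro!: AE_I2 order_trans[OF D] simp del: norm_mult\<close>)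
  have D1: "norm (bessel_symbol \<sigma> \<xi> * \<phi> \<xi>) \<le> D" for \<xi>
    by (rule order_trans[OF D mult_left_le]) (use D0 in \<open>auto simp: divide_le_eq intro!: one_le_power\<close>)
  show "integrable lborel (\<lambda>\<xi>. (norm (bessel_symbol \<sigma> \<xi> * \<phi> \<xi>))\<^sup>2)"
    by (rule Bochner_Integration.integrable_bound[OF integrable_mult_right[OF integrable_norm[OF 1], of D]])
      (use D0 in \<open>auto intro!: AE_I2 mult_right_mono D1 simp: power2_eq_square simp del: norm_mult\<close>)
qed

section \<open>Factorization of the heat semigroup\<close>

lemma measurable_uminus_lebesgue: "uminus \<in> lebesgue \<rightarrow>\<^sub>M (lebesgue :: 'a::euclidean_space measure)"
  using lebesgue_affine_measurable[of "\<lambda>_. - 1" "0 :: 'a"]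
  by (simp add: sum_negf euclidean_representation)

lemma distr_lebesgue_uminus: "distr lebesgue lebesgue uminus = (lebesgue :: 'a::euclidean_space measure)"
  using lebesgue_affine_euclidean[of "\<lambda>_. - 1" "0 :: 'a"]
  by (simp add: sum_negf euclidean_representation density_1)

lemma borel_measurable_lebesgue: "f \<in> borel_measurable borel \<Longrightarrow> f \<in> borel_measurable lebesgue"
  for f :: "'a::euclidean_space \<Rightarrow> 'b::topological_space"
  by (rule measurable_completion) simp

text \<open>The kernel is only Lebesgue measurable, so the density is taken over the completed
  measure; the image under the identity then restricts it to Borel sets.\<close>

definition levy_measure :: "('a::euclidean_space \<Rightarrow> real) \<Rightarrow> 'a measure" where
  "levy_measure K = distr (density lebesgue (\<lambda>z. ennreal (K z))) borel (\<lambda>z. z)"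

lemma sets_levy_measure [simp]: "sets (levy_measure K) = sets borel"
  by (simp add: levy_measure_def)

context
  fixes K :: "'a::euclidean_space \<Rightarrow> real"
  assumes K: "levy_kernel K"
begin

lemma levy_kernel_measurable: "K \<in> borel_measurable lebesgue"
  using K by (simp add: levy_kernel_def)

lemma levy_kernel_nonneg: "0 \<le> K z"
  using K by (simp add: levy_kernel_def)

lemma measurable_ident_density_lebesgue: "(\<lambda>z. z) \<in> measurable (density lebesgue (\<lambda>z. ennreal (K z))) borel"
  using measurable_completion[of "\<lambda>z. z" lborel borel] by simp

lemma integral_levy_measure:
  fixes f :: "'a \<Rightarrow> real"
  assumes f: "f \<in> borel_measurable borel"
  shows "(\<integral>z. f z \<partial>levy_measure K) = (\<integral>z. f z * K z \<partial>lebesgue)"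
    and "integrable (levy_measure K) f \<longleftrightarrow> integrable lebesgue (\<lambda>z. f z * K z)"
  unfolding levy_measure_def
  using borel_measurable_lebesgue[OF f] levy_kernel_measurable levy_kernel_nonneg
  by (simp_all add: integral_distr[OF measurable_ident_density_lebesgue f] integral_density
      integrable_distr_eq[OF measurable_ident_density_lebesgue f] integrable_density mult.commute)

lemma distr_levy_measure_uminus: "distr (levy_measure K) borel uminus = levy_measure K"
proof (rule measure_eqI)
  fix S assume "S \<in> sets (distr (levy_measure K) borel uminus)"
  then have S[measurable]: "S \<in> sets borel" by simp
  have mK: "(\<lambda>z. ennreal (K z)) \<in> borel_measurable lebesgue"
    using levy_kernel_measurable by simp
  have e: "emeasure (levy_measure K) T = (\<integral>\<^sup>+z. ennreal (K z) * indicator T z \<partial>lebesgue)" if T[measurable]: "T \<in> sets borel" for T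
  proof -
    have "T \<in> sets lebesgue" using T by simp
    then show ?thesis
      unfolding levy_measure_def using emeasure_distr[OF measurable_ident_density_lebesgue T]
      by (simp add: emeasure_density[OF mK])
  qed
  have mS: "(\<lambda>z. ennreal (K z) * indicator S z) \<in> borel_measurable lebesgue"
    using mK borel_measurable_lebesgue[of "indicator S :: 'a \<Rightarrow> ennreal"] by simp
  have m': "uminus -` S \<in> sets borel"
    using measurable_sets[of uminus "borel :: 'a measure" borel S] by simp
  have "emeasure (distr (levy_measure K) borel uminus) S = emeasure (levy_measure K) (uminus -` S)"
    by (subst emeasure_distr) (auto simp: levy_measure_def)
  also have "\<dots> = (\<integral>\<^sup>+z. ennreal (K z) * indicator (uminus -` S) z \<partial>lebesgue)"
    by (rule e[OF m'])
  also have "\<dots> = (\<integral>\<^sup>+z. ennreal (K (- z)) * indicator S (- z) \<partial>lebesgue)"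
    using K by (simp add: levy_kernel_def indicator_def)
  also have "\<dots> = (\<integral>\<^sup>+z. ennreal (K z) * indicator S z \<partial>distr lebesgue lebesgue uminus)"
    using nn_integral_distr[OF measurable_uminus_lebesgue, of "\<lambda>z. ennreal (K z) * indicator S z"] mS by simp
  also have "\<dots> = emeasure (levy_measure K) S"
    by (simp add: distr_lebesgue_uminus e)
  finally show "emeasure (distr (levy_measure K) borel uminus) S = emeasure (levy_measure K) S" .
qed simp

text \<open>Time is absorbed into the kernel, so the laws below need to be built at time 1
  only.\<close>

lemma levy_kernel_scale: "0 \<le> t \<Longrightarrow> levy_kernel (\<lambda>z. t * K z)"
  using K by (auto simp: levy_kernel_def mult.left_commute)

lemma levy_symbol_scale: "levy_symbol (\<lambda>z. t * K z) \<xi> = t * levy_symbol K \<xi>"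
  by (simp add: levy_symbol_def mult.left_commute)

lemma integrable_one_minus_cos: "integrable lebesgue (\<lambda>z. (1 - cos (z \<bullet> \<xi>)) * K z)"
proof (rule Bochner_Integration.integrable_bound)
  show "integrable lebesgue (\<lambda>z. (2 + (norm \<xi>)\<^sup>2) * (min 1 ((norm z)\<^sup>2) * K z))"
    using K by (auto simp: levy_kernel_def)
  show "(\<lambda>z. (1 - cos (z \<bullet> \<xi>)) * K z) \<in> borel_measurable lebesgue"
    using borel_measurable_lebesgue[of "\<lambda>z. 1 - cos (z \<bullet> \<xi>)"] levy_kernel_measurable by simp
  show "AE z in lebesgue. norm ((1 - cos (z \<bullet> \<xi>)) * K z) \<le> norm ((2 + (norm \<xi>)\<^sup>2) * (min 1 ((norm z)\<^sup>2) * K z))"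
    using mult_right_mono[OF one_minus_cos_le levy_kernel_nonneg] levy_kernel_nonneg
    by (intro AE_I2) (simp add: abs_mult mult_ac)
qed

end

lemma levy_heat_law_exists:
  fixes K :: "'a::euclidean_space \<Rightarrow> real"
  assumes K: "levy_kernel K"
  obtains \<rho> where "prob_space \<rho>" "sets \<rho> = sets borel"
    "\<And>\<xi>. fourier_measure \<rho> \<xi> = of_real (exp (- levy_symbol K \<xi>))"
proof -
  have "integrable (levy_measure K) (\<lambda>z. min 1 ((norm z)\<^sup>2))"
    using K by (subst integral_levy_measure(2)) (auto simp: levy_kernel_def)
  then obtain \<rho> where \<rho>: "prob_space \<rho>" "sets \<rho> = sets borel"
    "\<And>\<xi>. fourier_measure \<rho> \<xi> = of_real (exp (- (\<integral>z. 1 - cos (z \<bullet> \<xi>) \<partial>levy_measure K)))"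
    by (rule infinitely_divisible[OF sets_levy_measure distr_levy_measure_uminus[OF K]]) blast
  moreover have "(\<integral>z. 1 - cos (z \<bullet> \<xi>) \<partial>levy_measure K) = levy_symbol K \<xi>" for \<xi>
    using K by (subst integral_levy_measure(1)) (auto simp: levy_symbol_def)
  ultimately show thesis by (intro that[of \<rho>]) auto
qed

text \<open>With b the mass of \<open>B\<close>, the transform of its Levy measure is b - m, where m
  is the symbol. The sign -1 in the compound Poisson formula gives exp (- (b - m) - b), whence the
  factor 2.\<close>

lemma finite_negative_law_exists:
  fixes B :: "'a::euclidean_space \<Rightarrow> real"
  assumes B: "levy_kernel B" and Bi: "integrable lebesgue B"
  obtains M :: "(nat \<times> (nat \<Rightarrow> 'a)) measure" and N :: "nat \<times> (nat \<Rightarrow> 'a) \<Rightarrow> nat"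
    and X :: "nat \<times> (nat \<Rightarrow> 'a) \<Rightarrow> 'a"
  where "prob_space M" "N \<in> measurable M (count_space UNIV)" "X \<in> borel_measurable M"
    "\<And>\<xi>. (\<integral>\<omega>. (- 1) ^ N \<omega> * echar (X \<omega>) \<xi> \<partial>M) =
      of_real (exp (levy_symbol B \<xi> - 2 * (\<integral>z. B z \<partial>lebesgue)))"
proof -
  let ?\<nu> = "levy_measure B"
  have sp: "space ?\<nu> = UNIV" by (rule space_eq_UNIV) simp
  have 1: "integrable ?\<nu> (\<lambda>_. 1 :: real)"
    using Bi B by (subst integral_levy_measure(2)) auto
  have fin: "finite_measure ?\<nu>"
  proof
    show "emeasure ?\<nu> (space ?\<nu>) \<noteq> \<infinity>"
      using 1 by (auto simp: integrable_iff_bounded less_top)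
  qed
  have tot: "measure ?\<nu> UNIV = (\<integral>z. B z \<partial>lebesgue)"
    using integral_levy_measure(1)[OF B, of "\<lambda>_. 1"] sp by simp
  obtain M :: "(nat \<times> (nat \<Rightarrow> 'a)) measure" and N X
    where M: "prob_space M" "N \<in> measurable M (count_space UNIV)" "X \<in> borel_measurable M"
    and *: "\<And>s \<xi>. \<bar>s\<bar> \<le> 1 \<Longrightarrow> (\<integral>\<omega>. of_real s ^ N \<omega> * echar (X \<omega>) \<xi> \<partial>M) =
      exp (of_real s * (\<integral>z. echar z \<xi> \<partial>?\<nu>) - of_real (measure ?\<nu> UNIV))"
    by (rule compound_poisson[OF fin sets_levy_measure]) blast
  show thesis
  proof (rule that[OF M])
    fix \<xi> :: 'a
    have "integrable ?\<nu> (\<lambda>z. cos (z \<bullet> \<xi>))"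
      by (rule finite_measure.integrable_const_bound[OF fin, where B=1]) (auto simp: measurable_cong_sets[OF sets_levy_measure refl])
    then have "(\<integral>z. 1 - cos (z \<bullet> \<xi>) \<partial>?\<nu>) = measure ?\<nu> UNIV - (\<integral>z. cos (z \<bullet> \<xi>) \<partial>?\<nu>)"
      using 1 sp by simp
    moreover have "(\<integral>z. 1 - cos (z \<bullet> \<xi>) \<partial>?\<nu>) = levy_symbol B \<xi>"
      using B by (subst integral_levy_measure(1)) (auto simp: levy_symbol_def)
    ultimately have "(\<integral>z. echar z \<xi> \<partial>?\<nu>) = of_real ((\<integral>z. B z \<partial>lebesgue) - levy_symbol B \<xi>)"
      using symmetric_measure_integral_echar[OF fin sets_levy_measure distr_levy_measure_uminus[OF B], of \<xi>]
      by (simp add: tot)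
    then show "(\<integral>\<omega>. (- 1) ^ N \<omega> * echar (X \<omega>) \<xi> \<partial>M) =
      of_real (exp (levy_symbol B \<xi> - 2 * (\<integral>z. B z \<partial>lebesgue)))"
      using *[of "- 1" \<xi>] by (simp add: tot exp_of_real[symmetric] del: of_real_diff) (simp add: algebra_simps)
  qed
qed

text \<open>On the product space the displacements of the two independent parts add and their
  transforms multiply. The constant in the weight cancels exp (- 2 b), with b the mass of
  \<open>B\<close>, and is therefore the bound \<open>C\<close> of the locale.\<close>

lemma weighted_law_exists:
  fixes K B :: "'a::euclidean_space \<Rightarrow> real"
  assumes K: "levy_kernel K" and B: "levy_kernel B" "integrable lebesgue B"
  obtains M :: "('a \<times> nat \<times> (nat \<Rightarrow> 'a)) measure" and w X
  where "weighted_translation M w X (exp (2 * (\<integral>z. B z \<partial>lebesgue)))"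
    "\<And>\<xi>. weighted_char M w X \<xi> = of_real (exp (levy_symbol B \<xi> - levy_symbol K \<xi>))"
proof -
  obtain \<rho> where \<rho>: "prob_space \<rho>" "sets \<rho> = sets borel"
    "\<And>\<xi>. fourier_measure \<rho> \<xi> = of_real (exp (- levy_symbol K \<xi>))"
    by (rule levy_heat_law_exists[OF K]) blast
  obtain M :: "(nat \<times> (nat \<Rightarrow> 'a)) measure" and N X where M: "prob_space M"
    and [measurable]: "N \<in> measurable M (count_space UNIV)" "X \<in> borel_measurable M"
    and *: "\<And>\<xi>. (\<integral>\<omega>. (- 1) ^ N \<omega> * echar (X \<omega>) \<xi> \<partial>M) =
      of_real (exp (levy_symbol B \<xi> - 2 * (\<integral>z. B z \<partial>lebesgue)))"
    by (rule finite_negative_law_exists[OF B]) blast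
  have [measurable_cong]: "sets \<rho> = sets borel" by fact
  interpret R: prob_space \<rho> by fact
  interpret M: prob_space M by fact
  interpret pair_prob_space \<rho> M ..
  let ?C = "exp (2 * (\<integral>z. B z \<partial>lebesgue))"
  define W where "W = (\<lambda>(y :: 'a, \<omega>). ?C * (- 1) ^ N \<omega>)"
  define Y where "Y = (\<lambda>(y, \<omega>). y + X \<omega>)"
  show thesis
  proof (rule that)
    show wt: "weighted_translation (\<rho> \<Otimes>\<^sub>M M) W Y ?C"
    proof
      show "W \<in> borel_measurable (\<rho> \<Otimes>\<^sub>M M)" unfolding W_def by measurable
      show "Y \<in> borel_measurable (\<rho> \<Otimes>\<^sub>M M)" unfolding Y_def by measurable
      show "\<bar>W \<omega>\<bar> \<le> ?C" for \<omega> by (simp add: W_def abs_mult power_abs split: prod.split)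
    qed
    fix \<xi> :: 'a
    have i1: "integrable \<rho> (\<lambda>y. echar y \<xi>)"
      by (rule R.integrable_const_bound[where B=1]) auto
    have i2: "integrable M (\<lambda>\<omega>. of_real ?C * ((- 1) ^ N \<omega> * echar (X \<omega>) \<xi>))"
      by (rule M.integrable_const_bound[where B="?C"]) (auto simp: norm_mult norm_power)
    have "weighted_char (\<rho> \<Otimes>\<^sub>M M) W Y \<xi> =
      (\<integral>(y, \<omega>). echar y \<xi> * (of_real ?C * ((- 1) ^ N \<omega> * echar (X \<omega>) \<xi>)) \<partial>(\<rho> \<Otimes>\<^sub>M M))"
      unfolding weighted_char_def W_def Y_def
      by (intro Bochner_Integration.integral_cong refl) (simp add: case_prod_unfold echar_add mult_ac)
    also have "\<dots> = (\<integral>y. (\<integral>\<omega>. echar y \<xi> * (of_real ?C * ((- 1) ^ N \<omega> * echar (X \<omega>) \<xi>)) \<partial>M) \<partial>\<rho>)"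
      by (rule integral_fst[symmetric]) (rule integrable_mult_pair[OF i1 i2])
    also have "\<dots> = fourier_measure \<rho> \<xi> * (of_real ?C * (\<integral>\<omega>. (- 1) ^ N \<omega> * echar (X \<omega>) \<xi> \<partial>M))"
      unfolding fourier_measure_def by (simp only: integral_mult_right_zero integral_mult_left_zero)
    also have "\<dots> = of_real (exp (levy_symbol B \<xi> - levy_symbol K \<xi>))"
      unfolding * \<rho>(3) of_real_mult[symmetric] exp_add[symmetric] by simp
    finally show "weighted_char (\<rho> \<Otimes>\<^sub>M M) W Y \<xi> = of_real (exp (levy_symbol B \<xi> - levy_symbol K \<xi>))" .
  qed
qed

theorem theorem6p6:
  fixes J :: "'a::euclidean_space \<Rightarrow> real"
    and u0 :: "'a \<Rightarrow> complex"
    and u :: "real \<Rightarrow> 'a \<Rightarrow> complex"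
    and p :: real
  assumes "levy_kernel J"
    and "1 \<le> p"
    and "u0 \<in> Lp 2 \<inter> Lp p"
    and "levy_solution J u0 u"
    and "\<forall>z. z \<noteq> 0 \<and> norm z < 1 \<longrightarrow> J_log z \<le> J z"
  shows "(\<forall>t>0. u t \<in> bessel_space 2 (2 * t) \<inter> bessel_space p (2 * t)) \<and>
    ((\<forall>z. z \<noteq> 0 \<longrightarrow> J_log z \<le> J z) \<longrightarrow>
       (\<forall>t>0. bessel_norm p (2 * t) (u t) \<le> Lp_norm p u0))"
proof -
  note J = \<open>levy_kernel J\<close> and p = \<open>1 \<le> p\<close>
  have u2: "u0 \<in> Lp 2" and up: "u0 \<in> Lp p" using assms(3) by auto
  \<comment> \<open>Positive and negative part of \<open>J - J_log\<close>, set to 0 at the origin,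
    where the value of \<open>J_log\<close> is only a default.\<close>
  define K where "K z = (if z = 0 then 0 else max 0 (J z - J_log z))" for z :: 'a
  define B where "B z = (if z = 0 then 0 else max 0 (J_log z - J z))" for z :: 'a
  have Jm: "J \<in> borel_measurable lebesgue" and J0: "\<And>z. 0 \<le> J z" and Js: "\<And>z. J (- z) = J z"
    and Ji: "integrable lebesgue (\<lambda>z. min 1 ((norm z)\<^sup>2) * J z)"
    using J by (auto simp: levy_kernel_def)
  have Lm: "(J_log :: 'a \<Rightarrow> real) \<in> borel_measurable lebesgue"
    and Li: "integrable lebesgue (\<lambda>z::'a. min 1 ((norm z)\<^sup>2) * J_log z)"
    using levy_kernel_J_log by (auto simp: levy_kernel_def)
  have Km: "K \<in> borel_measurable lebesgue"
    unfolding K_def[abs_def] using Jm Lm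
    by (intro measurable_If borel_measurable_max borel_measurable_diff) auto
  have Bm: "B \<in> borel_measurable lebesgue"
    unfolding B_def[abs_def] using Jm Lm
    by (intro measurable_If borel_measurable_max borel_measurable_diff) auto
  have mm: "(\<lambda>z::'a. min 1 ((norm z)\<^sup>2)) \<in> borel_measurable lebesgue"
    by (rule borel_measurable_lebesgue) simp
  have Kb: "0 \<le> K z" "K z \<le> J z" for z
    using J0[of z] J_log_nonneg[of z] by (auto simp: K_def)
  have Bb: "0 \<le> B z" "B z \<le> J_log z" for z
    using J0[of z] J_log_nonneg[of z] by (auto simp: B_def)
  have K: "levy_kernel K"
    unfolding levy_kernel_def
  proof (intro conjI allI Km)
    show "integrable lebesgue (\<lambda>z. min 1 ((norm z)\<^sup>2) * K z)"
      by (rule Bochner_Integration.integrable_bound[OF Ji])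
        (use mm Km Kb J0 in \<open>auto intro!: AE_I2 mult_left_mono simp: abs_mult\<close>)
  qed (auto simp: K_def Js J_log_minus)
  have iB: "integrable lebesgue (\<lambda>z. min 1 ((norm z)\<^sup>2) * B z)"
    by (rule Bochner_Integration.integrable_bound[OF Li])
      (use mm Bm Bb in \<open>auto intro!: AE_I2 mult_left_mono simp: abs_mult abs_of_nonneg[OF J_log_nonneg]\<close>)
  have B: "levy_kernel B"
    unfolding levy_kernel_def by (intro conjI allI Bm iB) (auto simp: B_def Js J_log_minus)
  \<comment> \<open>Inside the unit ball \<open>B\<close> vanishes by the comparison hypothesis,
    outside it the minimum is 1; so the Levy condition for \<open>B\<close> is plain
    integrability.\<close>
  have "min 1 ((norm z)\<^sup>2) * B z = B z" for z
    using assms(5) by (cases "norm z < 1") (auto simp: B_def min_def one_le_power)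
  then have Bi: "integrable lebesgue B" using iB by (simp only:)
  \<comment> \<open>The decomposition of \<open>J\<close> may fail at z = 0, where the factor 1 -
    cos is 0.\<close>
  have sym: "levy_symbol J \<xi> = ln (1 + (norm \<xi>)\<^sup>2) + levy_symbol K \<xi> - levy_symbol B \<xi>" for \<xi>
  proof -
    have "levy_symbol J \<xi> = (\<integral>z. (1 - cos (z \<bullet> \<xi>)) * J_log z + (1 - cos (z \<bullet> \<xi>)) * K z - (1 - cos (z \<bullet> \<xi>)) * B z \<partial>lebesgue)"
      unfolding levy_symbol_def
      by (intro Bochner_Integration.integral_cong refl) (auto simp: K_def B_def max_def algebra_simps)
    also have "\<dots> = levy_symbol J_log \<xi> + levy_symbol K \<xi> - levy_symbol B \<xi>"
      unfolding levy_symbol_def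
      using integrable_one_minus_cos[OF levy_kernel_J_log, of \<xi>]
        integrable_one_minus_cos[OF K, of \<xi>] integrable_one_minus_cos[OF B, of \<xi>]
      by (simp only: Bochner_Integration.integral_diff Bochner_Integration.integral_add Bochner_Integration.integrable_add)
    finally show ?thesis by (simp add: levy_symbol_J_log)
  qed
  \<comment> \<open>One and the same \<open>g\<close> serves L^2 and L^p, and its bound keeps the
    mass of \<open>B\<close> so that both claims of the theorem can be read off.\<close>
  have main: "u t \<in> Lp q" "\<exists>g. g \<in> Lp 2 \<and> g \<in> Lp p \<and> is_bessel_derivative (2 * t) (u t) g \<and>
      Lp_norm p g \<le> exp (2 * t * (\<integral>z. B z \<partial>lebesgue)) * Lp_norm p u0"
    if t: "0 < t" and q: "q = 2 \<or> q = p" for t q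
  proof -
    obtain \<mu> where \<mu>: "levy_heat_measure J t \<mu>" "u t = measure_convolution \<mu> u0"
      using assms(4) t unfolding levy_solution_def by (meson less_imp_le)
    have \<mu>s[measurable_cong]: "sets \<mu> = sets borel" and \<mu>p: "prob_space \<mu>"
      and \<mu>f: "\<And>\<xi>. fourier_measure \<mu> \<xi> = of_real (exp (- t * levy_symbol J \<xi>))"
      using \<mu>(1) by (auto simp: levy_heat_measure_def)
    \<comment> \<open>The solution itself is an average of translates, with weight 1 and
      displacement law \<open>\<mu>\<close>.\<close>
    interpret U: weighted_translation \<mu> "\<lambda>_. 1" "\<lambda>y. y" 1
      by (intro weighted_translation.intro \<mu>p weighted_translation_axioms.intro) auto
    have uT: "u t = weighted_translate \<mu> (\<lambda>_. 1) (\<lambda>y. y) u0"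
      by (simp add: \<mu>(2) measure_convolution_def[abs_def] weighted_translate_def[abs_def])
    show "u t \<in> Lp q" unfolding uT using q p u2 up by (auto intro!: U.weighted_translate_Lp)
    obtain M :: "('a \<times> nat \<times> (nat \<Rightarrow> 'a)) measure" and w X where
      wt: "weighted_translation M w X (exp (2 * (\<integral>z. t * B z \<partial>lebesgue)))" and
      wc: "\<And>\<xi>. weighted_char M w X \<xi> = of_real (exp (levy_symbol (\<lambda>z. t * B z) \<xi> - levy_symbol (\<lambda>z. t * K z) \<xi>))"
      by (rule weighted_law_exists[OF levy_kernel_scale[OF K, of t] levy_kernel_scale[OF B, of t]])
        (use t Bi in auto)
    interpret W: weighted_translation M w X "exp (2 * (\<integral>z. t * B z \<partial>lebesgue))" by (rule wt)
    define g where "g = weighted_translate M w X u0"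
    have "is_bessel_derivative (2 * t) (u t) g"
      unfolding is_bessel_derivative_def
    proof (intro allI impI)
      fix \<phi> :: "'a \<Rightarrow> complex" assume \<phi>: "schwartz \<phi>"
      have 0: "bessel_symbol 0 \<xi> * \<phi> \<xi> = \<phi> \<xi>" for \<xi>
        by (simp add: bessel_symbol_def add_nonneg_eq_0_iff)
      have "dist_fourier (dist_of g) \<phi> = (\<integral>x. u0 x * fourier (\<lambda>\<xi>. weighted_char M w X \<xi> * \<phi> \<xi>) x \<partial>lborel)"
        unfolding dist_fourier_def dist_of_def g_def
        using schwartz_bessel_integrable[OF \<phi>, of 0] unfolding 0
        by (rule W.integral_weighted_translate_mult_fourier[OF u2])
      \<comment> \<open>Both sides of the derivative identity pair \<open>u0\<close> with a
        transform, so it remains to match the multipliers pointwise: the power (1 + |\<xi>|^2)^t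
        cancels the share of \<open>J_log\<close> in the exponent of \<open>\<mu>\<close>.\<close>
      also have "(\<lambda>\<xi>. weighted_char M w X \<xi> * \<phi> \<xi>) =
        (\<lambda>\<xi>. weighted_char \<mu> (\<lambda>_. 1) (\<lambda>y. y) \<xi> * (bessel_symbol (2 * t) \<xi> * \<phi> \<xi>))"
      proof
        fix \<xi> :: 'a
        have "0 < 1 + (norm \<xi>)\<^sup>2" by (simp add: add_pos_nonneg)
        then have "exp (t * levy_symbol B \<xi> - t * levy_symbol K \<xi>) =
          exp (- t * levy_symbol J \<xi>) * (1 + (norm \<xi>)\<^sup>2) powr t"
          by (simp add: sym powr_def exp_add[symmetric] algebra_simps)
        moreover have "weighted_char \<mu> (\<lambda>_. 1) (\<lambda>y. y) \<xi> = fourier_measure \<mu> \<xi>"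
          by (simp add: weighted_char_def fourier_measure_def)
        ultimately show "weighted_char M w X \<xi> * \<phi> \<xi> =
            weighted_char \<mu> (\<lambda>_. 1) (\<lambda>y. y) \<xi> * (bessel_symbol (2 * t) \<xi> * \<phi> \<xi>)"
          by (simp only: wc \<mu>f levy_symbol_scale[OF K] levy_symbol_scale[OF B] bessel_symbol_def of_real_mult mult.assoc) simp
      qed
      also have "(\<integral>x. u0 x * fourier (\<lambda>\<xi>. weighted_char \<mu> (\<lambda>_. 1) (\<lambda>y. y) \<xi> * (bessel_symbol (2 * t) \<xi> * \<phi> \<xi>)) x \<partial>lborel) =
        dist_mult (bessel_symbol (2 * t)) (dist_fourier (dist_of (u t))) \<phi>"
        unfolding dist_mult_def dist_fourier_def dist_of_def uT
        by (rule U.integral_weighted_translate_mult_fourier[symmetric, OF u2 schwartz_bessel_integrable[OF \<phi>]])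
      finally show "dist_fourier (dist_of g) \<phi> = dist_mult (bessel_symbol (2 * t)) (dist_fourier (dist_of (u t))) \<phi>" .
    qed
    moreover have "g \<in> Lp 2" "g \<in> Lp p" unfolding g_def using p u2 up by (auto intro!: W.weighted_translate_Lp)
    moreover have "Lp_norm p g \<le> exp (2 * t * (\<integral>z. B z \<partial>lebesgue)) * Lp_norm p u0"
      using W.weighted_translate_Lp(2)[OF p up] by (simp add: g_def mult.assoc)
    ultimately show "\<exists>g. g \<in> Lp 2 \<and> g \<in> Lp p \<and> is_bessel_derivative (2 * t) (u t) g \<and>
      Lp_norm p g \<le> exp (2 * t * (\<integral>z. B z \<partial>lebesgue)) * Lp_norm p u0" by blast
  qed
  have "u t \<in> bessel_space 2 (2 * t) \<inter> bessel_space p (2 * t)" if "0 < t" for t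
    using main(1)[OF that, of 2] main(1)[OF that, of p] main(2)[OF that, of p] by (auto simp: bessel_space_def)
  moreover have "bessel_norm p (2 * t) (u t) \<le> Lp_norm p u0" if le: "\<forall>z. z \<noteq> 0 \<longrightarrow> J_log z \<le> J z" and t: "0 < t" for t
  proof -
    \<comment> \<open>Under the global comparison the constant in the bound for \<open>g\<close>
      becomes exp 0 = 1.\<close>
    have "B = (\<lambda>_. 0)" using le by (auto simp: B_def fun_eq_iff)
    then obtain g where g: "g \<in> Lp p" "is_bessel_derivative (2 * t) (u t) g" "Lp_norm p g \<le> Lp_norm p u0"
      using main(2)[OF t, of p] by auto
    \<comment> \<open>\<open>bessel_norm\<close> is evaluated at a choice that need not be
      \<open>g\<close>; uniqueness almost everywhere transfers the bound.\<close>
    define g' where "g' = bessel_derivative p (2 * t) (u t)"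
    have "g' \<in> Lp p \<and> is_bessel_derivative (2 * t) (u t) g'"
      unfolding g'_def bessel_derivative_def by (rule someI[of _ g]) (use g in simp)
    then have g': "g' \<in> Lp p" "is_bessel_derivative (2 * t) (u t) g'" by auto
    have ae: "AE x in lborel. g' x = g x"
      by (rule is_bessel_derivative_unique[OF p g'(1) g(1) g'(2) g(2)])
    have "(\<integral>x. norm (g' x) powr p \<partial>lborel) = (\<integral>x. norm (g x) powr p \<partial>lborel)"
      using ae g(1) g'(1) by (intro integral_cong_AE) (auto simp: Lp_def)
    then have "Lp_norm p g' = Lp_norm p g" by (simp add: Lp_norm_def)
    then show ?thesis using g(3) by (simp add: bessel_norm_def g'_def)
  qed
  ultimately show ?thesis by blast
qed

end
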